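(* Let $k$ be a field, $\Lambda$ a finite-dimensional $k$-algebra and $X\in\mathsf{mod}\,\Lambda$. The following conditions are equivalent. (1) $\operatorname{ddell}_\Lambda X\le 1$. (2) There is an exact sequence $0\to K\to C\to X\to 0$ in $\mathsf{mod}\,\Lambda$ with $K\in\mathcal G_2(\Lambda)$ and $\Omega_\Lambda C\in\mathcal G_2(\Lambda)$. (3) There exists $Q\in\mathsf{proj}\,\Lambda$ such that $\Omega_\Lambda X\oplus Q\in\mathcal G_2(\Lambda)*\mathcal G_2(\Lambda)$.
   Context: $\mathsf{mod}\,\Lambda$ is the category of finitely generated right $\Lambda$-modules, $\mathsf{proj}\,\Lambda$ its full subcategory of finitely generated projectives, $\underline{\mathsf{mod}}\,\Lambda$ the stable category (quotient of $\mathsf{mod}\,\Lambda$ by morphisms factoring through projectives), and $\Omega_\Lambda X$ the kernel of a projective cover of $X$. For $r\ge1$ and $X\in\mathsf{mod}\,\Lambda$, let $r\text{-}\operatorname{dell}_\Lambda X$ be the infimum of the integers $n\ge0$ such that $\Omega_\Lambda^nX$ is a retract of $\Omega_\Lambda^{n+r}Y$ in $\underline{\mathsf{mod}}\,\Lambda$ for some $Y\in\mathsf{mod}\,\Lambda$. The derived delooping level $\operatorname{ddell}_\Lambda X$ is the infimum of the integers $m\ge0$ for which there are $0\le n\le m$ and an exact sequence $0\to C_n\to C_{n-1}\to\cdots\to C_0\to X\to0$ in $\mathsf{mod}\,\Lambda$ with $(i+1)\text{-}\operatorname{dell}_\Lambda C_i\le m-i$ for all $0\le i\le n$. The infimum of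 the empty set is $\infty$. $\mathcal G_2(\Lambda)=\mathsf{add}\bigl(\mathsf{proj}\,\Lambda\cup\{\Omega_\Lambda^2Y\mid Y\in\mathsf{mod}\,\Lambda\}\bigr)$, where $\mathsf{add}$ denotes closure under finite direct sums and direct summands. For full subcategories $\mathcal U,\mathcal V\subseteq\mathsf{mod}\,\Lambda$, $\mathcal U*\mathcal V$ consists of the modules $E$ for which there is a short exact sequence $0\to U\to E\to V\to0$ with $U\in\mathcal U$, $V\in\mathcal V$. *)

theory Defs
  imports "HOL-Library.Extended_Nat" "HOL-Algebra.AbelCoset" "HOL-Algebra.Module"
begin

section \<open>Finite-dimensional algebras and finitely generated right modules\<close>

definition finitely_generated :: "('a, 'r) ring_scheme \<Rightarrow> ('a, 'm) module \<Rightarrow> bool" where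
  "finitely_generated R M \<longleftrightarrow>
     (\<exists>B. finite B \<and> B \<subseteq> carrier M \<and>
        (\<forall>x\<in>carrier M. \<exists>c \<in> B \<rightarrow> carrier R. x = (\<Oplus>\<^bsub>M\<^esub>b\<in>B. c b \<odot>\<^bsub>M\<^esub> b)))"

text \<open>
  The library's \<open>algebra\<close> is commutative; here \<open>A\<close> is an arbitrary unital associative ring
  (possibly zero). The two compatibility laws say that \<open>K\<close> acts through the centre of \<open>A\<close>.
\<close>
locale fd_algebra = field K + Module.module K A + A: ring A
  for K :: "('k, 'z) ring_scheme" and A :: "('k, 'a) module" +
  assumes smult_mult_left:
      "\<lbrakk>c \<in> carrier K; x \<in> carrier A; y \<in> carrier A\<rbrakk>
        \<Longrightarrow> (c \<odot>\<^bsub>A\<^esub> x) \<otimes>\<^bsub>A\<^esub> y = c \<odot>\<^bsub>A\<^esub> (x \<otimes>\<^bsub>A\<^esub> y)"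
    and smult_mult_right:
      "\<lbrakk>c \<in> carrier K; x \<in> carrier A; y \<in> carrier A\<rbrakk>
        \<Longrightarrow> x \<otimes>\<^bsub>A\<^esub> (c \<odot>\<^bsub>A\<^esub> y) = c \<odot>\<^bsub>A\<^esub> (x \<otimes>\<^bsub>A\<^esub> y)"
    and finite_dim: "finitely_generated K A"

text \<open>
  Right modules reuse the library record for modules: \<open>a \<odot>\<^bsub>M\<^esub> x\<close> stands for \<open>x \<cdot> a\<close>,
  which is why the order of the factors is reversed in \<open>smult_assoc\<close>.
\<close>
locale right_module = R: ring R + M: abelian_group M
  for R :: "('a, 'r) ring_scheme" and M :: "('a, 'm) module" +
  assumes smult_closed:
      "\<lbrakk>a \<in> carrier R; x \<in> carrier M\<rbrakk> \<Longrightarrow> a \<odot>\<^bsub>M\<^esub> x \<in> carrier M"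
    and smult_l_distr:
      "\<lbrakk>a \<in> carrier R; b \<in> carrier R; x \<in> carrier M\<rbrakk>
        \<Longrightarrow> (a \<oplus>\<^bsub>R\<^esub> b) \<odot>\<^bsub>M\<^esub> x = a \<odot>\<^bsub>M\<^esub> x \<oplus>\<^bsub>M\<^esub> b \<odot>\<^bsub>M\<^esub> x"
    and smult_r_distr:
      "\<lbrakk>a \<in> carrier R; x \<in> carrier M; y \<in> carrier M\<rbrakk>
        \<Longrightarrow> a \<odot>\<^bsub>M\<^esub> (x \<oplus>\<^bsub>M\<^esub> y) = a \<odot>\<^bsub>M\<^esub> x \<oplus>\<^bsub>M\<^esub> a \<odot>\<^bsub>M\<^esub> y"
    and smult_assoc:
      "\<lbrakk>a \<in> carrier R; b \<in> carrier R; x \<in> carrier M\<rbrakk>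
        \<Longrightarrow> (a \<otimes>\<^bsub>R\<^esub> b) \<odot>\<^bsub>M\<^esub> x = b \<odot>\<^bsub>M\<^esub> (a \<odot>\<^bsub>M\<^esub> x)"
    and smult_one:
      "x \<in> carrier M \<Longrightarrow> \<one>\<^bsub>R\<^esub> \<odot>\<^bsub>M\<^esub> x = x"

definition fgmod :: "('a, 'r) ring_scheme \<Rightarrow> ('a, 'm) module set" where
  "fgmod R = {M. right_module R M \<and> finitely_generated R M}"

text \<open>
  A formula cannot quantify over all carrier types. Auxiliary modules (those bound by
  quantifiers, projective covers, syzygies) therefore have carriers inside the type
  \<open>'a list\<close>, where \<open>'a\<close> is the element type of the ring. This loses nothing: a finitely
  generated module is a quotient of some \<open>R\<^sup>n\<close>, and choosing a preimage of each element
  embeds its carrier into the lists of length \<open>n\<close>, so every finitely generated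
  module over \<open>R\<close> has an isomorphic copy of this type.
\<close>
type_synonym 'a lmod = "('a, 'a list) module"

definition rmod_hom ::
  "('a, 'r) ring_scheme \<Rightarrow> ('a, 'm) module \<Rightarrow> ('a, 'n) module \<Rightarrow> ('m \<Rightarrow> 'n) set" where
  "rmod_hom R M N =
     {h \<in> carrier M \<rightarrow> carrier N.
        (\<forall>x\<in>carrier M. \<forall>y\<in>carrier M. h (x \<oplus>\<^bsub>M\<^esub> y) = h x \<oplus>\<^bsub>N\<^esub> h y) \<and>
        (\<forall>a\<in>carrier R. \<forall>x\<in>carrier M. h (a \<odot>\<^bsub>M\<^esub> x) = a \<odot>\<^bsub>N\<^esub> h x)}"

definition rmod_iso :: "('a, 'r) ring_scheme \<Rightarrow> ('a, 'm) module \<Rightarrow> ('a, 'n) module \<Rightarrow> bool" where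
  "rmod_iso R M N \<longleftrightarrow> (\<exists>h\<in>rmod_hom R M N. bij_betw h (carrier M) (carrier N))"

definition direct_sum ::
  "('a, 'm) module \<Rightarrow> ('a, 'n) module \<Rightarrow> ('a, 'm \<times> 'n) module" (infixr \<open>\<oplus>\<^sub>m\<close> 65) where
  "M \<oplus>\<^sub>m N =
     \<lparr>carrier = carrier M \<times> carrier N, monoid.mult = undefined, monoid.one = undefined,
      ring.zero = (\<zero>\<^bsub>M\<^esub>, \<zero>\<^bsub>N\<^esub>),
      ring.add = (\<lambda>(x, y) (x', y'). (x \<oplus>\<^bsub>M\<^esub> x', y \<oplus>\<^bsub>N\<^esub> y')),
      module.smult = (\<lambda>a (x, y). (a \<odot>\<^bsub>M\<^esub> x, a \<odot>\<^bsub>N\<^esub> y))\<rparr>"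

definition short_exact ::
  "('a, 'r) ring_scheme \<Rightarrow> ('a, 'l) module \<Rightarrow> ('l \<Rightarrow> 'm) \<Rightarrow> ('a, 'm) module \<Rightarrow> ('m \<Rightarrow> 'n)
    \<Rightarrow> ('a, 'n) module \<Rightarrow> bool" where
  "short_exact R L f M g N \<longleftrightarrow>
     f \<in> rmod_hom R L M \<and> g \<in> rmod_hom R M N \<and>
     inj_on f (carrier L) \<and> f ` carrier L = a_kernel M N g \<and> g ` carrier M = carrier N"


section \<open>Projective modules, syzygies and the stable category\<close>

definition fgproj :: "('a, 'r) ring_scheme \<Rightarrow> 'a lmod set" where
  "fgproj R =
     {P \<in> fgmod R.
        \<forall>M \<in> fgmod R :: 'a lmod set. \<forall>N \<in> fgmod R :: 'a lmod set.
          \<forall>g \<in> rmod_hom R M N. \<forall>f \<in> rmod_hom R P N.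
            g ` carrier M = carrier N \<longrightarrow>
            (\<exists>h \<in> rmod_hom R P M. \<forall>x\<in>carrier P. g (h x) = f x)}"

definition projective_cover ::
  "('a, 'r) ring_scheme \<Rightarrow> 'a lmod \<Rightarrow> ('a list \<Rightarrow> 'm) \<Rightarrow> ('a, 'm) module \<Rightarrow> bool" where
  "projective_cover R P p M \<longleftrightarrow>
     P \<in> fgproj R \<and> p \<in> rmod_hom R P M \<and> p ` carrier P = carrier M \<and>
     (\<forall>N. submodule N R P \<and> N <+>\<^bsub>P\<^esub> a_kernel P M p = carrier P \<longrightarrow> N = carrier P)"

text \<open>
  Projective covers exist for finitely generated modules over a finite-dimensional algebra and
  are unique up to isomorphism, so the choice below affects \<open>\<Omega>\<close> only up to isomorphism.
\<close>
definition Omega :: "('a, 'r) ring_scheme \<Rightarrow> ('a, 'm) module \<Rightarrow> 'a lmod" where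
  "Omega R M =
     (let (P, p) = (SOME (P, p). projective_cover R P p M)
      in P\<lparr>carrier := a_kernel P M p\<rparr>)"

text \<open>Equality of two module homomorphisms in the stable category.\<close>
definition stably_equal ::
  "('a, 'r) ring_scheme \<Rightarrow> ('a, 'm) module \<Rightarrow> ('a, 'n) module \<Rightarrow> ('m \<Rightarrow> 'n) \<Rightarrow> ('m \<Rightarrow> 'n) \<Rightarrow> bool"
  where
  "stably_equal R M N f g \<longleftrightarrow>
     (\<exists>P \<in> fgproj R. \<exists>u \<in> rmod_hom R M P. \<exists>v \<in> rmod_hom R P N.
        \<forall>x\<in>carrier M. f x \<ominus>\<^bsub>N\<^esub> g x = v (u x))"

definition stable_retract ::
  "('a, 'r) ring_scheme \<Rightarrow> ('a, 'm) module \<Rightarrow> ('a, 'n) module \<Rightarrow> bool" where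
  "stable_retract R M N \<longleftrightarrow>
     (\<exists>s \<in> rmod_hom R M N. \<exists>t \<in> rmod_hom R N M. stably_equal R M M (t \<circ> s) id)"


section \<open>Delooping levels\<close>

definition dell :: "('a, 'r) ring_scheme \<Rightarrow> nat \<Rightarrow> 'a lmod \<Rightarrow> enat" where
  "dell R r M =
     Inf {enat n | n. \<exists>Y \<in> fgmod R :: 'a lmod set.
                    stable_retract R ((Omega R ^^ n) M) ((Omega R ^^ (n + r)) Y)}"

text \<open>
  Exactness of \<open>0 \<rightarrow> C n \<rightarrow> \<cdots> \<rightarrow> C 0 \<rightarrow> M \<rightarrow> 0\<close>, where \<open>d i\<close> maps \<open>C (i + 1)\<close> to \<open>C i\<close>
  and \<open>e\<close> maps \<open>C 0\<close> to \<open>M\<close>.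
  Here \<open>incoming i\<close> is the image in \<open>C i\<close> of the preceding map, which for \<open>i = n\<close> is \<open>0 \<rightarrow> C n\<close>.
\<close>
definition exact_resolution ::
  "('a, 'r) ring_scheme \<Rightarrow> nat \<Rightarrow> (nat \<Rightarrow> 'a lmod) \<Rightarrow> (nat \<Rightarrow> 'a list \<Rightarrow> 'a list)
    \<Rightarrow> ('a list \<Rightarrow> 'm) \<Rightarrow> ('a, 'm) module \<Rightarrow> bool" where
  "exact_resolution R n C d e M \<longleftrightarrow>
     (let incoming = (\<lambda>i. if i < n then d i ` carrier (C (Suc i)) else {\<zero>\<^bsub>C i\<^esub>}) in
        (\<forall>i\<le>n. C i \<in> fgmod R) \<and>
        (\<forall>i<n. d i \<in> rmod_hom R (C (Suc i)) (C i)) \<and>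
        e \<in> rmod_hom R (C 0) M \<and>
        e ` carrier (C 0) = carrier M \<and>
        a_kernel (C 0) M e = incoming 0 \<and>
        (\<forall>i<n. a_kernel (C (Suc i)) (C i) (d i) = incoming (Suc i)))"

definition ddell :: "('a, 'r) ring_scheme \<Rightarrow> ('a, 'm) module \<Rightarrow> enat" where
  "ddell R M =
     Inf {enat m | m. \<exists>n\<le>m. \<exists>C d e. exact_resolution R n C d e M \<and>
                        (\<forall>i\<le>n. dell R (i + 1) (C i) \<le> enat (m - i))}"


section \<open>Subcategories\<close>

text \<open>
  Closure under finite direct sums (including the empty one) and direct summands; closure under
  isomorphism is included, because sums are only formed up to isomorphism.
\<close>
inductive_set add_closure :: "('a, 'r) ring_scheme \<Rightarrow> 'a lmod set \<Rightarrow> 'a lmod set"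
  for R :: "('a, 'r) ring_scheme" and S :: "'a lmod set" where
  base: "M \<in> S \<Longrightarrow> M \<in> add_closure R S"
| zero: "\<lbrakk>Z \<in> fgmod R; carrier Z = {\<zero>\<^bsub>Z\<^esub>}\<rbrakk> \<Longrightarrow> Z \<in> add_closure R S"
| sum: "\<lbrakk>M \<in> add_closure R S; N \<in> add_closure R S; E \<in> fgmod R; rmod_iso R E (M \<oplus>\<^sub>m N)\<rbrakk>
         \<Longrightarrow> E \<in> add_closure R S"
| summand: "\<lbrakk>E \<in> add_closure R S; M \<in> fgmod R; (N :: 'a lmod) \<in> fgmod R; rmod_iso R E (M \<oplus>\<^sub>m N)\<rbrakk>
         \<Longrightarrow> M \<in> add_closure R S"

definition G2 :: "('a, 'r) ring_scheme \<Rightarrow> 'a lmod set" where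
  "G2 R = add_closure R (fgproj R \<union> {(Omega R ^^ 2) Y | Y :: 'a lmod. Y \<in> fgmod R})"

definition extensions ::
  "('a, 'r) ring_scheme \<Rightarrow> 'a lmod set \<Rightarrow> 'a lmod set \<Rightarrow> ('a, 'm) module set" where
  "extensions R \<U> \<V> =
     {E \<in> fgmod R. \<exists>U\<in>\<U>. \<exists>V\<in>\<V>. \<exists>f g. short_exact R U f E g V}"

end

theory Submission
  imports Defs
begin

text \<open>
  The key tool is the functoriality of syzygies on the stable category: if \<open>X\<close> is a stable retract
  of \<open>Y\<close>, then the kernel of any epimorphism from a projective onto \<open>X\<close> is a stable retract of the
  kernel of any such epimorphism onto \<open>Y\<close>. Since stable retracts of \<open>N\<close> are the direct summands
  of the modules \<open>N \<oplus> P\<close> with \<open>P\<close> projective, \<open>\<G>\<^sub>2\<close> consists of the stable retracts of second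
  syzygies. Hence \<open>2-dell L \<le> 0\<close> means \<open>L \<in> \<G>\<^sub>2\<close> and \<open>1-dell C \<le> 1\<close> means \<open>\<Omega> C \<in> \<G>\<^sub>2\<close>, which gives
  (1) \<open>\<longleftrightarrow>\<close> (2). For (2) \<open>\<longleftrightarrow>\<close> (3), an exact sequence \<open>0 \<rightarrow> L \<rightarrow> C \<rightarrow> M \<rightarrow> 0\<close> is matched with an
  extension of \<open>L\<close> by a syzygy of \<open>C\<close> whose middle term is a syzygy of \<open>M\<close>. Only stable
  information about syzygies is needed, so minimality of projective covers plays no role; but
  covers must exist for \<open>\<Omega>\<close> to mean anything.
\<close>

section \<open>Right modules\<close>

text \<open>Carriers are a recurring obstacle. The definitions quantify over modules whose elements
  are lists, but direct sums consist of pairs and the regular module of ring elements. Quotients are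
  therefore built on freely chosen labels instead of cosets, and the quotient by the zero submodule
  serves as a list copy of any finitely generated module. The second obstacle is finiteness. A
  strictly monotone rank on submodules supplies it: it makes syzygies finitely generated and
  provides the extremal endomorphism behind projective covers. The bound 1 on \<open>ddell\<close>
  leaves only resolutions of length 0 or 1, and length 0 is padded with a zero module. The
  projective \<open>Q\<close> in (3) is there because the kernel of a composite of epimorphisms
  \<open>PC\<close> to \<open>C\<close> to \<open>M\<close> is a syzygy of \<open>M\<close> for a
  presentation that may fail to be minimal. Schanuel's lemma corrects this at the price of adding
  \<open>PC\<close> to the syzygy of \<open>M\<close>, and adding the cover of \<open>M\<close> to
  the kernel. The latter is absorbed by the right-hand \<G> of the extension, which contains all
  projectives.\<close>

lemma right_moduleI:
  fixes M :: "('a, 'm) module"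
  assumes "ring R"
    and "\<zero>\<^bsub>M\<^esub> \<in> carrier M"
    and "\<And>x y. \<lbrakk>x \<in> carrier M; y \<in> carrier M\<rbrakk> \<Longrightarrow> x \<oplus>\<^bsub>M\<^esub> y \<in> carrier M"
    and "\<And>x y z. \<lbrakk>x \<in> carrier M; y \<in> carrier M; z \<in> carrier M\<rbrakk>
      \<Longrightarrow> (x \<oplus>\<^bsub>M\<^esub> y) \<oplus>\<^bsub>M\<^esub> z = x \<oplus>\<^bsub>M\<^esub> (y \<oplus>\<^bsub>M\<^esub> z)"
    and "\<And>x y. \<lbrakk>x \<in> carrier M; y \<in> carrier M\<rbrakk> \<Longrightarrow> x \<oplus>\<^bsub>M\<^esub> y = y \<oplus>\<^bsub>M\<^esub> x"
    and "\<And>x. x \<in> carrier M \<Longrightarrow> \<zero>\<^bsub>M\<^esub> \<oplus>\<^bsub>M\<^esub> x = x"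
    and "\<And>x. x \<in> carrier M \<Longrightarrow> \<exists>y\<in>carrier M. y \<oplus>\<^bsub>M\<^esub> x = \<zero>\<^bsub>M\<^esub>"
    and "\<And>a x. \<lbrakk>a \<in> carrier R; x \<in> carrier M\<rbrakk> \<Longrightarrow> a \<odot>\<^bsub>M\<^esub> x \<in> carrier M"
    and "\<And>a b x. \<lbrakk>a \<in> carrier R; b \<in> carrier R; x \<in> carrier M\<rbrakk>
      \<Longrightarrow> (a \<oplus>\<^bsub>R\<^esub> b) \<odot>\<^bsub>M\<^esub> x = a \<odot>\<^bsub>M\<^esub> x \<oplus>\<^bsub>M\<^esub> b \<odot>\<^bsub>M\<^esub> x"
    and "\<And>a x y. \<lbrakk>a \<in> carrier R; x \<in> carrier M; y \<in> carrier M\<rbrakk>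
      \<Longrightarrow> a \<odot>\<^bsub>M\<^esub> (x \<oplus>\<^bsub>M\<^esub> y) = a \<odot>\<^bsub>M\<^esub> x \<oplus>\<^bsub>M\<^esub> a \<odot>\<^bsub>M\<^esub> y"
    and "\<And>a b x. \<lbrakk>a \<in> carrier R; b \<in> carrier R; x \<in> carrier M\<rbrakk>
      \<Longrightarrow> (a \<otimes>\<^bsub>R\<^esub> b) \<odot>\<^bsub>M\<^esub> x = b \<odot>\<^bsub>M\<^esub> (a \<odot>\<^bsub>M\<^esub> x)"
    and "\<And>x. x \<in> carrier M \<Longrightarrow> \<one>\<^bsub>R\<^esub> \<odot>\<^bsub>M\<^esub> x = x"
  shows "right_module R M"
proof -
  have "abelian_group M" by (rule abelian_groupI) (fact assms(2-7))+
  then show ?thesis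
    by (intro right_module.intro right_module_axioms.intro assms(1,8-12))
qed

context right_module
begin

lemma zero_smult: "x \<in> carrier M \<Longrightarrow> \<zero>\<^bsub>R\<^esub> \<odot>\<^bsub>M\<^esub> x = \<zero>\<^bsub>M\<^esub>"
  by (metis M.add.r_cancel_one' R.l_zero R.zero_closed smult_closed smult_l_distr)

lemma smult_zero: "a \<in> carrier R \<Longrightarrow> a \<odot>\<^bsub>M\<^esub> \<zero>\<^bsub>M\<^esub> = \<zero>\<^bsub>M\<^esub>"
  by (metis M.add.r_cancel_one' M.l_zero M.zero_closed smult_closed smult_r_distr)

lemma minus_one_smult: "x \<in> carrier M \<Longrightarrow> (\<ominus>\<^bsub>R\<^esub> \<one>\<^bsub>R\<^esub>) \<odot>\<^bsub>M\<^esub> x = \<ominus>\<^bsub>M\<^esub> x"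
  using smult_l_distr[of "\<ominus>\<^bsub>R\<^esub> \<one>\<^bsub>R\<^esub>" "\<one>\<^bsub>R\<^esub>" x]
  by (metis M.minus_equality R.l_neg R.one_closed R.add.inv_closed smult_closed smult_one zero_smult)

lemma smult_minus: "\<lbrakk>a \<in> carrier R; x \<in> carrier M\<rbrakk> \<Longrightarrow> a \<odot>\<^bsub>M\<^esub> (\<ominus>\<^bsub>M\<^esub> x) = \<ominus>\<^bsub>M\<^esub> (a \<odot>\<^bsub>M\<^esub> x)"
  using smult_r_distr[of a "\<ominus>\<^bsub>M\<^esub> x" x]
  by (intro M.minus_equality[symmetric]) (simp_all add: M.l_neg smult_zero smult_closed)

text \<open>The library notion demands closure under additive inverses; scaling by minus one
  provides it, so the criterion can leave it out.\<close>

lemma submodule_iff: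
  "submodule U R M \<longleftrightarrow> U \<subseteq> carrier M \<and> \<zero>\<^bsub>M\<^esub> \<in> U \<and> (\<forall>x\<in>U. \<forall>y\<in>U. x \<oplus>\<^bsub>M\<^esub> y \<in> U) \<and>
     (\<forall>a\<in>carrier R. \<forall>x\<in>U. a \<odot>\<^bsub>M\<^esub> x \<in> U)"
proof
  assume "submodule U R M"
  then interpret U: submodule U R M .
  show "U \<subseteq> carrier M \<and> \<zero>\<^bsub>M\<^esub> \<in> U \<and> (\<forall>x\<in>U. \<forall>y\<in>U. x \<oplus>\<^bsub>M\<^esub> y \<in> U) \<and>
     (\<forall>a\<in>carrier R. \<forall>x\<in>U. a \<odot>\<^bsub>M\<^esub> x \<in> U)"
    using U.subset U.one_closed U.m_closed by auto
next
  assume U: "U \<subseteq> carrier M \<and> \<zero>\<^bsub>M\<^esub> \<in> U \<and> (\<forall>x\<in>U. \<forall>y\<in>U. x \<oplus>\<^bsub>M\<^esub> y \<in> U) \<and>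
     (\<forall>a\<in>carrier R. \<forall>x\<in>U. a \<odot>\<^bsub>M\<^esub> x \<in> U)"
  have "\<ominus>\<^bsub>M\<^esub> x \<in> U" if "x \<in> U" for x
    using U that minus_one_smult[of x] by (metis R.add.inv_closed R.one_closed subsetD)
  then show "submodule U R M"
    using U by (intro submodule.intro subgroup.intro submodule_axioms.intro) (auto simp: a_inv_def)
qed

lemma submodule_minus:
  assumes "submodule U R M" "x \<in> U" "y \<in> U"
  shows "x \<ominus>\<^bsub>M\<^esub> y \<in> U"
proof -
  have "y \<in> carrier M" "(\<ominus>\<^bsub>R\<^esub> \<one>\<^bsub>R\<^esub>) \<odot>\<^bsub>M\<^esub> y \<in> U"
    using assms unfolding submodule_iff by auto
  then show ?thesis
    using assms unfolding submodule_iff M.minus_eq by (simp add: minus_one_smult)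
qed

lemma submodule_module:
  assumes "submodule U R M"
  shows "right_module R (M\<lparr>carrier := U\<rparr>)"
proof -
  note U = assms[unfolded submodule_iff]
  have C: "x \<in> U \<Longrightarrow> x \<in> carrier M" for x using U by auto
  have "\<exists>y\<in>U. y \<oplus>\<^bsub>M\<^esub> x = \<zero>\<^bsub>M\<^esub>" if "x \<in> U" for x
    using submodule_minus[OF assms _ that, of "\<zero>\<^bsub>M\<^esub>"] U C[OF that]
    by (intro bexI[of _ "\<zero>\<^bsub>M\<^esub> \<ominus>\<^bsub>M\<^esub> x"]) (auto simp: M.minus_eq M.l_neg)
  then show ?thesis
    using U C by (intro right_moduleI R.ring_axioms)
      (auto simp: M.a_assoc smult_l_distr smult_r_distr smult_assoc smult_one intro: M.a_comm)
qed

lemma submodule_carrier: "submodule (carrier M) R M"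
  by (auto simp: submodule_iff smult_closed)

lemma minus_eq_zero: "\<lbrakk>x \<in> carrier M; y \<in> carrier M\<rbrakk> \<Longrightarrow> x \<ominus>\<^bsub>M\<^esub> y = \<zero>\<^bsub>M\<^esub> \<longleftrightarrow> x = y"
  by (metis M.minus_equality M.minus_minus M.r_neg M.minus_eq M.a_inv_closed)

lemma minus_add_cancel: "\<lbrakk>x \<in> carrier M; y \<in> carrier M\<rbrakk> \<Longrightarrow> (x \<ominus>\<^bsub>M\<^esub> y) \<oplus>\<^bsub>M\<^esub> y = x"
  by (simp add: M.minus_eq M.a_assoc M.l_neg)

end

section \<open>Homomorphisms\<close>

lemma rmod_homI:
  assumes "\<And>x. x \<in> carrier M \<Longrightarrow> h x \<in> carrier N"
    and "\<And>x y. \<lbrakk>x \<in> carrier M; y \<in> carrier M\<rbrakk> \<Longrightarrow> h (x \<oplus>\<^bsub>M\<^esub> y) = h x \<oplus>\<^bsub>N\<^esub> h y"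
    and "\<And>a x. \<lbrakk>a \<in> carrier R; x \<in> carrier M\<rbrakk> \<Longrightarrow> h (a \<odot>\<^bsub>M\<^esub> x) = a \<odot>\<^bsub>N\<^esub> h x"
  shows "h \<in> rmod_hom R M N"
  using assms by (auto simp: rmod_hom_def)

lemma hom_closed: "\<lbrakk>h \<in> rmod_hom R M N; x \<in> carrier M\<rbrakk> \<Longrightarrow> h x \<in> carrier N"
  by (auto simp: rmod_hom_def)

lemma hom_add:
  "\<lbrakk>h \<in> rmod_hom R M N; x \<in> carrier M; y \<in> carrier M\<rbrakk> \<Longrightarrow> h (x \<oplus>\<^bsub>M\<^esub> y) = h x \<oplus>\<^bsub>N\<^esub> h y"
  by (auto simp: rmod_hom_def)

lemma hom_smult:
  "\<lbrakk>h \<in> rmod_hom R M N; a \<in> carrier R; x \<in> carrier M\<rbrakk> \<Longrightarrow> h (a \<odot>\<^bsub>M\<^esub> x) = a \<odot>\<^bsub>N\<^esub> h x"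
  by (auto simp: rmod_hom_def)

lemma hom_zero:
  assumes "right_module R M" "right_module R N" "h \<in> rmod_hom R M N"
  shows "h \<zero>\<^bsub>M\<^esub> = \<zero>\<^bsub>N\<^esub>"
proof -
  interpret M: right_module R M by fact
  interpret N: right_module R N by fact
  show ?thesis
    using hom_add[OF assms(3), of "\<zero>\<^bsub>M\<^esub>" "\<zero>\<^bsub>M\<^esub>"] hom_closed[OF assms(3), of "\<zero>\<^bsub>M\<^esub>"]
    by (metis M.M.l_zero M.M.zero_closed N.M.add.r_cancel_one')
qed

lemma hom_minus:
  assumes "right_module R M" "right_module R N" "h \<in> rmod_hom R M N" "x \<in> carrier M" "y \<in> carrier M"
  shows "h (x \<ominus>\<^bsub>M\<^esub> y) = h x \<ominus>\<^bsub>N\<^esub> h y"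
proof -
  interpret M: right_module R M by fact
  interpret N: right_module R N by fact
  have "h (\<ominus>\<^bsub>M\<^esub> y) = \<ominus>\<^bsub>N\<^esub> h y"
    using assms(5) hom_smult[OF assms(3), of "\<ominus>\<^bsub>R\<^esub> \<one>\<^bsub>R\<^esub>" y] hom_closed[OF assms(3,5)]
    by (simp add: M.minus_one_smult N.minus_one_smult)
  then show ?thesis
    using assms(4,5) by (simp add: M.M.minus_eq N.M.minus_eq hom_add[OF assms(3)])
qed

lemma hom_id: "(\<lambda>x. x) \<in> rmod_hom R M M"
  by (auto simp: rmod_hom_def)

lemma hom_comp:
  "\<lbrakk>f \<in> rmod_hom R M N; g \<in> rmod_hom R N L\<rbrakk> \<Longrightarrow> (\<lambda>x. g (f x)) \<in> rmod_hom R M L"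
  by (auto simp: rmod_hom_def Pi_iff)

lemma hom_const_zero:
  assumes "right_module R N"
  shows "(\<lambda>_. \<zero>\<^bsub>N\<^esub>) \<in> rmod_hom R M N"
proof -
  interpret N: right_module R N by fact
  show ?thesis by (auto simp: rmod_hom_def N.smult_zero)
qed

lemma hom_plus:
  assumes "right_module R M" "right_module R N" "f \<in> rmod_hom R M N" "g \<in> rmod_hom R M N"
  shows "(\<lambda>x. f x \<oplus>\<^bsub>N\<^esub> g x) \<in> rmod_hom R M N"
proof -
  interpret M: right_module R M by fact
  interpret N: right_module R N by fact
  note c = hom_closed[OF assms(3)] hom_closed[OF assms(4)]
  show ?thesis
    by (rule rmod_homI) (simp_all add: c hom_add[OF assms(3)] hom_add[OF assms(4)]
      hom_smult[OF assms(3)] hom_smult[OF assms(4)] N.smult_r_distr N.M.a_ac)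
qed

lemma hom_diff:
  assumes "right_module R M" "right_module R N" "f \<in> rmod_hom R M N" "g \<in> rmod_hom R M N"
  shows "(\<lambda>x. f x \<ominus>\<^bsub>N\<^esub> g x) \<in> rmod_hom R M N"
proof -
  interpret M: right_module R M by fact
  interpret N: right_module R N by fact
  note c = hom_closed[OF assms(3)] hom_closed[OF assms(4)]
  show ?thesis
    by (rule rmod_homI) (simp_all add: c hom_add[OF assms(3)] hom_add[OF assms(4)] N.M.minus_eq
      hom_smult[OF assms(3)] hom_smult[OF assms(4)] N.smult_r_distr N.smult_minus N.M.minus_add N.M.a_ac)
qed

lemma kernel_submodule:
  assumes "right_module R M" "right_module R N" "h \<in> rmod_hom R M N"
  shows "submodule (a_kernel M N h) R M"
proof -
  interpret M: right_module R M by fact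
  interpret N: right_module R N by fact
  show ?thesis
    unfolding M.submodule_iff a_kernel_def'
    by (auto simp: hom_zero[OF assms] hom_add[OF assms(3)] hom_smult[OF assms(3)] M.smult_closed N.smult_zero)
qed

lemma vimage_submodule:
  assumes "right_module R M" "right_module R N" "h \<in> rmod_hom R M N" "submodule U R N"
  shows "submodule {x \<in> carrier M. h x \<in> U} R M"
proof -
  interpret M: right_module R M by fact
  interpret N: right_module R N by fact
  show ?thesis
    using assms(4) unfolding M.submodule_iff N.submodule_iff
    by (auto simp: hom_zero[OF assms(1-3)] hom_add[OF assms(3)] hom_smult[OF assms(3)] M.smult_closed)
qed

lemma image_submodule:
  assumes "right_module R M" "right_module R N" "h \<in> rmod_hom R M N"
  shows "submodule (h ` carrier M) R N"
proof -
  interpret M: right_module R M by fact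
  interpret N: right_module R N by fact
  have "\<zero>\<^bsub>N\<^esub> \<in> h ` carrier M" using hom_zero[OF assms] by (metis M.M.zero_closed imageI)
  then show ?thesis
    unfolding N.submodule_iff
    by (auto simp: hom_closed[OF assms(3)] hom_add[OF assms(3), symmetric] hom_smult[OF assms(3), symmetric] M.smult_closed)
qed

lemma kernel_eq_iff:
  assumes "right_module R M" "right_module R N" "h \<in> rmod_hom R M N" "x \<in> carrier M" "y \<in> carrier M"
  shows "x \<ominus>\<^bsub>M\<^esub> y \<in> a_kernel M N h \<longleftrightarrow> h x = h y"
proof -
  interpret M: right_module R M by fact
  interpret N: right_module R N by fact
  show ?thesis
    using assms hom_minus[OF assms] N.minus_eq_zero hom_closed[OF assms(3)]
    by (auto simp: a_kernel_def')
qed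

lemma hom_codomain_submodule:
  assumes "h \<in> rmod_hom R M N" "\<And>x. x \<in> carrier M \<Longrightarrow> h x \<in> U"
  shows "h \<in> rmod_hom R M (N\<lparr>carrier := U\<rparr>)"
  using assms by (auto simp: rmod_hom_def)

lemma hom_inclusion: "U \<subseteq> carrier M \<Longrightarrow> (\<lambda>x. x) \<in> rmod_hom R (M\<lparr>carrier := U\<rparr>) M"
  by (auto simp: rmod_hom_def)

text \<open>Universal property of a quotient: \<open>k\<close> evaluates \<open>h\<close> at a
  chosen preimage, and the inclusion of kernels makes the value independent of the choice. With
  \<open>h\<close> the identity it also inverts bijective homomorphisms.\<close>

lemma hom_factor:
  assumes "right_module R E" "right_module R C" "right_module R N"
    and q: "q \<in> rmod_hom R E C" "q ` carrier E = carrier C"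
    and h: "h \<in> rmod_hom R E N" and ker: "a_kernel E C q \<subseteq> a_kernel E N h"
  shows "\<exists>k\<in>rmod_hom R C N. \<forall>x\<in>carrier E. k (q x) = h x"
proof -
  interpret E: right_module R E by fact
  interpret C: right_module R C by fact
  have "\<exists>k. \<forall>x\<in>carrier E. k (q x) = h x"
  proof (intro exI ballI)
    fix x assume x: "x \<in> carrier E"
    define y where "y = inv_into (carrier E) q (q x)"
    have y: "y \<in> carrier E" "q y = q x" unfolding y_def using x by (auto intro: inv_into_into f_inv_into_f)
    then have "y \<ominus>\<^bsub>E\<^esub> x \<in> a_kernel E N h"
      using ker kernel_eq_iff[OF assms(1,2) q(1) y(1) x] by auto
    then show "(h \<circ> inv_into (carrier E) q) (q x) = h x"
      using kernel_eq_iff[OF assms(1,3) h y(1) x] by (simp add: y_def)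
  qed
  then obtain k where k: "k (q x) = h x" if "x \<in> carrier E" for x by blast
  have "k \<in> rmod_hom R C N"
  proof (rule rmod_homI)
    fix x y assume "x \<in> carrier C" "y \<in> carrier C"
    then obtain x' y' where "x' \<in> carrier E" "y' \<in> carrier E" "x = q x'" "y = q y'"
      using q(2) by blast
    then show "k (x \<oplus>\<^bsub>C\<^esub> y) = k x \<oplus>\<^bsub>N\<^esub> k y"
      using hom_add[OF q(1), of x' y', symmetric] by (simp add: k hom_add[OF h])
  next
    fix x assume "x \<in> carrier C"
    then obtain x' where x': "x' \<in> carrier E" "x = q x'" using q(2) by blast
    then show "k x \<in> carrier N" by (simp add: k hom_closed[OF h])
    fix a assume "a \<in> carrier R"
    then show "k (a \<odot>\<^bsub>C\<^esub> x) = a \<odot>\<^bsub>N\<^esub> k x"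
      using hom_smult[OF q(1) _ x'(1), of a, symmetric] x' by (simp add: k hom_smult[OF h] E.smult_closed)
  qed
  then show ?thesis using k by blast
qed

text \<open>Universal property of a kernel: \<open>h\<close> lands in the image of \<open>f\<close>,
  which gives the values of \<open>k\<close>, and injectivity of \<open>f\<close> transfers
  linearity from \<open>h\<close> to \<open>k\<close>.\<close>

lemma short_exact_lift:
  assumes "right_module R L" "right_module R M" "right_module R E" "short_exact R L f M g N"
    and h: "h \<in> rmod_hom R E M" and gh: "\<And>x. x \<in> carrier E \<Longrightarrow> g (h x) = \<zero>\<^bsub>N\<^esub>"
  shows "\<exists>k\<in>rmod_hom R E L. \<forall>x\<in>carrier E. f (k x) = h x"
proof -
  interpret L: right_module R L by fact
  interpret E: right_module R E by fact
  have f: "f \<in> rmod_hom R L M" "inj_on f (carrier L)" "f ` carrier L = a_kernel M N g"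
    using assms(4) by (auto simp: short_exact_def)
  have "\<forall>x\<in>carrier E. \<exists>y\<in>carrier L. f y = h x"
  proof
    fix x assume "x \<in> carrier E"
    then have "h x \<in> f ` carrier L"
      using gh hom_closed[OF h] by (auto simp: f(3) a_kernel_def')
    then show "\<exists>y\<in>carrier L. f y = h x" by auto
  qed
  then obtain k where k: "\<And>x. x \<in> carrier E \<Longrightarrow> k x \<in> carrier L" "\<And>x. x \<in> carrier E \<Longrightarrow> f (k x) = h x"
    by metis
  have "k \<in> rmod_hom R E L"
    by (rule rmod_homI; rule inj_onD[OF f(2)] k)
      (simp_all add: k hom_add[OF f(1)] hom_smult[OF f(1)] hom_add[OF h] hom_smult[OF h]
        L.smult_closed E.smult_closed)
  then show ?thesis using k by blast
qed

section \<open>Direct sums\<close>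

lemma direct_sum_simps [simp]:
  "carrier (M \<oplus>\<^sub>m N) = carrier M \<times> carrier N"
  "\<zero>\<^bsub>M \<oplus>\<^sub>m N\<^esub> = (\<zero>\<^bsub>M\<^esub>, \<zero>\<^bsub>N\<^esub>)"
  "(x, y) \<oplus>\<^bsub>M \<oplus>\<^sub>m N\<^esub> (x', y') = (x \<oplus>\<^bsub>M\<^esub> x', y \<oplus>\<^bsub>N\<^esub> y')"
  "a \<odot>\<^bsub>M \<oplus>\<^sub>m N\<^esub> (x, y) = (a \<odot>\<^bsub>M\<^esub> x, a \<odot>\<^bsub>N\<^esub> y)"
  by (simp_all add: direct_sum_def)

lemma right_module_direct_sum:
  assumes "right_module R M" "right_module R N"
  shows "right_module R (M \<oplus>\<^sub>m N)"
proof -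
  interpret M: right_module R M by fact
  interpret N: right_module R N by fact
  have "\<exists>y\<in>carrier (M \<oplus>\<^sub>m N). y \<oplus>\<^bsub>M \<oplus>\<^sub>m N\<^esub> x = \<zero>\<^bsub>M \<oplus>\<^sub>m N\<^esub>" if "x \<in> carrier (M \<oplus>\<^sub>m N)" for x
    using that by (intro bexI[of _ "(\<ominus>\<^bsub>M\<^esub> fst x, \<ominus>\<^bsub>N\<^esub> snd x)"]) (auto simp: M.M.l_neg N.M.l_neg)
  then show ?thesis
    by (intro right_moduleI M.R.ring_axioms)
      (auto simp: M.M.a_assoc N.M.a_assoc M.smult_l_distr N.smult_l_distr M.smult_r_distr N.smult_r_distr
        M.smult_assoc N.smult_assoc M.smult_one N.smult_one M.smult_closed N.smult_closed
        intro: M.M.a_comm N.M.a_comm)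
qed

lemma hom_pair:
  "\<lbrakk>f \<in> rmod_hom R M N; g \<in> rmod_hom R M L\<rbrakk> \<Longrightarrow> (\<lambda>x. (f x, g x)) \<in> rmod_hom R M (N \<oplus>\<^sub>m L)"
  by (auto simp: rmod_hom_def)

lemma hom_fst: "fst \<in> rmod_hom R (M \<oplus>\<^sub>m N) M"
  by (auto simp: rmod_hom_def)

lemma hom_snd: "snd \<in> rmod_hom R (M \<oplus>\<^sub>m N) N"
  by (auto simp: rmod_hom_def)

lemma hom_fst_comp: "f \<in> rmod_hom R M L \<Longrightarrow> (\<lambda>x. f (fst x)) \<in> rmod_hom R (M \<oplus>\<^sub>m N) L"
  by (rule hom_comp[OF hom_fst])

lemma hom_snd_comp: "f \<in> rmod_hom R N L \<Longrightarrow> (\<lambda>x. f (snd x)) \<in> rmod_hom R (M \<oplus>\<^sub>m N) L"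
  by (rule hom_comp[OF hom_snd])

section \<open>Finite generation\<close>

lemma (in right_module) submodule_finsum:
  assumes "submodule U R M" "finite B" "f \<in> B \<rightarrow> U"
  shows "(\<Oplus>\<^bsub>M\<^esub>b\<in>B. f b) \<in> U"
  using assms(2,3)
proof (induction B)
  case empty
  then show ?case using assms(1) by (simp add: submodule_iff)
next
  case (insert b B)
  have "f \<in> insert b B \<rightarrow> carrier M" using insert.prems assms(1) by (auto simp: submodule_iff)
  then show ?case using insert assms(1) by (auto simp: submodule_iff Pi_iff)
qed

lemma (in right_module) finsum_smult:
  assumes "finite B" "f \<in> B \<rightarrow> carrier M" "a \<in> carrier R"
  shows "a \<odot>\<^bsub>M\<^esub> (\<Oplus>\<^bsub>M\<^esub>b\<in>B. f b) = (\<Oplus>\<^bsub>M\<^esub>b\<in>B. a \<odot>\<^bsub>M\<^esub> f b)"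
  using assms(1,2)
proof (induction B)
  case empty
  then show ?case using assms(3) by (simp add: smult_zero)
next
  case (insert b B)
  then show ?case using assms(3) by (simp add: smult_r_distr smult_closed Pi_iff)
qed

lemma (in right_module) submodule_linear_combinations:
  assumes B: "finite B" "B \<subseteq> carrier M"
  shows "submodule {\<Oplus>\<^bsub>M\<^esub>b\<in>B. c b \<odot>\<^bsub>M\<^esub> b | c. c \<in> B \<rightarrow> carrier R} R M" (is "submodule ?S R M")
proof -
  have cl: "c b \<odot>\<^bsub>M\<^esub> b \<in> carrier M" if "c \<in> B \<rightarrow> carrier R" "b \<in> B" for c b
    using that B by (auto intro!: smult_closed)
  have "\<zero>\<^bsub>M\<^esub> \<in> ?S"
  proof (intro CollectI exI conjI)
    show "\<zero>\<^bsub>M\<^esub> = (\<Oplus>\<^bsub>M\<^esub>b\<in>B. \<zero>\<^bsub>R\<^esub> \<odot>\<^bsub>M\<^esub> b)"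
      using B by (subst M.finsum_cong'[where g="\<lambda>_. \<zero>\<^bsub>M\<^esub>"]) (auto simp: zero_smult)
  qed auto
  moreover have "x \<oplus>\<^bsub>M\<^esub> y \<in> ?S" if xy: "x \<in> ?S" "y \<in> ?S" for x y
  proof -
    obtain c d where cd: "c \<in> B \<rightarrow> carrier R" "d \<in> B \<rightarrow> carrier R"
      "x = (\<Oplus>\<^bsub>M\<^esub>b\<in>B. c b \<odot>\<^bsub>M\<^esub> b)" "y = (\<Oplus>\<^bsub>M\<^esub>b\<in>B. d b \<odot>\<^bsub>M\<^esub> b)" using xy by auto
    have "x \<oplus>\<^bsub>M\<^esub> y = (\<Oplus>\<^bsub>M\<^esub>b\<in>B. c b \<odot>\<^bsub>M\<^esub> b \<oplus>\<^bsub>M\<^esub> d b \<odot>\<^bsub>M\<^esub> b)"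
      unfolding cd using cl cd(1,2) by (subst M.finsum_addf) auto
    also have "\<dots> = (\<Oplus>\<^bsub>M\<^esub>b\<in>B. (c b \<oplus>\<^bsub>R\<^esub> d b) \<odot>\<^bsub>M\<^esub> b)"
      using cd B by (intro M.finsum_cong') (auto simp: smult_l_distr Pi_iff intro!: smult_closed)
    finally show ?thesis using cd(1,2)
      by (intro CollectI exI[of _ "\<lambda>b. c b \<oplus>\<^bsub>R\<^esub> d b"] conjI) auto
  qed
  moreover have "a \<odot>\<^bsub>M\<^esub> x \<in> ?S" if a: "a \<in> carrier R" and x: "x \<in> ?S" for a x
  proof -
    obtain c where c: "c \<in> B \<rightarrow> carrier R" "x = (\<Oplus>\<^bsub>M\<^esub>b\<in>B. c b \<odot>\<^bsub>M\<^esub> b)" using x by auto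
    have "a \<odot>\<^bsub>M\<^esub> x = (\<Oplus>\<^bsub>M\<^esub>b\<in>B. a \<odot>\<^bsub>M\<^esub> (c b \<odot>\<^bsub>M\<^esub> b))"
      unfolding c using cl c(1) a B by (subst finsum_smult) auto
    \<comment> \<open>The action is on the right: acting with \<open>c b\<close> and then with
      \<open>a\<close> is acting with the product of \<open>c b\<close> and \<open>a\<close> in this
      order.\<close>
    also have "\<dots> = (\<Oplus>\<^bsub>M\<^esub>b\<in>B. (c b \<otimes>\<^bsub>R\<^esub> a) \<odot>\<^bsub>M\<^esub> b)"
      using c B a by (intro M.finsum_cong') (auto simp: smult_assoc Pi_iff intro!: smult_closed)
    finally show ?thesis using c a
      by (intro CollectI exI[of _ "\<lambda>b. c b \<otimes>\<^bsub>R\<^esub> a"] conjI) auto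
  qed
  moreover have "?S \<subseteq> carrier M" using cl by (auto intro!: M.finsum_closed)
  ultimately show ?thesis unfolding submodule_iff by blast
qed

text \<open>The linear combinations of \<open>B\<close> form the least submodule containing
  \<open>B\<close>. In this form generation can be tested by pulling submodules back along
  homomorphisms, without handling sums.\<close>

lemma (in right_module) finitely_generated_iff:
  "finitely_generated R M \<longleftrightarrow>
     (\<exists>B. finite B \<and> B \<subseteq> carrier M \<and> (\<forall>U. submodule U R M \<and> B \<subseteq> U \<longrightarrow> U = carrier M))"
proof
  assume "finitely_generated R M"
  then obtain B where B: "finite B" "B \<subseteq> carrier M"
    "\<And>x. x \<in> carrier M \<Longrightarrow> \<exists>c \<in> B \<rightarrow> carrier R. x = (\<Oplus>\<^bsub>M\<^esub>b\<in>B. c b \<odot>\<^bsub>M\<^esub> b)"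
    unfolding finitely_generated_def by blast
  have "x \<in> U" if U: "submodule U R M" "B \<subseteq> U" and x: "x \<in> carrier M" for U x
  proof -
    obtain c where c: "c \<in> B \<rightarrow> carrier R" "x = (\<Oplus>\<^bsub>M\<^esub>b\<in>B. c b \<odot>\<^bsub>M\<^esub> b)" using B(3)[OF x] by blast
    show ?thesis unfolding c(2) using U c(1)
      by (intro submodule_finsum[OF U(1) B(1)]) (auto simp: submodule_iff Pi_iff)
  qed
  then show "\<exists>B. finite B \<and> B \<subseteq> carrier M \<and> (\<forall>U. submodule U R M \<and> B \<subseteq> U \<longrightarrow> U = carrier M)"
  proof (intro exI conjI allI impI)
    fix U assume U: "submodule U R M \<and> B \<subseteq> U"
    assume "\<And>U x. submodule U R M \<Longrightarrow> B \<subseteq> U \<Longrightarrow> x \<in> carrier M \<Longrightarrow> x \<in> U"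
    then have "carrier M \<subseteq> U" using U by blast
    then show "U = carrier M" using U by (auto simp: submodule_iff)
  qed (use B(1,2) in auto)
next
  assume "\<exists>B. finite B \<and> B \<subseteq> carrier M \<and> (\<forall>U. submodule U R M \<and> B \<subseteq> U \<longrightarrow> U = carrier M)"
  then obtain B where B: "finite B" "B \<subseteq> carrier M"
    "\<And>U. submodule U R M \<Longrightarrow> B \<subseteq> U \<Longrightarrow> U = carrier M" by metis
  let ?S = "{\<Oplus>\<^bsub>M\<^esub>b\<in>B. c b \<odot>\<^bsub>M\<^esub> b | c. c \<in> B \<rightarrow> carrier R}"
  have "b \<in> ?S" if b: "b \<in> B" for b
  proof (intro CollectI exI conjI)
    have bM: "b \<in> carrier M" using b B(2) by auto
    \<comment> \<open>Kronecker coefficients exhibit \<open>b\<close> itself as a linear combination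
      of \<open>B\<close>.\<close>
    have "(\<Oplus>\<^bsub>M\<^esub>b'\<in>B. (if b = b' then \<one>\<^bsub>R\<^esub> else \<zero>\<^bsub>R\<^esub>) \<odot>\<^bsub>M\<^esub> b')
      = (\<Oplus>\<^bsub>M\<^esub>b'\<in>B. if b = b' then b' else \<zero>\<^bsub>M\<^esub>)"
      using B(1,2) by (intro M.finsum_cong') (auto simp: zero_smult smult_one)
    then show "b = (\<Oplus>\<^bsub>M\<^esub>b'\<in>B. (if b = b' then \<one>\<^bsub>R\<^esub> else \<zero>\<^bsub>R\<^esub>) \<odot>\<^bsub>M\<^esub> b')"
      using M.finsum_singleton[OF b B(1), of "\<lambda>x. x"] B(2) by (simp add: Pi_iff subset_eq)
  qed auto
  then have "?S = carrier M"
    using B(3)[OF submodule_linear_combinations[OF B(1,2)]] by blast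
  then have "\<exists>c\<in>B \<rightarrow> carrier R. x = (\<Oplus>\<^bsub>M\<^esub>b\<in>B. c b \<odot>\<^bsub>M\<^esub> b)" if "x \<in> carrier M" for x
    using that by auto
  then show "finitely_generated R M"
    unfolding finitely_generated_def using B(1,2) by (intro exI[of _ B]) simp
qed

lemma fgmod_right_module: "M \<in> fgmod R \<Longrightarrow> right_module R M"
  by (simp add: fgmod_def)

lemma fgmod_image:
  assumes M: "M \<in> fgmod R" and N: "right_module R N"
    and h: "h \<in> rmod_hom R M N" "h ` carrier M = carrier N"
  shows "N \<in> fgmod R"
proof -
  interpret M: right_module R M using M by (rule fgmod_right_module)
  interpret N: right_module R N by fact
  obtain B where B: "finite B" "B \<subseteq> carrier M"
    "\<And>U. submodule U R M \<Longrightarrow> B \<subseteq> U \<Longrightarrow> U = carrier M"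
    using M M.finitely_generated_iff by (auto simp: fgmod_def)
  have "U = carrier N" if U: "submodule U R N" "h ` B \<subseteq> U" for U
  proof -
    have "{x \<in> carrier M. h x \<in> U} = carrier M"
      using U B(2) by (intro B(3) vimage_submodule[OF M.right_module_axioms N h(1)]) auto
    then have "h ` carrier M \<subseteq> U" by auto
    then show ?thesis using U(1) h(2) by (auto simp: N.submodule_iff)
  qed
  then have "finitely_generated R N"
    unfolding N.finitely_generated_iff using B(1,2) h by (intro exI[of _ "h ` B"]) auto
  then show ?thesis using N by (simp add: fgmod_def)
qed

lemma fgmod_direct_sum:
  assumes "M \<in> fgmod R" "N \<in> fgmod R"
  shows "M \<oplus>\<^sub>m N \<in> fgmod R"
proof -
  interpret M: right_module R M using assms by (simp add: fgmod_right_module)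
  interpret N: right_module R N using assms by (simp add: fgmod_right_module)
  interpret S: right_module R "M \<oplus>\<^sub>m N"
    by (intro right_module_direct_sum M.right_module_axioms N.right_module_axioms)
  obtain B where B: "finite B" "B \<subseteq> carrier M"
    "\<And>U. submodule U R M \<Longrightarrow> B \<subseteq> U \<Longrightarrow> U = carrier M"
    using assms M.finitely_generated_iff by (auto simp: fgmod_def)
  obtain B' where B': "finite B'" "B' \<subseteq> carrier N"
    "\<And>U. submodule U R N \<Longrightarrow> B' \<subseteq> U \<Longrightarrow> U = carrier N"
    using assms N.finitely_generated_iff by (auto simp: fgmod_def)
  have "U = carrier (M \<oplus>\<^sub>m N)"
    if U: "submodule U R (M \<oplus>\<^sub>m N)" "B \<times> {\<zero>\<^bsub>N\<^esub>} \<union> {\<zero>\<^bsub>M\<^esub>} \<times> B' \<subseteq> U" for U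
  proof -
    \<comment> \<open>Pulling \<open>U\<close> back along the inclusion of a summand gives a
      submodule containing the generators of that summand, hence all of it.\<close>
    have "{x \<in> carrier M. (x, \<zero>\<^bsub>N\<^esub>) \<in> U} = carrier M"
      using U B(2) by (intro B(3) vimage_submodule[OF M.right_module_axioms S.right_module_axioms _ U(1)]
          hom_pair hom_id hom_const_zero N.right_module_axioms) auto
    moreover have "{x \<in> carrier N. (\<zero>\<^bsub>M\<^esub>, x) \<in> U} = carrier N"
      using U B'(2) by (intro B'(3) vimage_submodule[OF N.right_module_axioms S.right_module_axioms _ U(1)]
          hom_pair hom_id hom_const_zero M.right_module_axioms) auto
    ultimately have "(x, \<zero>\<^bsub>N\<^esub>) \<oplus>\<^bsub>M \<oplus>\<^sub>m N\<^esub> (\<zero>\<^bsub>M\<^esub>, y) \<in> U" if "x \<in> carrier M" "y \<in> carrier N" for x y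
      using that U(1) unfolding S.submodule_iff by blast
    then show ?thesis using U(1) unfolding S.submodule_iff by auto
  qed
  then have "finitely_generated R (M \<oplus>\<^sub>m N)"
    unfolding S.finitely_generated_iff using B(1,2) B'(1,2)
    by (intro exI[of _ "B \<times> {\<zero>\<^bsub>N\<^esub>} \<union> {\<zero>\<^bsub>M\<^esub>} \<times> B'"]) auto
  then show ?thesis using S.right_module_axioms by (simp add: fgmod_def)
qed

section \<open>Quotients\<close>

text \<open>Every module law is inherited along a surjection that respects the operations.
  Preservation of zero is listed separately because \<open>N\<close> is not yet known to be a
  module, so it cannot be deduced from additivity.\<close>

lemma right_module_surj_image:
  fixes N :: "('a, 'n) module"
  assumes "right_module R M"
    and surj: "e ` carrier M = carrier N"
    and ops: "e \<zero>\<^bsub>M\<^esub> = \<zero>\<^bsub>N\<^esub>"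
      "\<And>x y. \<lbrakk>x \<in> carrier M; y \<in> carrier M\<rbrakk> \<Longrightarrow> e (x \<oplus>\<^bsub>M\<^esub> y) = e x \<oplus>\<^bsub>N\<^esub> e y"
      "\<And>a x. \<lbrakk>a \<in> carrier R; x \<in> carrier M\<rbrakk> \<Longrightarrow> e (a \<odot>\<^bsub>M\<^esub> x) = a \<odot>\<^bsub>N\<^esub> e x"
  shows "right_module R N"
proof -
  interpret M: right_module R M by fact
  note ops' = ops[symmetric]
  show ?thesis
  proof (rule right_moduleI)
    show "ring R" by (rule M.R.ring_axioms)
    show "\<zero>\<^bsub>N\<^esub> \<in> carrier N" by (simp add: surj[symmetric] ops')
    fix x assume "x \<in> carrier N"
    then obtain y where y: "y \<in> carrier M" "x = e y" unfolding surj[symmetric] by blast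
    have "e (\<ominus>\<^bsub>M\<^esub> y) \<oplus>\<^bsub>N\<^esub> x = \<zero>\<^bsub>N\<^esub>" using y by (simp add: ops' M.M.l_neg)
    moreover have "e (\<ominus>\<^bsub>M\<^esub> y) \<in> carrier N" using y(1) unfolding surj[symmetric] by blast
    ultimately show "\<exists>y\<in>carrier N. y \<oplus>\<^bsub>N\<^esub> x = \<zero>\<^bsub>N\<^esub>" by blast
  qed (auto simp: surj[symmetric] ops' M.smult_closed M.M.a_assoc M.smult_l_distr
      M.smult_r_distr M.smult_assoc M.smult_one intro!: arg_cong[of _ _ e] M.M.a_comm)
qed

text \<open>A quotient without cosets: if \<open>e\<close> takes equal values exactly on congruent
  elements, its values are labels of the cosets and may have any type. The operations are computed
  on chosen representatives.\<close>

definition image_module :: "('m \<Rightarrow> 'n) \<Rightarrow> ('a, 'm) module \<Rightarrow> ('a, 'n) module" where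
  "image_module e M =
     (let s = inv_into (carrier M) e in
      \<lparr>carrier = e ` carrier M, monoid.mult = undefined, monoid.one = undefined,
       ring.zero = e \<zero>\<^bsub>M\<^esub>,
       ring.add = (\<lambda>x y. e (s x \<oplus>\<^bsub>M\<^esub> s y)),
       module.smult = (\<lambda>a x. e (a \<odot>\<^bsub>M\<^esub> s x))\<rparr>)"

lemma image_module:
  assumes "right_module R M" "submodule U R M"
    and e: "\<And>x y. \<lbrakk>x \<in> carrier M; y \<in> carrier M\<rbrakk> \<Longrightarrow> e x = e y \<longleftrightarrow> x \<ominus>\<^bsub>M\<^esub> y \<in> U"
  shows "right_module R (image_module e M)"
    and "e \<in> rmod_hom R M (image_module e M)"
    and "e ` carrier M = carrier (image_module e M)"
    and "a_kernel M (image_module e M) e = U"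
proof -
  interpret M: right_module R M by fact
  note U = assms(2)[unfolded M.submodule_iff]
  define s where "s = inv_into (carrier M) e"
  \<comment> \<open>The representative chosen for the label of \<open>x\<close> differs from
    \<open>x\<close> by an element of \<open>U\<close>; this makes the operations on labels well
    defined.\<close>
  have s: "s (e x) \<in> carrier M" "s (e x) \<ominus>\<^bsub>M\<^esub> x \<in> U" if "x \<in> carrier M" for x
  proof -
    show *: "s (e x) \<in> carrier M" using that by (auto simp: s_def intro: inv_into_into)
    show "s (e x) \<ominus>\<^bsub>M\<^esub> x \<in> U"
      using that by (subst e[symmetric, OF *]) (auto simp: s_def intro: f_inv_into_f)
  qed
  have add: "e (x \<oplus>\<^bsub>M\<^esub> y) = e (s (e x) \<oplus>\<^bsub>M\<^esub> s (e y))" if "x \<in> carrier M" "y \<in> carrier M" for x y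
  proof -
    have "(s (e x) \<oplus>\<^bsub>M\<^esub> s (e y)) \<ominus>\<^bsub>M\<^esub> (x \<oplus>\<^bsub>M\<^esub> y) = (s (e x) \<ominus>\<^bsub>M\<^esub> x) \<oplus>\<^bsub>M\<^esub> (s (e y) \<ominus>\<^bsub>M\<^esub> y)"
      using s that by (simp add: M.M.minus_eq M.M.minus_add M.M.a_ac)
    then have "e (s (e x) \<oplus>\<^bsub>M\<^esub> s (e y)) = e (x \<oplus>\<^bsub>M\<^esub> y)"
      using s that U by (simp add: e)
    then show ?thesis by simp
  qed
  have smult: "e (a \<odot>\<^bsub>M\<^esub> x) = e (a \<odot>\<^bsub>M\<^esub> s (e x))" if "a \<in> carrier R" "x \<in> carrier M" for a x
  proof -
    have "(a \<odot>\<^bsub>M\<^esub> s (e x)) \<ominus>\<^bsub>M\<^esub> (a \<odot>\<^bsub>M\<^esub> x) = a \<odot>\<^bsub>M\<^esub> (s (e x) \<ominus>\<^bsub>M\<^esub> x)"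
      using s that by (simp add: M.M.minus_eq M.smult_minus M.smult_r_distr)
    then have "e (a \<odot>\<^bsub>M\<^esub> s (e x)) = e (a \<odot>\<^bsub>M\<^esub> x)"
      using s that U by (simp add: e M.smult_closed)
    then show ?thesis by simp
  qed
  show surj: "e ` carrier M = carrier (image_module e M)"
    by (simp add: image_module_def Let_def)
  show "right_module R (image_module e M)"
    by (rule right_module_surj_image[OF assms(1) surj])
      (use add smult in \<open>auto simp: image_module_def Let_def s_def\<close>)
  show "e \<in> rmod_hom R M (image_module e M)"
    by (rule rmod_homI) (use add smult in \<open>auto simp: image_module_def Let_def s_def\<close>)
  have "x \<in> a_kernel M (image_module e M) e \<longleftrightarrow> x \<in> carrier M \<and> x \<ominus>\<^bsub>M\<^esub> \<zero>\<^bsub>M\<^esub> \<in> U" for x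
    using e[of x "\<zero>\<^bsub>M\<^esub>"] by (auto simp: a_kernel_def' image_module_def Let_def)
  moreover have "x \<ominus>\<^bsub>M\<^esub> \<zero>\<^bsub>M\<^esub> = x" if "x \<in> carrier M" for x
    using M.minus_add_cancel[OF that M.M.zero_closed] that by simp
  ultimately show "a_kernel M (image_module e M) e = U"
    using U by auto
qed

text \<open>A list is read as the coefficients of a linear combination of fixed generators, so lists
  of ring elements suffice to name all elements of \<open>M\<close>.\<close>

lemma fgmod_range_lists:
  fixes M :: "('a, 'm) module"
  assumes "M \<in> fgmod R"
  shows "\<exists>g :: 'a list \<Rightarrow> 'm. carrier M \<subseteq> range g"
proof -
  obtain B where B: "finite B" "B \<subseteq> carrier M"
    "\<And>x. x \<in> carrier M \<Longrightarrow> \<exists>c \<in> B \<rightarrow> carrier R. x = (\<Oplus>\<^bsub>M\<^esub>b\<in>B. c b \<odot>\<^bsub>M\<^esub> b)"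
    using assms by (auto simp: fgmod_def finitely_generated_def)
  interpret right_module R M using assms by (rule fgmod_right_module)
  obtain bs where bs: "set bs = B" using finite_list[OF B(1)] by blast
  \<comment> \<open>Repetitions in \<open>bs\<close> do no harm, since \<open>map c bs\<close>
    assigns equal coefficients to equal generators. Lists of the wrong shape may get arbitrary
    values, as only surjectivity onto the carrier is claimed.\<close>
  define g where "g l = (\<Oplus>\<^bsub>M\<^esub>b\<in>B. the (map_of (zip bs l) b) \<odot>\<^bsub>M\<^esub> b)" for l :: "'a list"
  have "x \<in> range g" if x: "x \<in> carrier M" for x
  proof -
    obtain c where c: "c \<in> B \<rightarrow> carrier R" "x = (\<Oplus>\<^bsub>M\<^esub>b\<in>B. c b \<odot>\<^bsub>M\<^esub> b)" using B(3)[OF x] by blast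
    have "c b \<odot>\<^bsub>M\<^esub> b \<in> carrier M" if "b \<in> B" for b
      using that c(1) B(2) by (intro smult_closed) auto
    then have "g (map c bs) = x"
      unfolding g_def c(2) using bs by (intro M.finsum_cong') (auto simp: map_of_zip_map)
    then show ?thesis by blast
  qed
  then show ?thesis by blast
qed

text \<open>A coset is labelled by a coefficient list naming one of its members, which makes the
  quotient a module on lists.\<close>

lemma quotient_lmod:
  fixes M :: "('a, 'm) module"
  assumes "M \<in> fgmod R" "submodule U R M"
  shows "\<exists>(N :: 'a lmod) q. N \<in> fgmod R \<and> q \<in> rmod_hom R M N \<and> q ` carrier M = carrier N
    \<and> a_kernel M N q = U"
proof -
  interpret M: right_module R M using assms(1) by (rule fgmod_right_module)
  obtain g :: "'a list \<Rightarrow> 'm" where g: "carrier M \<subseteq> range g"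
    using fgmod_range_lists[OF assms(1)] by blast
  define e where "e x = (SOME l. g l \<in> carrier M \<and> g l \<ominus>\<^bsub>M\<^esub> x \<in> U)" for x
  note U = assms(2)[unfolded M.submodule_iff]
  have ex: "g (e x) \<in> carrier M \<and> g (e x) \<ominus>\<^bsub>M\<^esub> x \<in> U" if x: "x \<in> carrier M" for x
    unfolding e_def
  proof (rule someI_ex)
    obtain l where "g l = x" using g x by auto
    then show "\<exists>l. g l \<in> carrier M \<and> g l \<ominus>\<^bsub>M\<^esub> x \<in> U"
      using x U by (intro exI[of _ l]) (simp add: M.M.minus_eq M.M.r_neg)
  qed
  have diff: "z \<ominus>\<^bsub>M\<^esub> y \<in> U" if "x \<in> carrier M" "y \<in> carrier M" "z \<in> carrier M"
    "x \<ominus>\<^bsub>M\<^esub> y \<in> U" "z \<ominus>\<^bsub>M\<^esub> x \<in> U" for x y z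
  proof -
    have "z \<ominus>\<^bsub>M\<^esub> y = (z \<ominus>\<^bsub>M\<^esub> x) \<oplus>\<^bsub>M\<^esub> (x \<ominus>\<^bsub>M\<^esub> y)"
      using that by (simp add: M.M.minus_eq M.M.a_ac M.M.r_neg1 M.M.r_neg2)
    then show ?thesis using that U by simp
  qed
  have sym: "y \<ominus>\<^bsub>M\<^esub> x \<in> U" if "x \<in> carrier M" "y \<in> carrier M" "x \<ominus>\<^bsub>M\<^esub> y \<in> U" for x y
  proof -
    have "y \<ominus>\<^bsub>M\<^esub> x = \<zero>\<^bsub>M\<^esub> \<ominus>\<^bsub>M\<^esub> (x \<ominus>\<^bsub>M\<^esub> y)"
      using that by (simp add: M.M.minus_eq M.M.minus_add M.M.a_ac)
    then show ?thesis using that U M.submodule_minus[OF assms(2)] by simp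
  qed
  have e: "e x = e y \<longleftrightarrow> x \<ominus>\<^bsub>M\<^esub> y \<in> U" if xy: "x \<in> carrier M" "y \<in> carrier M" for x y
  proof
    assume "e x = e y"
    then show "x \<ominus>\<^bsub>M\<^esub> y \<in> U"
      using ex[OF xy(1)] ex[OF xy(2)] diff[of "g (e x)" y x] sym[of "g (e x)" x] xy by auto
  next
    assume d: "x \<ominus>\<^bsub>M\<^esub> y \<in> U"
    \<comment> \<open>For congruent \<open>x\<close> and \<open>y\<close> the predicates under the
      choice operator coincide, hence so do the chosen labels.\<close>
    have "g l \<in> carrier M \<and> g l \<ominus>\<^bsub>M\<^esub> x \<in> U \<longleftrightarrow> g l \<in> carrier M \<and> g l \<ominus>\<^bsub>M\<^esub> y \<in> U" for l
      using d xy diff[of x y "g l"] diff[of y x "g l"] sym[of x y] by auto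
    then show "e x = e y" unfolding e_def by simp
  qed
  note im = image_module[OF M.right_module_axioms assms(2) e]
  have "image_module e M \<in> fgmod R" by (rule fgmod_image[OF assms(1) im(1-3)])
  then show ?thesis using im by blast
qed

text \<open>This is the quotient by the zero submodule, together with the inverse of the projection.
  It brings direct sums, whose elements are pairs, back to the type over which the definitions
  quantify.\<close>

lemma lmod_copy:
  fixes M :: "('a, 'm) module"
  assumes "M \<in> fgmod R"
  shows "\<exists>(N :: 'a lmod) q r. N \<in> fgmod R \<and> q \<in> rmod_hom R M N \<and> r \<in> rmod_hom R N M
    \<and> (\<forall>x\<in>carrier M. r (q x) = x) \<and> (\<forall>y\<in>carrier N. q (r y) = y)"
proof -
  interpret M: right_module R M using assms by (rule fgmod_right_module)
  have U: "submodule {\<zero>\<^bsub>M\<^esub>} R M" by (auto simp: M.submodule_iff M.smult_zero)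
  obtain N :: "'a lmod" and q where q: "N \<in> fgmod R" "q \<in> rmod_hom R M N"
    "q ` carrier M = carrier N" "a_kernel M N q = {\<zero>\<^bsub>M\<^esub>}"
    using quotient_lmod[OF assms U] by blast
  have "a_kernel M N q \<subseteq> a_kernel M M (\<lambda>x. x)" unfolding q(4) by (auto simp: a_kernel_def')
  then obtain r where r: "r \<in> rmod_hom R N M" "\<forall>x\<in>carrier M. r (q x) = x"
    using hom_factor[OF M.right_module_axioms fgmod_right_module[OF q(1)] M.right_module_axioms q(2,3) hom_id]
    by blast
  have "q (r y) = y" if y: "y \<in> carrier N" for y
  proof -
    obtain x where "x \<in> carrier M" "y = q x" using y unfolding q(3)[symmetric] by blast
    then show ?thesis using r(2) by simp
  qed
  then show ?thesis using q(1,2) r by (intro exI[of _ N] exI[of _ q] exI[of _ r]) simp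
qed

section \<open>Projective modules\<close>

text \<open>Agrees with \<^const>\<open>fgproj\<close>, except that the carrier of \<open>P\<close> may be of any type.\<close>
definition projective :: "('a, 'r) ring_scheme \<Rightarrow> ('a, 'p) module \<Rightarrow> bool" where
  "projective R P \<longleftrightarrow> P \<in> fgmod R \<and>
     (\<forall>M \<in> fgmod R :: 'a lmod set. \<forall>N \<in> fgmod R :: 'a lmod set.
        \<forall>g \<in> rmod_hom R M N. \<forall>f \<in> rmod_hom R P N.
          g ` carrier M = carrier N \<longrightarrow>
          (\<exists>h \<in> rmod_hom R P M. \<forall>x\<in>carrier P. g (h x) = f x))"

lemma fgproj_iff: "P \<in> fgproj R \<longleftrightarrow> projective R P"
  by (auto simp: fgproj_def projective_def)

lemma projective_fgmod: "projective R P \<Longrightarrow> P \<in> fgmod R"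
  by (simp add: projective_def)

lemma projective_module: "projective R P \<Longrightarrow> right_module R P"
  by (simp add: projective_def fgmod_right_module)

text \<open>Projectivity is only tested on modules of lists; a lifting problem for other types is
  moved to list copies of \<open>M\<close> and \<open>N\<close> and its solution is moved
  back.\<close>

lemma projective_lift:
  fixes M :: "('a, 'm) module" and N :: "('a, 'n) module"
  assumes P: "projective R P" and M: "M \<in> fgmod R" and N: "N \<in> fgmod R"
    and g: "g \<in> rmod_hom R M N" "g ` carrier M = carrier N" and f: "f \<in> rmod_hom R P N"
  shows "\<exists>h\<in>rmod_hom R P M. \<forall>x\<in>carrier P. g (h x) = f x"
proof -
  obtain M' :: "'a lmod" and qM rM where M': "M' \<in> fgmod R" "qM \<in> rmod_hom R M M'" "rM \<in> rmod_hom R M' M"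
    "\<forall>x\<in>carrier M. rM (qM x) = x"
    using lmod_copy[OF M] by blast
  obtain N' :: "'a lmod" and qN rN where N': "N' \<in> fgmod R" "qN \<in> rmod_hom R N N'" "rN \<in> rmod_hom R N' N"
    "\<forall>x\<in>carrier N. rN (qN x) = x" "\<forall>x\<in>carrier N'. qN (rN x) = x"
    using lmod_copy[OF N] by blast
  have "(\<lambda>x. qN (g (rM x))) \<in> rmod_hom R M' N'" "(\<lambda>x. qN (f x)) \<in> rmod_hom R P N'"
    by (rule hom_comp[OF hom_comp[OF M'(3) g(1)] N'(2)], rule hom_comp[OF f N'(2)])
  moreover have "(\<lambda>x. qN (g (rM x))) ` carrier M' = carrier N'"
  proof
    show "(\<lambda>x. qN (g (rM x))) ` carrier M' \<subseteq> carrier N'"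
      by (auto intro: hom_closed[OF N'(2)] hom_closed[OF g(1)] hom_closed[OF M'(3)])
    show "carrier N' \<subseteq> (\<lambda>x. qN (g (rM x))) ` carrier M'"
    proof
      fix y assume y: "y \<in> carrier N'"
      then obtain x where x: "x \<in> carrier M" "g x = rN y"
        using g(2) hom_closed[OF N'(3)] by (metis imageE)
      then have "y = qN (g (rM (qM x)))" using y N' M' by simp
      then show "y \<in> (\<lambda>x. qN (g (rM x))) ` carrier M'" using x hom_closed[OF M'(2)] by blast
    qed
  qed
  ultimately obtain h where h: "h \<in> rmod_hom R P M'" "\<And>x. x \<in> carrier P \<Longrightarrow> qN (g (rM (h x))) = qN (f x)"
    using P M'(1) N'(1) unfolding projective_def by meson
  have "g (rM (h x)) = f x" if "x \<in> carrier P" for x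
    using arg_cong[OF h(2)[OF that], of rN] N'(4) that
    by (simp add: hom_closed[OF h(1)] hom_closed[OF M'(3)] hom_closed[OF g(1)] hom_closed[OF f])
  then show ?thesis by (intro bexI[OF _ hom_comp[OF h(1) M'(3)]]) simp
qed

lemma projective_retract:
  assumes P: "projective R P" and N: "N \<in> fgmod R"
    and i: "i \<in> rmod_hom R N P" and r: "r \<in> rmod_hom R P N" and ri: "\<And>x. x \<in> carrier N \<Longrightarrow> r (i x) = x"
  shows "projective R N"
  unfolding projective_def
proof (intro conjI ballI impI N)
  fix X Y :: "'a lmod" and g f
  assume a: "X \<in> fgmod R" "Y \<in> fgmod R" "g \<in> rmod_hom R X Y" "f \<in> rmod_hom R N Y" "g ` carrier X = carrier Y"
  obtain h where h: "h \<in> rmod_hom R P X" "\<forall>x\<in>carrier P. g (h x) = f (r x)"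
    using projective_lift[OF P a(1-3,5) hom_comp[OF r a(4)]] by blast
  show "\<exists>h\<in>rmod_hom R N X. \<forall>x\<in>carrier N. g (h x) = f x"
    using h ri hom_closed[OF i] by (intro bexI[OF _ hom_comp[OF i h(1)]]) simp
qed

lemma projective_direct_sum:
  assumes P: "projective R P" and Q: "projective R Q"
  shows "projective R (P \<oplus>\<^sub>m Q)"
  unfolding projective_def
proof (intro conjI ballI impI)
  show "P \<oplus>\<^sub>m Q \<in> fgmod R" using P Q by (intro fgmod_direct_sum projective_fgmod)
  interpret P: right_module R P by (rule projective_module[OF P])
  interpret Q: right_module R Q by (rule projective_module[OF Q])
  fix X Y :: "'a lmod" and g f
  assume a: "X \<in> fgmod R" "Y \<in> fgmod R" "g \<in> rmod_hom R X Y" "f \<in> rmod_hom R (P \<oplus>\<^sub>m Q) Y"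
    "g ` carrier X = carrier Y"
  interpret X: right_module R X by (rule fgmod_right_module[OF a(1)])
  have "(\<lambda>x. f (x, \<zero>\<^bsub>Q\<^esub>)) \<in> rmod_hom R P Y"
    by (rule hom_comp[OF hom_pair[OF hom_id hom_const_zero[OF Q.right_module_axioms]] a(4)])
  then obtain h where h: "h \<in> rmod_hom R P X" "\<forall>x\<in>carrier P. g (h x) = f (x, \<zero>\<^bsub>Q\<^esub>)"
    using projective_lift[OF P a(1-3,5)] by blast
  have "(\<lambda>x. f (\<zero>\<^bsub>P\<^esub>, x)) \<in> rmod_hom R Q Y"
    by (rule hom_comp[OF hom_pair[OF hom_const_zero[OF P.right_module_axioms] hom_id] a(4)])
  then obtain k where k: "k \<in> rmod_hom R Q X" "\<forall>x\<in>carrier Q. g (k x) = f (\<zero>\<^bsub>P\<^esub>, x)"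
    using projective_lift[OF Q a(1-3,5)] by blast
  have "(\<lambda>z. h (fst z) \<oplus>\<^bsub>X\<^esub> k (snd z)) \<in> rmod_hom R (P \<oplus>\<^sub>m Q) X"
    by (intro hom_plus hom_fst_comp hom_snd_comp h k right_module_direct_sum
        P.right_module_axioms Q.right_module_axioms X.right_module_axioms)
  moreover have "g (h (fst z) \<oplus>\<^bsub>X\<^esub> k (snd z)) = f z" if zPQ: "z \<in> carrier (P \<oplus>\<^sub>m Q)" for z
  proof -
    obtain x y where z: "z = (x, y)" "x \<in> carrier P" "y \<in> carrier Q" using zPQ by auto
    then show ?thesis
      using hom_add[OF a(4), of "(x, \<zero>\<^bsub>Q\<^esub>)" "(\<zero>\<^bsub>P\<^esub>, y)"] h(2) k(2)
      by (simp add: hom_add[OF a(3)] hom_closed[OF h(1)] hom_closed[OF k(1)])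
  qed
  ultimately show "\<exists>h\<in>rmod_hom R (P \<oplus>\<^sub>m Q) X. \<forall>x\<in>carrier (P \<oplus>\<^sub>m Q). g (h x) = f x"
    by (intro bexI[of _ "\<lambda>z. h (fst z) \<oplus>\<^bsub>X\<^esub> k (snd z)"]) simp_all
qed

lemma projective_copy:
  fixes P :: "('a, 'p) module"
  assumes P: "projective R P"
  shows "\<exists>(Q :: 'a lmod) q r. Q \<in> fgproj R \<and> q \<in> rmod_hom R P Q \<and> r \<in> rmod_hom R Q P
    \<and> (\<forall>x\<in>carrier P. r (q x) = x) \<and> (\<forall>y\<in>carrier Q. q (r y) = y)"
proof -
  obtain Q :: "'a lmod" and q r where Q: "Q \<in> fgmod R" "q \<in> rmod_hom R P Q" "r \<in> rmod_hom R Q P"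
    "\<forall>x\<in>carrier P. r (q x) = x" "\<forall>y\<in>carrier Q. q (r y) = y"
    using lmod_copy[OF projective_fgmod[OF P]] by blast
  moreover have "projective R Q" by (rule projective_retract[OF P Q(1,3,2)]) (use Q(5) in blast)
  ultimately show ?thesis unfolding fgproj_iff by blast
qed

definition zero_lmod :: "'a lmod" where
  "zero_lmod = \<lparr>carrier = {[]}, monoid.mult = undefined, monoid.one = undefined,
     ring.zero = [], ring.add = (\<lambda>_ _. []), module.smult = (\<lambda>_ _. [])\<rparr>"

lemma zero_lmod:
  assumes "ring R"
  shows "projective R zero_lmod" "carrier zero_lmod = {\<zero>\<^bsub>zero_lmod\<^esub>}"
proof -
  show c: "carrier zero_lmod = {\<zero>\<^bsub>zero_lmod\<^esub>}" by (simp add: zero_lmod_def)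
  have "right_module R zero_lmod" using assms by (rule right_moduleI) (auto simp: zero_lmod_def)
  then interpret Z: right_module R zero_lmod .
  have "finitely_generated R zero_lmod"
    unfolding Z.finitely_generated_iff by (rule exI[of _ "{}"]) (auto simp: c Z.submodule_iff)
  then have Z: "zero_lmod \<in> fgmod R" using Z.right_module_axioms by (simp add: fgmod_def)
  have "\<exists>h\<in>rmod_hom R zero_lmod M. \<forall>x\<in>carrier zero_lmod. g (h x) = f x"
    if "M \<in> fgmod R" "N \<in> fgmod R" "g \<in> rmod_hom R M N" "f \<in> rmod_hom R zero_lmod N" for M N :: "'a lmod" and g f
    using hom_zero[OF Z.right_module_axioms fgmod_right_module[OF that(2)] that(4)]
      hom_zero[OF fgmod_right_module[OF that(1)] fgmod_right_module[OF that(2)] that(3)]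
    by (intro bexI[OF _ hom_const_zero[OF fgmod_right_module[OF that(1)]]]) (simp add: c)
  then show "projective R zero_lmod" unfolding projective_def using Z by blast
qed

text \<open>The scalar multiplies on the right, matching the reading of scalar multiplication as a
  right action. Elements are ring elements, so the module enters \<open>fgproj\<close> only through
  a copy.\<close>

definition regular_module :: "('a, 'r) ring_scheme \<Rightarrow> ('a, 'a) module" where
  "regular_module R = \<lparr>carrier = carrier R, monoid.mult = undefined, monoid.one = undefined,
     ring.zero = \<zero>\<^bsub>R\<^esub>, ring.add = ring.add R, module.smult = (\<lambda>a x. x \<otimes>\<^bsub>R\<^esub> a)\<rparr>"

lemma regular_module_simps [simp]:
  "carrier (regular_module R) = carrier R" "\<zero>\<^bsub>regular_module R\<^esub> = \<zero>\<^bsub>R\<^esub>"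
  "x \<oplus>\<^bsub>regular_module R\<^esub> y = x \<oplus>\<^bsub>R\<^esub> y" "a \<odot>\<^bsub>regular_module R\<^esub> x = x \<otimes>\<^bsub>R\<^esub> a"
  by (simp_all add: regular_module_def)

lemma (in right_module) hom_regular: "m \<in> carrier M \<Longrightarrow> (\<lambda>a. a \<odot>\<^bsub>M\<^esub> m) \<in> rmod_hom R (regular_module R) M"
  by (rule rmod_homI) (auto simp: smult_closed smult_l_distr smult_assoc)

lemma projective_regular:
  assumes "ring R"
  shows "projective R (regular_module R)"
proof -
  interpret R: ring R by fact
  have "\<exists>y\<in>carrier R. y \<oplus>\<^bsub>R\<^esub> x = \<zero>\<^bsub>R\<^esub>" if "x \<in> carrier R" for x
    using that R.l_neg by blast
  then have "right_module R (regular_module R)"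
    by (intro right_moduleI R.ring_axioms) (auto simp: R.a_assoc R.l_distr R.r_distr R.m_assoc intro: R.a_comm)
  then interpret M: right_module R "regular_module R" .
  have "U = carrier R" if U: "submodule U R (regular_module R)" "\<one>\<^bsub>R\<^esub> \<in> U" for U
  proof -
    have "\<one>\<^bsub>R\<^esub> \<otimes>\<^bsub>R\<^esub> a \<in> U" if "a \<in> carrier R" for a
      using U that unfolding M.submodule_iff by fastforce
    then show ?thesis using U unfolding M.submodule_iff by auto
  qed
  then have "finitely_generated R (regular_module R)"
    unfolding M.finitely_generated_iff by (intro exI[of _ "{\<one>\<^bsub>R\<^esub>}"]) simp
  then have fg: "regular_module R \<in> fgmod R" using M.right_module_axioms by (simp add: fgmod_def)
  have "\<exists>h\<in>rmod_hom R (regular_module R) M. \<forall>x\<in>carrier (regular_module R). g (h x) = f x"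
    if M: "M \<in> fgmod R" "N \<in> fgmod R" and g: "g \<in> rmod_hom R M N"
      and f: "f \<in> rmod_hom R (regular_module R) N" and surj: "g ` carrier M = carrier N"
    for M N :: "'a lmod" and g f
  proof -
    interpret N: right_module R M using M(1) by (rule fgmod_right_module)
    \<comment> \<open>The module is free on the unit: a preimage \<open>m\<close> of the image of
      the unit determines the lift.\<close>
    obtain m where m: "m \<in> carrier M" "g m = f \<one>\<^bsub>R\<^esub>"
      using surj hom_closed[OF f] by (metis R.one_closed imageE regular_module_simps(1))
    have "g (a \<odot>\<^bsub>M\<^esub> m) = f a" if "a \<in> carrier R" for a
      using that m hom_smult[OF f, of a "\<one>\<^bsub>R\<^esub>"] by (simp add: hom_smult[OF g])
    then show ?thesis by (intro bexI[OF _ N.hom_regular[OF m(1)]]) simp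
  qed
  then show ?thesis unfolding projective_def using fg by blast
qed

lemma enough_projectives:
  fixes M :: "('a, 'm) module"
  assumes "M \<in> fgmod R"
  shows "\<exists>P\<in>fgproj R. \<exists>p\<in>rmod_hom R P M. p ` carrier P = carrier M"
proof -
  interpret M: right_module R M using assms by (rule fgmod_right_module)
  obtain B where B: "finite B" "B \<subseteq> carrier M"
    "\<And>U. submodule U R M \<Longrightarrow> B \<subseteq> U \<Longrightarrow> U = carrier M"
    using assms M.finitely_generated_iff by (auto simp: fgmod_def)
  \<comment> \<open>Covering the elements of \<open>B\<close> suffices, because an image is a
    submodule. The free module grows by one copy of the regular module per generator and is recoded
    as a module of lists each time.\<close>
  have "\<exists>P\<in>fgproj R. \<exists>p\<in>rmod_hom R P M. B \<subseteq> p ` carrier P"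
    using B(1,2)
  proof (induction B)
    case empty
    then show ?case
      using zero_lmod(1)[OF M.R.ring_axioms] hom_const_zero[OF M.right_module_axioms] fgproj_iff by blast
  next
    case (insert b B)
    then obtain P p where P: "P \<in> fgproj R" "p \<in> rmod_hom R P M" "B \<subseteq> p ` carrier P" by auto
    have b: "b \<in> carrier M" using insert.prems by simp
    interpret P: right_module R P using P(1) by (auto simp: fgproj_iff intro: projective_module)
    have proj: "projective R (P \<oplus>\<^sub>m regular_module R)"
      using P(1) by (auto simp: fgproj_iff intro: projective_direct_sum projective_regular M.R.ring_axioms)
    obtain Q :: "'a lmod" and q r where Q: "Q \<in> fgproj R" "q \<in> rmod_hom R (P \<oplus>\<^sub>m regular_module R) Q"
      "r \<in> rmod_hom R Q (P \<oplus>\<^sub>m regular_module R)" "\<forall>x\<in>carrier (P \<oplus>\<^sub>m regular_module R). r (q x) = x"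
      using projective_copy[OF proj] by blast
    \<comment> \<open>The map extends \<open>p\<close> by sending the unit of the new summand to
      \<open>b\<close>.\<close>
    let ?s = "\<lambda>z. p (fst z) \<oplus>\<^bsub>M\<^esub> snd z \<odot>\<^bsub>M\<^esub> b"
    have s: "?s \<in> rmod_hom R (P \<oplus>\<^sub>m regular_module R) M"
      by (intro hom_plus hom_fst_comp hom_snd_comp[OF M.hom_regular] P(2) b projective_module[OF proj] M.right_module_axioms)
    have in_im: "?s z \<in> (\<lambda>x. ?s (r x)) ` carrier Q" if "z \<in> carrier (P \<oplus>\<^sub>m regular_module R)" for z
      using that Q(4) hom_closed[OF Q(2) that] by (intro image_eqI[of _ _ "q z"]) auto
    have "p x \<in> (\<lambda>x. ?s (r x)) ` carrier Q" if "x \<in> carrier P" for x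
      using in_im[of "(x, \<zero>\<^bsub>R\<^esub>)"] that hom_closed[OF P(2)] b by (simp add: M.zero_smult)
    moreover have "b \<in> (\<lambda>x. ?s (r x)) ` carrier Q"
      using in_im[of "(\<zero>\<^bsub>P\<^esub>, \<one>\<^bsub>R\<^esub>)"] b
      by (simp add: M.smult_one hom_zero[OF P.right_module_axioms M.right_module_axioms P(2)])
    ultimately have "insert b B \<subseteq> (\<lambda>x. ?s (r x)) ` carrier Q" using P(3) by blast
    then show ?case by (intro bexI[OF _ Q(1)] bexI[OF _ hom_comp[OF Q(3) s]])
  qed
  then obtain P p where P: "P \<in> fgproj R" "p \<in> rmod_hom R P M" "B \<subseteq> p ` carrier P" by blast
  then have "p ` carrier P = carrier M"
    using image_submodule[OF _ M.right_module_axioms P(2)] by (intro B(3)) (auto simp: fgproj_iff projective_module)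
  then show ?thesis using P by blast
qed

section \<open>Stable retracts\<close>

text \<open>Here the projective through which the error term factors may have any carrier type, so
  it can be a direct sum; a list copy replaces it in the definition.\<close>

lemma stable_retractI:
  assumes M: "right_module R M" and P: "projective R P"
    and s: "s \<in> rmod_hom R M N" and t: "t \<in> rmod_hom R N M"
    and u: "u \<in> rmod_hom R M P" and v: "v \<in> rmod_hom R P M"
    and eq: "\<And>x. x \<in> carrier M \<Longrightarrow> t (s x) = x \<oplus>\<^bsub>M\<^esub> v (u x)"
  shows "stable_retract R M N"
proof -
  interpret M: right_module R M by fact
  obtain Q :: "'a lmod" and q r where Q: "Q \<in> fgproj R" "q \<in> rmod_hom R P Q" "r \<in> rmod_hom R Q P"
    "\<forall>x\<in>carrier P. r (q x) = x"
    using projective_copy[OF P] by blast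
  have "(t \<circ> s) x \<ominus>\<^bsub>M\<^esub> id x = v (r (q (u x)))" if "x \<in> carrier M" for x
    using that Q(4) hom_closed[OF u that] hom_closed[OF v, of "u x"]
    by (simp add: eq M.M.minus_eq M.M.a_ac M.M.r_neg2)
  then show ?thesis
    unfolding stable_retract_def stably_equal_def
    by (intro bexI[OF _ s] bexI[OF _ t] bexI[OF _ Q(1)] bexI[OF _ hom_comp[OF u Q(2)]]
        bexI[OF _ hom_comp[OF Q(3) v]]) simp
qed

lemma stable_retractE:
  fixes R :: "('a, 'r) ring_scheme"
  assumes "stable_retract R M N" "right_module R M"
  obtains P :: "'a lmod" and s t u v where "projective R P" "s \<in> rmod_hom R M N" "t \<in> rmod_hom R N M"
    "u \<in> rmod_hom R M P" "v \<in> rmod_hom R P M"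
    "\<forall>x\<in>carrier M. t (s x) = x \<oplus>\<^bsub>M\<^esub> v (u x)"
proof -
  interpret M: right_module R M by fact
  obtain s t P u v where *: "P \<in> fgproj R" "s \<in> rmod_hom R M N" "t \<in> rmod_hom R N M"
    "u \<in> rmod_hom R M P" "v \<in> rmod_hom R P M"
    "\<forall>x\<in>carrier M. (t \<circ> s) x \<ominus>\<^bsub>M\<^esub> id x = v (u x)"
    using assms(1) unfolding stable_retract_def stably_equal_def by blast
  have "t (s x) = x \<oplus>\<^bsub>M\<^esub> v (u x)" if x: "x \<in> carrier M" for x
  proof -
    have tc: "t (s x) \<in> carrier M" using x by (intro hom_closed[OF *(3)] hom_closed[OF *(2)])
    have "t (s x) = (t (s x) \<ominus>\<^bsub>M\<^esub> x) \<oplus>\<^bsub>M\<^esub> x" using M.minus_add_cancel[OF tc x] by simp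
    also have "t (s x) \<ominus>\<^bsub>M\<^esub> x = v (u x)" using *(6) x by simp
    finally show ?thesis using x hom_closed[OF *(5) hom_closed[OF *(4) x]] by (simp add: M.M.a_comm)
  qed
  then show ?thesis using that[of P s t u v] * by (simp add: fgproj_iff)
qed

lemma stable_retract_of_retract:
  assumes "right_module R M" "s \<in> rmod_hom R M N" "t \<in> rmod_hom R N M"
    and "\<And>x. x \<in> carrier M \<Longrightarrow> t (s x) = x"
  shows "stable_retract R M N"
proof -
  interpret M: right_module R M by fact
  note Z = zero_lmod(1)[OF M.R.ring_axioms]
  show ?thesis
    by (rule stable_retractI[OF assms(1) Z assms(2,3) hom_const_zero[OF projective_module[OF Z]]
        hom_const_zero[OF assms(1)]]) (simp add: assms(4))
qed

lemma stable_retract_refl: "right_module R M \<Longrightarrow> stable_retract R M M"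
  by (rule stable_retract_of_retract[OF _ hom_id hom_id]) simp_all

lemma stable_retract_trans:
  fixes R :: "('a, 'r) ring_scheme"
  assumes "right_module R M" "right_module R N" "stable_retract R M N" "stable_retract R N L"
  shows "stable_retract R M L"
proof -
  interpret M: right_module R M by fact
  obtain P :: "'a lmod" and s t u v where 1: "projective R P" "s \<in> rmod_hom R M N" "t \<in> rmod_hom R N M"
    "u \<in> rmod_hom R M P" "v \<in> rmod_hom R P M"
    "\<forall>x\<in>carrier M. t (s x) = x \<oplus>\<^bsub>M\<^esub> v (u x)"
    by (rule stable_retractE[OF assms(3,1)], rule that)
  obtain P' :: "'a lmod" and s' t' u' v' where 2: "projective R P'" "s' \<in> rmod_hom R N L" "t' \<in> rmod_hom R L N"
    "u' \<in> rmod_hom R N P'" "v' \<in> rmod_hom R P' N"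
    "\<forall>x\<in>carrier N. t' (s' x) = x \<oplus>\<^bsub>N\<^esub> v' (u' x)"
    by (rule stable_retractE[OF assms(4,2)], rule that)
  note PP = projective_direct_sum[OF 1(1) 2(1)]
  show ?thesis
  proof (rule stable_retractI[OF assms(1) PP])
    show "(\<lambda>x. s' (s x)) \<in> rmod_hom R M L" by (rule hom_comp[OF 1(2) 2(2)])
    show "(\<lambda>x. t (t' x)) \<in> rmod_hom R L M" by (rule hom_comp[OF 2(3) 1(3)])
    \<comment> \<open>Expanding t t' s' s = t (1 + v' u') s gives 1 + v u + (t v') (u' s). The two
      error terms factor together through the direct sum of \<open>P\<close> and
      \<open>P'\<close>.\<close>
    show "(\<lambda>x. (u x, u' (s x))) \<in> rmod_hom R M (P \<oplus>\<^sub>m P')"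
      by (intro hom_pair 1 hom_comp[OF 1(2) 2(4)])
    show "(\<lambda>z. v (fst z) \<oplus>\<^bsub>M\<^esub> t (v' (snd z))) \<in> rmod_hom R (P \<oplus>\<^sub>m P') M"
      by (rule hom_plus[OF projective_module[OF PP] assms(1) hom_fst_comp[OF 1(5)]
            hom_snd_comp[OF hom_comp[OF 2(5) 1(3)]]])
    fix x assume x: "x \<in> carrier M"
    note sx = hom_closed[OF 1(2) x]
    note vx = hom_closed[OF 2(5) hom_closed[OF 2(4) sx]]
    show "t (t' (s' (s x))) = x \<oplus>\<^bsub>M\<^esub> (v (fst (u x, u' (s x))) \<oplus>\<^bsub>M\<^esub> t (v' (snd (u x, u' (s x)))))"
      using x hom_closed[OF 1(3) vx] hom_closed[OF 1(5) hom_closed[OF 1(4) x]]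
      by (simp add: 2(6)[rule_format, OF sx] hom_add[OF 1(3) sx vx] 1(6)[rule_format, OF x] M.M.a_assoc)
  qed
qed

text \<open>The identity of \<open>P\<close> factors through \<open>P\<close>, so \<open>P\<close>
  is stably zero: with both maps between \<open>P\<close> and \<open>N\<close> zero, the error term
  is minus the identity, given by u = 1 and v = -1.\<close>

lemma projective_stable_retract:
  assumes P: "projective R P" and N: "right_module R N"
  shows "stable_retract R P N"
proof -
  note PM = projective_module[OF P]
  interpret P: right_module R P by (rule PM)
  show ?thesis
    by (rule stable_retractI[OF PM P hom_const_zero[OF N] hom_const_zero[OF PM] hom_id
        hom_diff[OF PM PM hom_const_zero[OF PM] hom_id]]) (simp add: P.M.minus_eq P.M.r_neg)
qed

text \<open>
  With \<open>Y = X\<close> this says that syzygies are stably independent of the presentation (Schanuel);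
  in general, that they are functorial on the stable category.
\<close>
lemma syzygy_stable_retract:
  fixes R :: "('a, 'r) ring_scheme"
  assumes P: "projective R P" and Q: "projective R Q"
    and se: "short_exact R U i P p X" "short_exact R V j Q q Y"
    and X: "X \<in> fgmod R" and Y: "Y \<in> fgmod R" and U: "right_module R U" and V: "right_module R V"
    and XY: "stable_retract R X Y"
  shows "stable_retract R U V"
proof -
  note mods = projective_module[OF P] projective_module[OF Q] fgmod_right_module[OF X] fgmod_right_module[OF Y] U V
  interpret P: right_module R P by (rule mods)
  interpret X: right_module R X by (rule mods)
  interpret U: right_module R U by (rule mods)
  obtain L :: "'a lmod" and s t u v where L: "projective R L" "s \<in> rmod_hom R X Y" "t \<in> rmod_hom R Y X"
    "u \<in> rmod_hom R X L" "v \<in> rmod_hom R L X"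
    "\<forall>x\<in>carrier X. t (s x) = x \<oplus>\<^bsub>X\<^esub> v (u x)"
    by (rule stable_retractE[OF XY mods(3)], rule that)
  have i: "i \<in> rmod_hom R U P" "inj_on i (carrier U)" "i ` carrier U = a_kernel P X p"
    and p: "p \<in> rmod_hom R P X" "p ` carrier P = carrier X"
    and j: "j \<in> rmod_hom R V Q" "j ` carrier V = a_kernel Q Y q"
    and q: "q \<in> rmod_hom R Q Y" "q ` carrier Q = carrier Y"
    using se by (auto simp: short_exact_def)
  have pi: "p (i x) = \<zero>\<^bsub>X\<^esub>" if "x \<in> carrier U" for x using that i(3) by (auto simp: a_kernel_def')
  have qj: "q (j x) = \<zero>\<^bsub>Y\<^esub>" if "x \<in> carrier V" for x using that j(2) by (auto simp: a_kernel_def')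
  \<comment> \<open>\<open>S\<close> and \<open>T\<close> lift the maps between \<open>X\<close> and
    \<open>Y\<close> to the projectives and restrict to maps between the kernels; \<open>w\<close>
    lifts the projective error \<open>v\<close>, so that it can be subtracted upstairs as
    well.\<close>
  obtain S where S: "S \<in> rmod_hom R P Q" "\<forall>x\<in>carrier P. q (S x) = s (p x)"
    using projective_lift[OF P projective_fgmod[OF Q] Y q hom_comp[OF p(1) L(2)]] by blast
  obtain T where T: "T \<in> rmod_hom R Q P" "\<forall>x\<in>carrier Q. p (T x) = t (q x)"
    using projective_lift[OF Q projective_fgmod[OF P] X p hom_comp[OF q(1) L(3)]] by blast
  obtain w where w: "w \<in> rmod_hom R L P" "\<forall>x\<in>carrier L. p (w x) = v x"
    using projective_lift[OF L(1) projective_fgmod[OF P] X p L(5)] by blast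
  have "q (S (i x)) = \<zero>\<^bsub>Y\<^esub>" if "x \<in> carrier U" for x
    using that S(2) hom_closed[OF i(1)] by (simp add: pi hom_zero[OF mods(3,4) L(2)])
  then obtain s' where s': "s' \<in> rmod_hom R U V" "\<forall>x\<in>carrier U. j (s' x) = S (i x)"
    using short_exact_lift[OF mods(6,2,5) se(2) hom_comp[OF i(1) S(1)]] by blast
  have "p (T (j x)) = \<zero>\<^bsub>X\<^esub>" if "x \<in> carrier V" for x
    using that T(2) hom_closed[OF j(1)] by (simp add: qj hom_zero[OF mods(4,3) L(3)])
  then obtain t' where t': "t' \<in> rmod_hom R V U" "\<forall>x\<in>carrier V. i (t' x) = T (j x)"
    using short_exact_lift[OF mods(5,1,6) se(1) hom_comp[OF j(1) T(1)]] by blast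
  \<comment> \<open>Applying \<open>p\<close> gives t s p - p - v u p = 0, so this map factors
    through \<open>U\<close> by some \<open>v'\<close>. On \<open>U\<close> the last term vanishes
    because p i = 0, which leaves t' s' = 1 + v' i: the error on kernels factors through
    \<open>P\<close>.\<close>
  let ?D = "\<lambda>x. (T (S x) \<ominus>\<^bsub>P\<^esub> x) \<ominus>\<^bsub>P\<^esub> w (u (p x))"
  have D: "?D \<in> rmod_hom R P P"
    by (intro hom_diff mods hom_id hom_comp[OF S(1) T(1)] hom_comp[OF hom_comp[OF p(1) L(4)] w(1)])
  have "p (?D x) = \<zero>\<^bsub>X\<^esub>" if x: "x \<in> carrier P" for x
  proof -
    note px = hom_closed[OF p(1) x]
    note c = hom_closed[OF S(1) x] hom_closed[OF T(1) hom_closed[OF S(1) x]] hom_closed[OF L(4) px]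
      hom_closed[OF w(1) hom_closed[OF L(4) px]] hom_closed[OF L(5) hom_closed[OF L(4) px]]
    have "p (?D x) = ((p x \<oplus>\<^bsub>X\<^esub> v (u (p x))) \<ominus>\<^bsub>X\<^esub> p x) \<ominus>\<^bsub>X\<^esub> v (u (p x))"
      using x px c S(2) T(2) w(2)
      by (simp add: hom_minus[OF mods(1,3) p(1)] L(6)[rule_format, symmetric])
    also have "\<dots> = \<zero>\<^bsub>X\<^esub>" using px c by (simp add: X.M.minus_eq X.M.a_ac X.M.r_neg X.M.r_neg2)
    finally show ?thesis .
  qed
  then obtain v' where v': "v' \<in> rmod_hom R P U" "\<forall>x\<in>carrier P. i (v' x) = ?D x"
    using short_exact_lift[OF mods(5,1,1) se(1) D] by blast
  show ?thesis
  proof (rule stable_retractI[OF U P s'(1) t'(1) i(1) v'(1)])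
    fix x assume x: "x \<in> carrier U"
    note ix = hom_closed[OF i(1) x]
    note c = ix hom_closed[OF S(1) ix] hom_closed[OF T(1) hom_closed[OF S(1) ix]]
      hom_closed[OF t'(1) hom_closed[OF s'(1) x]] hom_closed[OF v'(1) ix] hom_closed[OF s'(1) x]
    have "i (t' (s' x)) = T (S (i x))" using x c s'(2) t'(2) by simp
    moreover have "?D (i x) = T (S (i x)) \<ominus>\<^bsub>P\<^esub> i x"
      using c by (simp add: pi[OF x] hom_zero[OF mods(3) projective_module[OF L(1)] L(4)]
        hom_zero[OF projective_module[OF L(1)] mods(1) w(1)] P.M.minus_eq)
    ultimately have "i (x \<oplus>\<^bsub>U\<^esub> v' (i x)) = i (t' (s' x))"
      using x c v'(2) P.minus_add_cancel[of "T (S (i x))" "i x"] by (simp add: hom_add[OF i(1)] P.M.a_comm)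
    then show "t' (s' x) = x \<oplus>\<^bsub>U\<^esub> v' (i x)"
      using i(2) x c by (auto simp: inj_on_def)
  qed
qed

section \<open>Submodules generated by a set\<close>

definition generated :: "('a, 'r) ring_scheme \<Rightarrow> ('a, 'm) module \<Rightarrow> 'm set \<Rightarrow> 'm set" where
  "generated R M B = \<Inter>{W. submodule W R M \<and> B \<subseteq> W}"

lemma generated_least: "\<lbrakk>submodule W R M; B \<subseteq> W\<rbrakk> \<Longrightarrow> generated R M B \<subseteq> W"
  by (auto simp: generated_def)

lemma generated_superset: "B \<subseteq> generated R M B"
  by (auto simp: generated_def)

lemma (in right_module) generated_submodule:
  assumes "B \<subseteq> carrier M"
  shows "submodule (generated R M B) R M"
proof -
  have "generated R M B \<subseteq> carrier M" by (rule generated_least[OF submodule_carrier assms])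
  then show ?thesis unfolding submodule_iff by (auto simp: generated_def submodule_iff)
qed

text \<open>The sums on the right form a submodule containing \<open>B\<close> and \<open>b\<close>.
  Hence one new generator costs one scalar, which drives the induction that constructs the
  rank.\<close>

lemma (in right_module) generated_insert:
  assumes "b \<in> carrier M" "B \<subseteq> carrier M" "x \<in> generated R M (insert b B)"
  shows "\<exists>w\<in>generated R M B. \<exists>a\<in>carrier R. x = w \<oplus>\<^bsub>M\<^esub> a \<odot>\<^bsub>M\<^esub> b"
proof -
  note G = generated_submodule[OF assms(2), unfolded submodule_iff]
  let ?W = "{w \<oplus>\<^bsub>M\<^esub> a \<odot>\<^bsub>M\<^esub> b | w a. w \<in> generated R M B \<and> a \<in> carrier R}"
  have c: "w \<in> carrier M" if "w \<in> generated R M B" for w using G that by auto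
  have W: "submodule ?W R M"
    unfolding submodule_iff
  proof (intro conjI ballI)
    show "?W \<subseteq> carrier M" using c assms(1) by (auto simp: smult_closed)
    have "\<zero>\<^bsub>M\<^esub> = \<zero>\<^bsub>M\<^esub> \<oplus>\<^bsub>M\<^esub> \<zero>\<^bsub>R\<^esub> \<odot>\<^bsub>M\<^esub> b" using assms(1) by (simp add: zero_smult)
    then show "\<zero>\<^bsub>M\<^esub> \<in> ?W" using G R.zero_closed by blast
  next
    fix x y assume "x \<in> ?W" "y \<in> ?W"
    then obtain w a w' a' where *: "x = w \<oplus>\<^bsub>M\<^esub> a \<odot>\<^bsub>M\<^esub> b" "y = w' \<oplus>\<^bsub>M\<^esub> a' \<odot>\<^bsub>M\<^esub> b"
      "w \<in> generated R M B" "a \<in> carrier R" "w' \<in> generated R M B" "a' \<in> carrier R" by blast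
    have "x \<oplus>\<^bsub>M\<^esub> y = (w \<oplus>\<^bsub>M\<^esub> w') \<oplus>\<^bsub>M\<^esub> (a \<oplus>\<^bsub>R\<^esub> a') \<odot>\<^bsub>M\<^esub> b"
      using * c assms(1) by (simp add: smult_l_distr smult_closed M.a_ac)
    then show "x \<oplus>\<^bsub>M\<^esub> y \<in> ?W" using * G R.add.m_closed by blast
  next
    fix k x assume k: "k \<in> carrier R" and "x \<in> ?W"
    then obtain w a where *: "x = w \<oplus>\<^bsub>M\<^esub> a \<odot>\<^bsub>M\<^esub> b" "w \<in> generated R M B" "a \<in> carrier R" by blast
    have "k \<odot>\<^bsub>M\<^esub> x = k \<odot>\<^bsub>M\<^esub> w \<oplus>\<^bsub>M\<^esub> (a \<otimes>\<^bsub>R\<^esub> k) \<odot>\<^bsub>M\<^esub> b"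
      using * k c assms(1) by (simp add: smult_r_distr smult_closed smult_assoc)
    then show "k \<odot>\<^bsub>M\<^esub> x \<in> ?W" using * k G R.m_closed by blast
  qed
  have "w = w \<oplus>\<^bsub>M\<^esub> \<zero>\<^bsub>R\<^esub> \<odot>\<^bsub>M\<^esub> b" if "w \<in> generated R M B" for w
    using c[OF that] assms(1) by (simp add: zero_smult)
  then have "B \<subseteq> ?W" using generated_superset[of B R M] R.zero_closed by blast
  moreover have "b = \<zero>\<^bsub>M\<^esub> \<oplus>\<^bsub>M\<^esub> \<one>\<^bsub>R\<^esub> \<odot>\<^bsub>M\<^esub> b" using assms(1) by (simp add: smult_one)
  then have "b \<in> ?W" using G R.one_closed by blast
  ultimately have "generated R M (insert b B) \<subseteq> ?W" by (intro generated_least[OF W]) simp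
  then show ?thesis using assms(3) by blast
qed

lemma (in right_module) submodule_Int:
  "\<lbrakk>submodule U R M; submodule V R M\<rbrakk> \<Longrightarrow> submodule (U \<inter> V) R M"
  by (auto simp: submodule_iff)

text \<open>A substitute for the dimension: \<open>\<phi> U\<close> counts the pivot positions of \<open>U\<close> in a list of generators.\<close>
lemma vector_space_rank:
  assumes "field K" "right_module K V" "finite B" "B \<subseteq> carrier V"
  shows "\<exists>\<phi> :: 'v set \<Rightarrow> nat. \<forall>U U'. submodule U K V \<and> submodule U' K V \<and> U \<subset> U'
    \<and> U' \<subseteq> generated K V B \<longrightarrow> \<phi> U < \<phi> U'"
  using assms(3,4)
proof (induction B)
  case empty
  interpret V: right_module K V by fact
  have "generated K V {} \<subseteq> {\<zero>\<^bsub>V\<^esub>}"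
    by (rule generated_least) (auto simp: V.submodule_iff V.smult_zero)
  then have "\<not> (submodule U K V \<and> submodule U' K V \<and> U \<subset> U' \<and> U' \<subseteq> generated K V {})" for U U'
    by (auto simp: V.submodule_iff)
  then show ?case by blast
next
  case (insert b B)
  interpret V: right_module K V by fact
  interpret K: field K by fact
  let ?W = "generated K V B"
  have b: "b \<in> carrier V" and B: "B \<subseteq> carrier V" using insert.prems by auto
  have W: "submodule ?W K V" by (rule V.generated_submodule[OF B])
  note WD = W[unfolded V.submodule_iff]
  obtain \<phi> :: "'v set \<Rightarrow> nat" where IH: "\<forall>U U'. submodule U K V \<and> submodule U' K V \<and> U \<subset> U'
      \<and> U' \<subseteq> ?W \<longrightarrow> \<phi> U < \<phi> U'"
    using insert.IH[OF B] by (rule exE)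
  have \<phi>: "\<phi> U < \<phi> U'" if "submodule U K V" "submodule U' K V" "U \<subset> U'" "U' \<subseteq> ?W" for U U'
    using IH that by simp
  \<comment> \<open>Modulo \<open>?W\<close> at most the line spanned by \<open>b\<close> remains,
    so beyond the part inside \<open>?W\<close> a subspace gains at most one pivot.\<close>
  let ?\<psi> = "\<lambda>U. \<phi> (U \<inter> ?W) + (if U \<subseteq> ?W then 0 else 1)"
  have "?\<psi> U < ?\<psi> U'" if U: "submodule U K V" "submodule U' K V" "U \<subset> U'" "U' \<subseteq> generated K V (insert b B)" for U U'
  proof (cases "U \<inter> ?W = U' \<inter> ?W")
    case False
    then have "\<phi> (U \<inter> ?W) < \<phi> (U' \<inter> ?W)" using U by (intro \<phi> V.submodule_Int W) auto
    then show ?thesis using U(3) by auto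
  next
    case True
    obtain x where x: "x \<in> U'" "x \<notin> U" using U(3) by blast
    have "x \<notin> ?W" using x True by auto
    \<comment> \<open>If \<open>U\<close> also left \<open>?W\<close>, a multiple of
      \<open>u\<close> could be subtracted from \<open>x\<close> to cancel \<open>b\<close>. The
      difference lies in \<open>U'\<close> and \<open>?W\<close>, hence in \<open>U\<close>, which
      forces \<open>x\<close> into \<open>U\<close>.\<close>
    have "U \<subseteq> ?W"
    proof (rule ccontr)
      assume "\<not> U \<subseteq> ?W"
      then obtain u where u: "u \<in> U" "u \<notin> ?W" by blast
      obtain w k where w: "w \<in> ?W" "k \<in> carrier K" "u = w \<oplus>\<^bsub>V\<^esub> k \<odot>\<^bsub>V\<^esub> b"
        using V.generated_insert[OF b B, of u] u U by blast
      obtain w' k' where w': "w' \<in> ?W" "k' \<in> carrier K" "x = w' \<oplus>\<^bsub>V\<^esub> k' \<odot>\<^bsub>V\<^esub> b"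
        using V.generated_insert[OF b B, of x] x U by blast
      have c: "w \<in> carrier V" "w' \<in> carrier V" "u \<in> carrier V" "x \<in> carrier V"
        using w w' WD u x U unfolding V.submodule_iff by auto
      have "k \<noteq> \<zero>\<^bsub>K\<^esub>" using w u c b by (auto simp: V.zero_smult)
      then have k: "k \<in> Units K" using w(2) K.field_Units by auto
      \<comment> \<open>The coefficient \<open>k\<close> of \<open>b\<close> in \<open>u\<close> is
        nonzero since \<open>u\<close> is outside \<open>?W\<close>, hence invertible in the field;
        scaling \<open>u\<close> by \<open>a\<close> turns it into the coefficient \<open>k'\<close>
        of \<open>b\<close> in \<open>x\<close>.\<close>
      define a where "a = inv\<^bsub>K\<^esub> k \<otimes>\<^bsub>K\<^esub> k'"
      have a: "a \<in> carrier K" using k w' by (simp add: a_def)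
      have "k \<otimes>\<^bsub>K\<^esub> a = k'"
        using k w' w by (simp add: a_def V.R.m_assoc[symmetric])
      then have "a \<odot>\<^bsub>V\<^esub> u = a \<odot>\<^bsub>V\<^esub> w \<oplus>\<^bsub>V\<^esub> k' \<odot>\<^bsub>V\<^esub> b"
        using w a c b by (simp add: V.smult_r_distr V.smult_closed V.smult_assoc[symmetric])
      then have "x \<ominus>\<^bsub>V\<^esub> a \<odot>\<^bsub>V\<^esub> u = w' \<ominus>\<^bsub>V\<^esub> a \<odot>\<^bsub>V\<^esub> w"
        using w' a c b V.M.a_lcomm[of "k' \<odot>\<^bsub>V\<^esub> b" "\<ominus>\<^bsub>V\<^esub> (a \<odot>\<^bsub>V\<^esub> w)" "\<ominus>\<^bsub>V\<^esub> (k' \<odot>\<^bsub>V\<^esub> b)"]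
        by (simp add: V.M.minus_eq V.M.minus_add V.M.a_assoc V.smult_closed V.M.r_neg)
      moreover have "w' \<ominus>\<^bsub>V\<^esub> a \<odot>\<^bsub>V\<^esub> w \<in> ?W"
        using w w' a WD by (intro V.submodule_minus[OF W]) auto
      moreover have aU: "a \<odot>\<^bsub>V\<^esub> u \<in> U" using a u U unfolding V.submodule_iff by auto
      then have "x \<ominus>\<^bsub>V\<^esub> a \<odot>\<^bsub>V\<^esub> u \<in> U'" using x U by (intro V.submodule_minus[OF U(2)]) auto
      ultimately have "x \<ominus>\<^bsub>V\<^esub> a \<odot>\<^bsub>V\<^esub> u \<in> U" using True by auto
      then have "(x \<ominus>\<^bsub>V\<^esub> a \<odot>\<^bsub>V\<^esub> u) \<oplus>\<^bsub>V\<^esub> a \<odot>\<^bsub>V\<^esub> u \<in> U"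
        using aU U(1) unfolding V.submodule_iff by blast
      then show False using x V.minus_add_cancel[of x "a \<odot>\<^bsub>V\<^esub> u"] c a by (simp add: V.smult_closed)
    qed
    then show ?thesis using True \<open>x \<notin> ?W\<close> x(1) by auto
  qed
  then show ?case by (intro exI[of _ ?\<psi>]) blast
qed

section \<open>Submodule rank over a finite-dimensional algebra\<close>

definition restrict_scalars :: "('k, 'a) module \<Rightarrow> ('a, 'm) module \<Rightarrow> ('k, 'm) module" where
  "restrict_scalars A M = \<lparr>carrier = carrier M, monoid.mult = undefined, monoid.one = undefined,
     ring.zero = \<zero>\<^bsub>M\<^esub>, ring.add = ring.add M,
     module.smult = (\<lambda>k x. (k \<odot>\<^bsub>A\<^esub> \<one>\<^bsub>A\<^esub>) \<odot>\<^bsub>M\<^esub> x)\<rparr>"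

lemma restrict_scalars_simps [simp]:
  "carrier (restrict_scalars A M) = carrier M" "\<zero>\<^bsub>restrict_scalars A M\<^esub> = \<zero>\<^bsub>M\<^esub>"
  "x \<oplus>\<^bsub>restrict_scalars A M\<^esub> y = x \<oplus>\<^bsub>M\<^esub> y"
  "k \<odot>\<^bsub>restrict_scalars A M\<^esub> x = (k \<odot>\<^bsub>A\<^esub> \<one>\<^bsub>A\<^esub>) \<odot>\<^bsub>M\<^esub> x"
  by (simp_all add: restrict_scalars_def)

context fd_algebra
begin

text \<open>Commutativity of \<open>K\<close> allows its left action on \<open>A\<close> to be read
  as a right action, so the results on right modules apply to vector spaces.\<close>

lemma right_module_K: "right_module K A"
proof (rule right_moduleI)
  show "ring K" ..
  fix x assume "x \<in> carrier A"
  then show "\<exists>y\<in>carrier A. y \<oplus>\<^bsub>A\<^esub> x = \<zero>\<^bsub>A\<^esub>" using M.l_neg by blast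
qed (auto simp: M.a_assoc smult_l_distr smult_r_distr smult_assoc1[symmetric] m_comm intro: M.a_comm)

lemma right_module_restrict_scalars:
  assumes "right_module A M"
  shows "right_module K (restrict_scalars A M)"
proof -
  interpret M: right_module A M by fact
  have 1: "k \<odot>\<^bsub>A\<^esub> \<one>\<^bsub>A\<^esub> \<in> carrier A" if "k \<in> carrier K" for k
    using that by (simp add: smult_closed)
  have mult: "(k \<otimes>\<^bsub>K\<^esub> l) \<odot>\<^bsub>A\<^esub> \<one>\<^bsub>A\<^esub> = (k \<odot>\<^bsub>A\<^esub> \<one>\<^bsub>A\<^esub>) \<otimes>\<^bsub>A\<^esub> (l \<odot>\<^bsub>A\<^esub> \<one>\<^bsub>A\<^esub>)" if "k \<in> carrier K" "l \<in> carrier K" for k l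
    using that by (simp add: smult_mult_left smult_closed smult_assoc1)
  show ?thesis
  proof (rule right_moduleI)
    show "ring K" ..
    fix x assume "x \<in> carrier (restrict_scalars A M)"
    then show "\<exists>y\<in>carrier (restrict_scalars A M). y \<oplus>\<^bsub>restrict_scalars A M\<^esub> x = \<zero>\<^bsub>restrict_scalars A M\<^esub>"
      using M.M.l_neg by auto
  qed (auto simp: M.M.a_assoc M.smult_closed 1 M.smult_l_distr[symmetric] M.smult_r_distr M.smult_assoc[symmetric]
      M.smult_one smult_l_distr mult intro: M.M.a_comm)
qed

lemma submodule_restrict_scalars:
  assumes "right_module A M" "submodule U A M"
  shows "submodule U K (restrict_scalars A M)"
  using assms(2)
  unfolding right_module.submodule_iff[OF assms(1)]
    right_module.submodule_iff[OF right_module_restrict_scalars[OF assms(1)]]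
  by (auto simp: smult_closed)

lemma restrict_scalars_generated:
  assumes "M \<in> fgmod A"
  shows "\<exists>B. finite B \<and> B \<subseteq> carrier M \<and> generated K (restrict_scalars A M) B = carrier M"
proof -
  interpret M: right_module A M using assms by (rule fgmod_right_module)
  interpret MK: right_module K "restrict_scalars A M"
    by (rule right_module_restrict_scalars[OF M.right_module_axioms])
  interpret AK: right_module K A by (rule right_module_K)
  obtain B where B: "finite B" "B \<subseteq> carrier M"
    "\<And>U. submodule U A M \<Longrightarrow> B \<subseteq> U \<Longrightarrow> U = carrier M"
    using assms M.finitely_generated_iff by (auto simp: fgmod_def)
  obtain D where D: "finite D" "D \<subseteq> carrier A"
    "\<And>U. submodule U K A \<Longrightarrow> D \<subseteq> U \<Longrightarrow> U = carrier A"
    using finite_dim AK.finitely_generated_iff by auto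
  \<comment> \<open>The products of generators of \<open>M\<close> over \<open>A\<close> with
    generators of \<open>A\<close> over \<open>K\<close> will span \<open>M\<close> over
    \<open>K\<close>.\<close>
  define E where "E = (\<lambda>(d, b). d \<odot>\<^bsub>M\<^esub> b) ` (D \<times> B)"
  have E: "finite E" "E \<subseteq> carrier M" using B(1,2) D(1,2) by (auto simp: E_def intro!: M.smult_closed)
  define W where "W = generated K (restrict_scalars A M) E"
  have W: "submodule W K (restrict_scalars A M)"
    unfolding W_def by (rule MK.generated_submodule) (simp add: E)
  note WD = W[unfolded MK.submodule_iff, simplified]
  have "a \<odot>\<^bsub>M\<^esub> b \<in> W" if b: "b \<in> B" and a: "a \<in> carrier A" for a b
  proof -
    have bM: "b \<in> carrier M" using b B(2) by auto
    \<comment> \<open>For fixed \<open>b\<close> the orbit map is \<open>K\<close>-linear, so the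
      scalars sending \<open>b\<close> into \<open>W\<close> form a subspace; it contains
      \<open>D\<close> and is therefore all of \<open>A\<close>.\<close>
    have "(\<lambda>a. a \<odot>\<^bsub>M\<^esub> b) \<in> rmod_hom K A (restrict_scalars A M)"
    proof (rule rmod_homI)
      fix k a assume ka: "k \<in> carrier K" "a \<in> carrier A"
      have "a \<otimes>\<^bsub>A\<^esub> (k \<odot>\<^bsub>A\<^esub> \<one>\<^bsub>A\<^esub>) = k \<odot>\<^bsub>A\<^esub> a" using ka by (simp add: smult_mult_right)
      then show "(k \<odot>\<^bsub>A\<^esub> a) \<odot>\<^bsub>M\<^esub> b = k \<odot>\<^bsub>restrict_scalars A M\<^esub> (a \<odot>\<^bsub>M\<^esub> b)"
        using ka bM M.smult_assoc[of a "k \<odot>\<^bsub>A\<^esub> \<one>\<^bsub>A\<^esub>" b] by (simp add: smult_closed)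
    qed (simp_all add: M.smult_closed M.smult_l_distr bM)
    then have "submodule {a \<in> carrier A. a \<odot>\<^bsub>M\<^esub> b \<in> W} K A"
      by (rule vimage_submodule[OF right_module_K MK.right_module_axioms _ W])
    moreover have "D \<subseteq> {a \<in> carrier A. a \<odot>\<^bsub>M\<^esub> b \<in> W}"
      using D(2) b generated_superset[of E K "restrict_scalars A M"] by (auto simp: W_def E_def)
    ultimately have "{a \<in> carrier A. a \<odot>\<^bsub>M\<^esub> b \<in> W} = carrier A" by (rule D(3))
    then show ?thesis using a by auto
  qed
  then have "B \<subseteq> {x \<in> carrier M. \<forall>a\<in>carrier A. a \<odot>\<^bsub>M\<^esub> x \<in> W}" using B(2) by auto
  \<comment> \<open>\<open>W\<close> is only known to be a \<open>K\<close>-subspace. The elements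
    whose whole orbit stays in \<open>W\<close> do form an \<open>A\<close>-submodule, and it
    contains the generators \<open>B\<close>.\<close>
  moreover have "submodule {x \<in> carrier M. \<forall>a\<in>carrier A. a \<odot>\<^bsub>M\<^esub> x \<in> W} A M"
    unfolding M.submodule_iff using WD
    by (auto simp: M.smult_zero M.smult_r_distr M.smult_closed M.smult_assoc[symmetric])
  ultimately have "{x \<in> carrier M. \<forall>a\<in>carrier A. a \<odot>\<^bsub>M\<^esub> x \<in> W} = carrier M" by (intro B(3))
  then have "\<one>\<^bsub>A\<^esub> \<odot>\<^bsub>M\<^esub> x \<in> W" if "x \<in> carrier M" for x using that by auto
  then have "W = carrier M" using WD by (auto simp: M.smult_one)
  then show ?thesis using E unfolding W_def by blast
qed

text \<open>Submodules over \<open>A\<close> are subspaces over \<open>K\<close>, so the pivot count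
  restricts to them. Its strict monotonicity stands in for both chain conditions.\<close>

lemma submodule_rank:
  fixes M :: "('a, 'm) module"
  assumes "M \<in> fgmod A"
  obtains \<phi> :: "'m set \<Rightarrow> nat"
  where "\<And>U U'. \<lbrakk>submodule U A M; submodule U' A M; U \<subset> U'\<rbrakk> \<Longrightarrow> \<phi> U < \<phi> U'"
proof -
  note M = fgmod_right_module[OF assms]
  obtain B where B: "finite B" "B \<subseteq> carrier M" "generated K (restrict_scalars A M) B = carrier M"
    using restrict_scalars_generated[OF assms] by blast
  obtain \<phi> :: "'m set \<Rightarrow> nat" where \<phi>: "\<forall>U U'. submodule U K (restrict_scalars A M) \<and>
      submodule U' K (restrict_scalars A M) \<and> U \<subset> U' \<and> U' \<subseteq> carrier M \<longrightarrow> \<phi> U < \<phi> U'"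
    using vector_space_rank[OF field_axioms right_module_restrict_scalars[OF M] B(1)] B(2,3) by auto
  have "\<phi> U < \<phi> U'" if U: "submodule U A M" "submodule U' A M" "U \<subset> U'" for U U'
  proof -
    have "U' \<subseteq> carrier M" using U(2) right_module.submodule_iff[OF M, of U'] by simp
    then show ?thesis
      using \<phi> U(3) submodule_restrict_scalars[OF M U(1)] submodule_restrict_scalars[OF M U(2)] by simp
  qed
  then show ?thesis by (rule that)
qed

text \<open>Among finite subsets of \<open>U\<close>, take one generating a submodule of maximal
  rank. An element of \<open>U\<close> outside that submodule could be added to raise the rank, so
  the subset generates \<open>U\<close>.\<close>

lemma fgmod_submodule:
  assumes "M \<in> fgmod A" "submodule U A M"
  shows "M\<lparr>carrier := U\<rparr> \<in> fgmod A"
proof -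
  interpret M: right_module A M using assms(1) by (rule fgmod_right_module)
  note UD = assms(2)[unfolded M.submodule_iff]
  obtain \<phi> :: "'b set \<Rightarrow> nat" where \<phi>: "\<And>U U'. \<lbrakk>submodule U A M; submodule U' A M; U \<subset> U'\<rbrakk> \<Longrightarrow> \<phi> U < \<phi> U'"
    using submodule_rank[OF assms(1)] by blast
  have gU: "submodule (generated A M B) A M \<and> generated A M B \<subseteq> U" if "B \<subseteq> U" for B
    using that UD by (intro conjI M.generated_submodule generated_least[OF assms(2) that]) auto
  have "\<phi> (generated A M B) \<le> \<phi> U" if "B \<subseteq> U" for B
    using \<phi>[of "generated A M B" U] gU[OF that] assms(2) by (cases "generated A M B = U") (auto simp: psubset_eq)
  then have bound: "\<forall>B. finite B \<and> B \<subseteq> U \<longrightarrow> \<phi> (generated A M B) < Suc (\<phi> U)"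
    by (auto simp: le_imp_less_Suc)
  obtain B where B: "finite B" "B \<subseteq> U"
    "\<And>C. \<lbrakk>finite C; C \<subseteq> U\<rbrakk> \<Longrightarrow> \<phi> (generated A M C) \<le> \<phi> (generated A M B)"
    using ex_has_greatest_nat[of "\<lambda>B. finite B \<and> B \<subseteq> U" "{}" "\<lambda>B. \<phi> (generated A M B)" "Suc (\<phi> U)"] bound by auto
  have "x \<in> generated A M B" if x: "x \<in> U" for x
  proof (rule ccontr)
    assume "x \<notin> generated A M B"
    moreover have "x \<in> generated A M (insert x B)" "B \<subseteq> generated A M (insert x B)"
      using generated_superset[of "insert x B" A M] by auto
    moreover have "generated A M B \<subseteq> generated A M (insert x B)"
      using gU[of "insert x B"] x B(2) \<open>B \<subseteq> generated A M (insert x B)\<close> by (intro generated_least) auto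
    ultimately have "\<phi> (generated A M B) < \<phi> (generated A M (insert x B))"
      using gU[of B] gU[of "insert x B"] x B(2) by (intro \<phi>) auto
    then show False using B(3)[of "insert x B"] B(1,2) x by simp
  qed
  then have UB: "generated A M B = U" using gU[OF B(2)] by auto
  interpret U: right_module A "M\<lparr>carrier := U\<rparr>" by (rule M.submodule_module[OF assms(2)])
  have "W = U" if W: "submodule W A (M\<lparr>carrier := U\<rparr>)" "B \<subseteq> W" for W
  proof -
    have "submodule W A M" using W(1) UD unfolding U.submodule_iff M.submodule_iff by auto
    then show ?thesis using generated_least[OF _ W(2), of A M] UB W(1) by (auto simp: U.submodule_iff)
  qed
  then have "finitely_generated A (M\<lparr>carrier := U\<rparr>)"
    unfolding U.finitely_generated_iff using B(1,2) by (intro exI[of _ B]) simp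
  then show ?thesis using U.right_module_axioms by (simp add: fgmod_def)
qed

end

section \<open>Projective covers and syzygies\<close>

context fd_algebra
begin

text \<open>
  Among the endomorphisms \<open>h\<close> over \<open>M\<close> of a projective \<open>F\<close> mapping onto \<open>M\<close>, take one with small
  image and large kernel. Composing it with itself changes neither, so its image is a direct summand
  of \<open>F\<close>; and any submodule still mapping onto \<open>M\<close> would give a smaller \<open>h\<close>.
\<close>
lemma projective_cover_exists:
  assumes "M \<in> fgmod A"
  shows "\<exists>P p. projective_cover A P p M"
proof -
  note M = fgmod_right_module[OF assms]
  obtain F :: "'a lmod" and p where F: "projective A F" "p \<in> rmod_hom A F M" "p ` carrier F = carrier M"
    using enough_projectives[OF assms] by (auto simp: fgproj_iff)
  note FF = projective_fgmod[OF F(1)] and FM = projective_module[OF F(1)]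
  interpret F: right_module A F by (rule FM)
  obtain \<phi> :: "'a list set \<Rightarrow> nat" where
    \<phi>: "\<And>U U'. \<lbrakk>submodule U A F; submodule U' A F; U \<subset> U'\<rbrakk> \<Longrightarrow> \<phi> U < \<phi> U'"
    using submodule_rank[OF FF] by blast
  have mono: "\<phi> U \<le> \<phi> U'" if "submodule U A F" "submodule U' A F" "U \<subseteq> U'" for U U'
    using \<phi>[OF that(1,2)] that(3) by (cases "U = U'") (auto simp: psubset_eq intro: less_imp_le)
  define over where "over h \<longleftrightarrow> h \<in> rmod_hom A F F \<and> (\<forall>x\<in>carrier F. p (h x) = p x)" for h
  \<comment> \<open>Small image and large kernel become a single number to minimise. Truncated
    subtraction loses nothing, as the rank of a kernel is at most that of the carrier.\<close>
  define m where "m h = \<phi> (h ` carrier F) + (\<phi> (carrier F) - \<phi> (a_kernel F F h))" for h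
  have "over (\<lambda>x. x)" by (simp add: over_def hom_id)
  then obtain h where h: "over h" "\<And>k. over k \<Longrightarrow> m h \<le> m k"
    using ex_has_least_nat[of over "\<lambda>x. x" m] by auto
  have hF: "h \<in> rmod_hom A F F" and ph: "\<And>x. x \<in> carrier F \<Longrightarrow> p (h x) = p x"
    using h(1) by (auto simp: over_def)
  \<comment> \<open>Under these inclusions neither summand of \<open>m\<close> can increase, so
    minimality of \<open>m h\<close> fixes both ranks, and strict monotonicity turns equal ranks
    into equal submodules.\<close>
  have extremal: "k ` carrier F = h ` carrier F \<and> a_kernel F F k = a_kernel F F h"
    if k: "over k" "k ` carrier F \<subseteq> h ` carrier F" "a_kernel F F h \<subseteq> a_kernel F F k" for k
  proof -
    have kF: "k \<in> rmod_hom A F F" using k(1) by (simp add: over_def)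
    note sub = image_submodule[OF FM FM kF] image_submodule[OF FM FM hF]
      kernel_submodule[OF FM FM kF] kernel_submodule[OF FM FM hF]
    have "a_kernel F F k \<subseteq> carrier F" by (auto simp: a_kernel_def')
    then have "\<phi> (k ` carrier F) \<le> \<phi> (h ` carrier F)" "\<phi> (a_kernel F F h) \<le> \<phi> (a_kernel F F k)"
      "\<phi> (a_kernel F F k) \<le> \<phi> (carrier F)"
      using sub k F.submodule_carrier by (auto intro!: mono)
    then have eq: "\<phi> (k ` carrier F) = \<phi> (h ` carrier F)" "\<phi> (a_kernel F F h) = \<phi> (a_kernel F F k)"
      using h(2)[OF k(1)] by (auto simp: m_def)
    have "\<not> k ` carrier F \<subset> h ` carrier F" "\<not> a_kernel F F h \<subset> a_kernel F F k"
      using \<phi>[OF sub(1,2)] \<phi>[OF sub(4,3)] eq by auto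
    then show ?thesis using k(2,3) by blast
  qed
  have hc: "h x \<in> carrier F" if "x \<in> carrier F" for x using that by (rule hom_closed[OF hF])
  define N where "N = h ` carrier F"
  have N: "submodule N A F" unfolding N_def by (rule image_submodule[OF FM FM hF])
  have NF: "N \<subseteq> carrier F" using N by (simp add: F.submodule_iff)
  define P where "P = F\<lparr>carrier := N\<rparr>"
  have carP: "carrier P = N" by (simp add: P_def)
  have PM: "right_module A P" unfolding P_def by (rule F.submodule_module[OF N])
  have Pfg: "P \<in> fgmod A" unfolding P_def by (rule fgmod_submodule[OF FF N])
  have incl: "(\<lambda>x. x) \<in> rmod_hom A P F" unfolding P_def by (rule hom_inclusion[OF NF])
  have hP: "h \<in> rmod_hom A F P"
    unfolding P_def by (rule hom_codomain_submodule[OF hF]) (simp add: N_def)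
  have "over (\<lambda>x. h (h x))" unfolding over_def using hom_comp[OF hF hF] ph hc by simp
  moreover have "(\<lambda>x. h (h x)) ` carrier F \<subseteq> h ` carrier F" using hc by auto
  moreover have "a_kernel F F h \<subseteq> a_kernel F F (\<lambda>x. h (h x))"
    by (auto simp: a_kernel_def' hom_zero[OF FM FM hF])
  ultimately have hh: "(\<lambda>x. h (h x)) ` carrier F = N" "a_kernel F F (\<lambda>x. h (h x)) = a_kernel F F h"
    using extremal[of "\<lambda>x. h (h x)"] by (auto simp: N_def)
  have "(\<lambda>x. h (h x)) \<in> rmod_hom A F P" by (rule hom_comp[OF hF hP])
  moreover have "a_kernel F P (\<lambda>x. h (h x)) \<subseteq> a_kernel F P h"
    using hh(2) by (auto simp: a_kernel_def' P_def)
  \<comment> \<open>Equal kernels let \<open>h\<close> factor through h h, whose image is all of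
    \<open>N\<close>. The factor \<open>k\<close> inverts \<open>h\<close> on \<open>N\<close>, so k
    h is a retraction of \<open>F\<close> onto \<open>P\<close>.\<close>
  ultimately obtain k where k: "k \<in> rmod_hom A P P" "\<forall>x\<in>carrier F. k (h (h x)) = h x"
    using hom_factor[OF FM PM PM _ _ hP, of "\<lambda>x. h (h x)"] hh(1) carP by auto
  have "k (h x) = x" if "x \<in> carrier P" for x using that k(2) by (auto simp: carP N_def)
  then have "projective A P"
    by (rule projective_retract[OF F(1) Pfg incl hom_comp[OF hP k(1)]])
  moreover have pP: "p \<in> rmod_hom A P M" by (rule hom_comp[OF incl F(2)])
  moreover have "p ` carrier P = carrier M"
    using F(3) ph by (auto simp: carP N_def image_image)
  moreover have "N' = carrier P" if N': "submodule N' A P" "N' <+>\<^bsub>P\<^esub> a_kernel P M p = carrier P" for N'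
  proof -
    note N'P = N'(1)[unfolded right_module.submodule_iff[OF PM]]
    have N'F: "submodule N' A F" using N'P NF unfolding F.submodule_iff by (auto simp: P_def)
    define P' where "P' = F\<lparr>carrier := N'\<rparr>"
    have carP': "carrier P' = N'" by (simp add: P'_def)
    have P'fg: "P' \<in> fgmod A" unfolding P'_def by (rule fgmod_submodule[OF FF N'F])
    have N'c: "N' \<subseteq> carrier F" "N' \<subseteq> carrier P" using N'P N'F by (auto simp: F.submodule_iff)
    have incl': "(\<lambda>x. x) \<in> rmod_hom A P' F" unfolding P'_def by (rule hom_inclusion[OF N'c(1)])
    have pP': "p \<in> rmod_hom A P' M" by (rule hom_comp[OF incl' F(2)])
    have "p ` N' = carrier M"
    proof
      show "p ` N' \<subseteq> carrier M" using hom_closed[OF F(2)] N'c by auto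
      show "carrier M \<subseteq> p ` N'"
      proof
        fix y assume "y \<in> carrier M"
        then obtain x where x: "x \<in> carrier P" "p x = y"
          using \<open>p ` carrier P = carrier M\<close> by (metis imageE)
        obtain n z where nz: "n \<in> N'" "z \<in> a_kernel P M p" "x = n \<oplus>\<^bsub>P\<^esub> z"
          using x(1) unfolding N'(2)[symmetric] by (auto simp: set_add_def')
        have "p x = p n \<oplus>\<^bsub>M\<^esub> p z" unfolding nz(3)
          using nz N'c by (intro hom_add[OF pP]) (auto simp: a_kernel_def')
        also have "\<dots> = p n \<oplus>\<^bsub>M\<^esub> \<zero>\<^bsub>M\<^esub>" using nz(2) by (simp add: a_kernel_def')
        also have "\<dots> = p n"
        proof -
          interpret M: right_module A M by (rule M)
          show ?thesis using hom_closed[OF F(2)] nz(1) N'c by auto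
        qed
        finally show "y \<in> p ` N'" using x(2) nz(1) by blast
      qed
    qed
    \<comment> \<open>\<open>N'\<close> still maps onto \<open>M\<close>, so \<open>p\<close> lifts
      to a map \<open>l\<close> into \<open>N'\<close>. The composite l h is again over
      \<open>M\<close>, has image inside \<open>N'\<close> and kernel at least that of
      \<open>h\<close>; extremality makes its image \<open>N\<close>, whence \<open>N'\<close> is
      everything.\<close>
    then obtain l where l: "l \<in> rmod_hom A F P'" "\<forall>x\<in>carrier F. p (l x) = p x"
      using projective_lift[OF F(1) P'fg assms pP' _ F(2)] by (auto simp: carP')
    have lN': "l x \<in> N'" if "x \<in> carrier F" for x using hom_closed[OF l(1) that] by (simp add: carP')
    have lF: "l \<in> rmod_hom A F F" by (rule hom_comp[OF l(1) incl'])
    have lz: "l \<zero>\<^bsub>F\<^esub> = \<zero>\<^bsub>F\<^esub>" by (rule hom_zero[OF FM FM lF])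
    have "over (\<lambda>x. l (h x))" unfolding over_def using hom_comp[OF hF lF] l(2) hc ph by simp
    moreover have "(\<lambda>x. l (h x)) ` carrier F \<subseteq> N'" using lN' hc by auto
    moreover have "a_kernel F F h \<subseteq> a_kernel F F (\<lambda>x. l (h x))" by (auto simp: a_kernel_def' lz)
    ultimately have "(\<lambda>x. l (h x)) ` carrier F = N"
      using extremal[of "\<lambda>x. l (h x)"] N'c by (auto simp: N_def carP)
    then have "N \<subseteq> N'" using \<open>(\<lambda>x. l (h x)) ` carrier F \<subseteq> N'\<close> by simp
    then show ?thesis using N'c by (auto simp: carP)
  qed
  ultimately have "projective_cover A P p M" unfolding projective_cover_def fgproj_iff by blast
  then show ?thesis by blast
qed

text \<open>The choice inside \<open>Omega\<close> carries information only because some projective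
  cover exists.\<close>

lemma Omega_cover:
  assumes "M \<in> fgmod A"
  obtains P :: "'a lmod" and p where "projective A P" "p \<in> rmod_hom A P M" "p ` carrier P = carrier M"
    "Omega A M = P\<lparr>carrier := a_kernel P M p\<rparr>"
proof -
  have "\<exists>z. case z of (P, p) \<Rightarrow> projective_cover A P p M"
    using projective_cover_exists[OF assms] by auto
  then have "case SOME (P, p). projective_cover A P p M of (P, p) \<Rightarrow> projective_cover A P p M"
    by (rule someI_ex)
  then show ?thesis
    using that unfolding Omega_def Let_def projective_cover_def fgproj_iff
    by (auto split: prod.splits)
qed

text \<open>A syzygy is a submodule of a finitely generated module; finite dimension of the algebra
  keeps it finitely generated, so that \<open>Omega\<close> can be iterated.\<close>

lemma Omega_fgmod:
  assumes "M \<in> fgmod A"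
  shows "Omega A M \<in> fgmod A"
proof (rule Omega_cover[OF assms])
  fix P :: "'a lmod" and p
  assume P: "projective A P" "p \<in> rmod_hom A P M" "Omega A M = P\<lparr>carrier := a_kernel P M p\<rparr>"
  show ?thesis
    unfolding P(3) by (intro fgmod_submodule kernel_submodule P projective_fgmod[OF P(1)]
        projective_module[OF P(1)] fgmod_right_module[OF assms])
qed

lemma Omega_module: "M \<in> fgmod A \<Longrightarrow> right_module A (Omega A M)"
  by (intro fgmod_right_module Omega_fgmod)

lemma Omega_short_exact:
  assumes "M \<in> fgmod A"
  obtains P :: "'a lmod" and p where "projective A P" "short_exact A (Omega A M) (\<lambda>x. x) P p M"
proof (rule Omega_cover[OF assms])
  fix P :: "'a lmod" and p
  assume P: "projective A P" "p \<in> rmod_hom A P M" "p ` carrier P = carrier M"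
    "Omega A M = P\<lparr>carrier := a_kernel P M p\<rparr>"
  have "(\<lambda>x. x) \<in> rmod_hom A (Omega A M) P"
    unfolding P(4) by (rule hom_inclusion) (auto simp: a_kernel_def')
  then have "short_exact A (Omega A M) (\<lambda>x. x) P p M"
    using P by (simp add: short_exact_def)
  then show ?thesis using that P(1) by blast
qed

lemma Omega_stable_retract:
  assumes "X \<in> fgmod A" "Y \<in> fgmod A" "stable_retract A X Y"
  shows "stable_retract A (Omega A X) (Omega A Y)"
proof -
  obtain P :: "'a lmod" and p where P: "projective A P" "short_exact A (Omega A X) (\<lambda>x. x) P p X"
    by (rule Omega_short_exact[OF assms(1)])
  obtain Q :: "'a lmod" and q where Q: "projective A Q" "short_exact A (Omega A Y) (\<lambda>x. x) Q q Y"
    by (rule Omega_short_exact[OF assms(2)])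
  show ?thesis
    by (rule syzygy_stable_retract[OF P(1) Q(1) P(2) Q(2) assms(1,2) Omega_module Omega_module assms(3)])
      (fact assms)+
qed

end

section \<open>Direct sums and the stable category\<close>

lemma stable_retract_direct_sum:
  fixes R :: "('a, 'r) ring_scheme"
  assumes M: "right_module R M" "right_module R M'"
    and sr: "stable_retract R M N" "stable_retract R M' N'"
  shows "stable_retract R (M \<oplus>\<^sub>m M') (N \<oplus>\<^sub>m N')"
proof -
  obtain P :: "'a lmod" and s t u v where 1: "projective R P" "s \<in> rmod_hom R M N" "t \<in> rmod_hom R N M"
    "u \<in> rmod_hom R M P" "v \<in> rmod_hom R P M"
    "\<forall>x\<in>carrier M. t (s x) = x \<oplus>\<^bsub>M\<^esub> v (u x)"
    by (rule stable_retractE[OF sr(1) M(1)], rule that)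
  obtain P' :: "'a lmod" and s' t' u' v' where 2: "projective R P'" "s' \<in> rmod_hom R M' N'" "t' \<in> rmod_hom R N' M'"
    "u' \<in> rmod_hom R M' P'" "v' \<in> rmod_hom R P' M'"
    "\<forall>x\<in>carrier M'. t' (s' x) = x \<oplus>\<^bsub>M'\<^esub> v' (u' x)"
    by (rule stable_retractE[OF sr(2) M(2)], rule that)
  show ?thesis
  proof (rule stable_retractI[OF right_module_direct_sum[OF M] projective_direct_sum[OF 1(1) 2(1)]])
    show "(\<lambda>z. (s (fst z), s' (snd z))) \<in> rmod_hom R (M \<oplus>\<^sub>m M') (N \<oplus>\<^sub>m N')"
      by (intro hom_pair hom_fst_comp hom_snd_comp 1 2)
    show "(\<lambda>z. (t (fst z), t' (snd z))) \<in> rmod_hom R (N \<oplus>\<^sub>m N') (M \<oplus>\<^sub>m M')"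
      by (intro hom_pair hom_fst_comp hom_snd_comp 1 2)
    show "(\<lambda>z. (u (fst z), u' (snd z))) \<in> rmod_hom R (M \<oplus>\<^sub>m M') (P \<oplus>\<^sub>m P')"
      by (intro hom_pair hom_fst_comp hom_snd_comp 1 2)
    show "(\<lambda>z. (v (fst z), v' (snd z))) \<in> rmod_hom R (P \<oplus>\<^sub>m P') (M \<oplus>\<^sub>m M')"
      by (intro hom_pair hom_fst_comp hom_snd_comp 1 2)
  qed (use 1(6) 2(6) in auto)
qed

lemma short_exact_direct_sum:
  assumes "short_exact R U i P p X" "short_exact R V j Q q Y"
  shows "short_exact R (U \<oplus>\<^sub>m V) (\<lambda>z. (i (fst z), j (snd z))) (P \<oplus>\<^sub>m Q) (\<lambda>z. (p (fst z), q (snd z))) (X \<oplus>\<^sub>m Y)"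
proof -
  have 1: "i \<in> rmod_hom R U P" "inj_on i (carrier U)" "i ` carrier U = a_kernel P X p"
     "p \<in> rmod_hom R P X" "p ` carrier P = carrier X"
    using assms(1) by (auto simp: short_exact_def)
  have 2: "j \<in> rmod_hom R V Q" "inj_on j (carrier V)" "j ` carrier V = a_kernel Q Y q"
     "q \<in> rmod_hom R Q Y" "q ` carrier Q = carrier Y"
    using assms(2) by (auto simp: short_exact_def)
  have "(\<lambda>z. (i (fst z), j (snd z))) ` (carrier U \<times> carrier V) = i ` carrier U \<times> j ` carrier V"
    by force
  moreover have "(\<lambda>z. (p (fst z), q (snd z))) ` (carrier P \<times> carrier Q) = p ` carrier P \<times> q ` carrier Q"
    by force
  moreover have "a_kernel P X p \<times> a_kernel Q Y q = a_kernel (P \<oplus>\<^sub>m Q) (X \<oplus>\<^sub>m Y) (\<lambda>z. (p (fst z), q (snd z)))"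
    by (auto simp: a_kernel_def')
  moreover have "inj_on (\<lambda>z. (i (fst z), j (snd z))) (carrier U \<times> carrier V)"
    using 1(2) 2(2) by (auto simp: inj_on_def)
  ultimately show ?thesis
    unfolding short_exact_def
    by (simp add: 1(3,5) 2(3,5)) (intro conjI hom_pair hom_fst_comp hom_snd_comp 1 2)
qed

lemma rmod_isoI:
  assumes "h \<in> rmod_hom R M N" "k \<in> rmod_hom R N M"
    and "\<forall>x\<in>carrier M. k (h x) = x" "\<forall>y\<in>carrier N. h (k y) = y"
  shows "rmod_iso R M N"
proof -
  have "bij_betw h (carrier M) (carrier N)"
    by (rule bij_betw_byWitness[of _ k]) (use assms hom_closed[OF assms(1)] hom_closed[OF assms(2)] in auto)
  then show ?thesis using assms(1) unfolding rmod_iso_def by blast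
qed

lemma rmod_isoE:
  assumes "rmod_iso R M N" "right_module R M" "right_module R N"
  obtains h k where "h \<in> rmod_hom R M N" "k \<in> rmod_hom R N M"
    "\<forall>x\<in>carrier M. k (h x) = x" "\<forall>y\<in>carrier N. h (k y) = y"
proof -
  obtain h where h: "h \<in> rmod_hom R M N" "inj_on h (carrier M)" "h ` carrier M = carrier N"
    using assms(1) by (auto simp: rmod_iso_def bij_betw_def)
  interpret M: right_module R M by fact
  have "a_kernel M N h \<subseteq> a_kernel M M (\<lambda>x. x)"
    using h(2) hom_zero[OF assms(2,3) h(1)] M.M.zero_closed by (fastforce simp: a_kernel_def' inj_on_def)
  then obtain k where k: "k \<in> rmod_hom R N M" "\<forall>x\<in>carrier M. k (h x) = x"
    using hom_factor[OF assms(2,3,2) h(1,3) hom_id] by blast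
  have "\<forall>y\<in>carrier N. h (k y) = y" unfolding h(3)[symmetric] using k(2) by simp
  then show ?thesis using that h(1) k by blast
qed

text \<open>The isomorphism sends x to (t x, x - s (t x)). The complement is a submodule of
  \<open>E\<close>, so it has the carrier type that the summand rule of \<open>add_closure\<close>
  asks for.\<close>

lemma split_iso:
  assumes E: "right_module R E" and M: "right_module R M"
    and s: "s \<in> rmod_hom R M E" and t: "t \<in> rmod_hom R E M" and ts: "\<And>x. x \<in> carrier M \<Longrightarrow> t (s x) = x"
  shows "rmod_iso R E (M \<oplus>\<^sub>m E\<lparr>carrier := a_kernel E M t\<rparr>)"
proof -
  interpret E: right_module R E by (rule E)
  interpret M: right_module R M by (rule M)
  have sub: "submodule (a_kernel E M t) R E" by (rule kernel_submodule[OF E M t])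
  let ?N = "E\<lparr>carrier := a_kernel E M t\<rparr>"
  have N: "right_module R ?N" by (rule E.submodule_module[OF sub])
  have incl: "(\<lambda>x. x) \<in> rmod_hom R ?N E" by (rule hom_inclusion) (auto simp: a_kernel_def')
  have cl: "s (t x) \<in> carrier E" if "x \<in> carrier E" for x using that by (intro hom_closed[OF s] hom_closed[OF t])
  have "(\<lambda>x. x \<ominus>\<^bsub>E\<^esub> s (t x)) \<in> rmod_hom R E ?N"
  proof (rule hom_codomain_submodule[OF hom_diff[OF E E hom_id hom_comp[OF t s]]])
    fix x assume x: "x \<in> carrier E"
    then show "x \<ominus>\<^bsub>E\<^esub> s (t x) \<in> a_kernel E M t"
      using kernel_eq_iff[OF E M t x cl[OF x]] ts hom_closed[OF t] by simp
  qed
  note h = hom_pair[OF t this]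
  have k: "(\<lambda>z. s (fst z) \<oplus>\<^bsub>E\<^esub> snd z) \<in> rmod_hom R (M \<oplus>\<^sub>m ?N) E"
    by (rule hom_plus[OF right_module_direct_sum[OF M N] E hom_fst_comp[OF s] hom_snd_comp[OF incl]])
  show ?thesis
  proof (rule rmod_isoI[OF h k])
    show "\<forall>x\<in>carrier E. s (fst (t x, x \<ominus>\<^bsub>E\<^esub> s (t x))) \<oplus>\<^bsub>E\<^esub> snd (t x, x \<ominus>\<^bsub>E\<^esub> s (t x)) = x"
      using cl E.minus_add_cancel by (simp add: E.M.a_comm)
    show "\<forall>z\<in>carrier (M \<oplus>\<^sub>m ?N). (t (s (fst z) \<oplus>\<^bsub>E\<^esub> snd z), (s (fst z) \<oplus>\<^bsub>E\<^esub> snd z) \<ominus>\<^bsub>E\<^esub> s (t (s (fst z) \<oplus>\<^bsub>E\<^esub> snd z))) = z"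
    proof
      fix z assume "z \<in> carrier (M \<oplus>\<^sub>m ?N)"
      then obtain x y where z: "z = (x, y)" "x \<in> carrier M" "y \<in> carrier E" "t y = \<zero>\<^bsub>M\<^esub>"
        by (auto simp: a_kernel_def')
      note sx = hom_closed[OF s z(2)]
      have "t (s x \<oplus>\<^bsub>E\<^esub> y) = x" using z sx ts by (simp add: hom_add[OF t])
      moreover have "(s x \<oplus>\<^bsub>E\<^esub> y) \<ominus>\<^bsub>E\<^esub> s x = y"
        using sx z(3) by (simp add: E.M.minus_eq E.M.a_ac E.M.r_neg E.M.r_neg2)
      ultimately show "(t (s (fst z) \<oplus>\<^bsub>E\<^esub> snd z), (s (fst z) \<oplus>\<^bsub>E\<^esub> snd z) \<ominus>\<^bsub>E\<^esub> s (t (s (fst z) \<oplus>\<^bsub>E\<^esub> snd z))) = z"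
        by (simp add: z(1))
    qed
  qed
qed

lemma stable_retract_iso:
  assumes "rmod_iso R M N" "right_module R M" "right_module R N"
  shows "stable_retract R M N" "stable_retract R N M"
proof -
  obtain h k where hk: "h \<in> rmod_hom R M N" "k \<in> rmod_hom R N M"
    "\<forall>x\<in>carrier M. k (h x) = x" "\<forall>y\<in>carrier N. h (k y) = y"
    by (rule rmod_isoE[OF assms])
  show "stable_retract R M N" by (rule stable_retract_of_retract[OF assms(2) hk(1,2)]) (use hk in blast)
  show "stable_retract R N M" by (rule stable_retract_of_retract[OF assms(3) hk(2,1)]) (use hk in blast)
qed

lemma stable_retract_summand:
  assumes "right_module R M" "right_module R N"
  shows "stable_retract R M (M \<oplus>\<^sub>m N)"
  by (rule stable_retract_of_retract[OF assms(1) hom_pair[OF hom_id hom_const_zero[OF assms(2)]] hom_fst]) simp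

section \<open>The subcategory of second syzygies in stable terms\<close>

context fd_algebra
begin

text \<open>The direct sum of two covers presents the direct sum of the modules, with the direct sum
  of the syzygies as kernel. \<open>W\<close> is meant to be a list copy of that module.\<close>

lemma Omega_direct_sum_stable_retract:
  assumes "X \<in> fgmod A" "Y \<in> fgmod A" "W \<in> fgmod A" "stable_retract A (X \<oplus>\<^sub>m Y) W"
  shows "stable_retract A (Omega A X \<oplus>\<^sub>m Omega A Y) (Omega A W)"
proof -
  obtain P :: "'a lmod" and p where P: "projective A P" "short_exact A (Omega A X) (\<lambda>x. x) P p X"
    by (rule Omega_short_exact[OF assms(1)])
  obtain Q :: "'a lmod" and q where Q: "projective A Q" "short_exact A (Omega A Y) (\<lambda>x. x) Q q Y"
    by (rule Omega_short_exact[OF assms(2)])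
  obtain L :: "'a lmod" and l where L: "projective A L" "short_exact A (Omega A W) (\<lambda>x. x) L l W"
    by (rule Omega_short_exact[OF assms(3)])
  show ?thesis
    by (rule syzygy_stable_retract[OF projective_direct_sum[OF P(1) Q(1)] L(1)
        short_exact_direct_sum[OF P(2) Q(2)] L(2) fgmod_direct_sum[OF assms(1,2)] assms(3)
        right_module_direct_sum[OF Omega_module[OF assms(1)] Omega_module[OF assms(2)]]
        Omega_module[OF assms(3)] assms(4)])
qed

text \<open>Stable retracts of second syzygies are closed under sums and summands, and stably zero
  modules are retracts of anything, so induction over the closure applies.\<close>

lemma G2_stable_retract:
  assumes "M \<in> G2 A"
  shows "M \<in> fgmod A \<and> (\<exists>Y\<in>fgmod A :: 'a lmod set. stable_retract A M (Omega A (Omega A Y)))"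
  using assms unfolding G2_def
proof (induction rule: add_closure.induct)
  case (base M)
  then consider "projective A M" | Y :: "'a lmod" where "Y \<in> fgmod A" "M = Omega A (Omega A Y)"
    by (auto simp: fgproj_iff numeral_2_eq_2)
  then show ?case
  proof cases
    case 1
    note fg = projective_fgmod[OF 1]
    have "stable_retract A M (Omega A (Omega A M))"
      by (intro projective_stable_retract[OF 1] Omega_module Omega_fgmod fg)
    then show ?thesis using fg by blast
  next
    case 2
    then show ?thesis using stable_retract_refl Omega_module Omega_fgmod by blast
  qed
next
  case (zero Z)
  interpret Z: right_module A Z using zero(1) by (rule fgmod_right_module)
  interpret \<Omega>: right_module A "Omega A (Omega A Z)" by (intro Omega_module Omega_fgmod zero)
  have "stable_retract A Z (Omega A (Omega A Z))"
    by (rule stable_retract_of_retract[OF Z.right_module_axioms hom_const_zero[OF \<Omega>.right_module_axioms]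
        hom_const_zero[OF Z.right_module_axioms]]) (use zero in auto)
  then show ?case using zero by blast
next
  case (sum M N E)
  obtain X Y :: "'a lmod" where X: "X \<in> fgmod A" "stable_retract A M (Omega A (Omega A X))"
    and Y: "Y \<in> fgmod A" "stable_retract A N (Omega A (Omega A Y))"
    using sum.IH by blast
  have M: "right_module A M" and N: "right_module A N" using sum.IH by (auto intro: fgmod_right_module)
  have E: "right_module A E" by (rule fgmod_right_module[OF sum.hyps(3)])
  note MN = right_module_direct_sum[OF M N]
  obtain W :: "'a lmod" and q r where W: "W \<in> fgmod A" "q \<in> rmod_hom A (X \<oplus>\<^sub>m Y) W" "r \<in> rmod_hom A W (X \<oplus>\<^sub>m Y)"
    "\<forall>x\<in>carrier (X \<oplus>\<^sub>m Y). r (q x) = x"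
    using lmod_copy[OF fgmod_direct_sum[OF X(1) Y(1)]] by blast
  have "stable_retract A (X \<oplus>\<^sub>m Y) W"
    by (rule stable_retract_of_retract[OF right_module_direct_sum[OF fgmod_right_module[OF X(1)] fgmod_right_module[OF Y(1)]] W(2,3)])
      (use W(4) in blast)
  \<comment> \<open>The comparison of sums with syzygies is applied twice, once for each
    \<open>Omega\<close>.\<close>
  then have *: "stable_retract A (Omega A (Omega A X) \<oplus>\<^sub>m Omega A (Omega A Y)) (Omega A (Omega A W))"
    by (intro Omega_direct_sum_stable_retract Omega_fgmod X Y W)
  have "right_module A (Omega A (Omega A X) \<oplus>\<^sub>m Omega A (Omega A Y))"
    by (intro right_module_direct_sum Omega_module Omega_fgmod X Y)
  then have "stable_retract A (M \<oplus>\<^sub>m N) (Omega A (Omega A W))"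
    using stable_retract_trans[OF MN _ stable_retract_direct_sum[OF M N X(2) Y(2)] *] by blast
  then have "stable_retract A E (Omega A (Omega A W))"
    by (rule stable_retract_trans[OF E MN stable_retract_iso(1)[OF sum.hyps(4) E MN]])
  then show ?case using sum.hyps(3) W(1) by blast
next
  case (summand E M N)
  obtain Y :: "'a lmod" where Y: "Y \<in> fgmod A" "stable_retract A E (Omega A (Omega A Y))"
    using summand.IH by blast
  have E: "right_module A E" using summand.IH by (auto intro: fgmod_right_module)
  note M = fgmod_right_module[OF summand.hyps(2)] and N = fgmod_right_module[OF summand.hyps(3)]
  note MN = right_module_direct_sum[OF M N]
  have "stable_retract A M E"
    by (rule stable_retract_trans[OF M MN stable_retract_summand[OF M N] stable_retract_iso(2)[OF summand.hyps(4) E MN]])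
  then have "stable_retract A M (Omega A (Omega A Y))"
    by (rule stable_retract_trans[OF M E _ Y(2)])
  then show ?case using summand.hyps(2) Y(1) by blast
qed

lemma G2_fgmod: "M \<in> G2 A \<Longrightarrow> M \<in> fgmod A"
  using G2_stable_retract by blast

lemma projective_G2: "projective A P \<Longrightarrow> P \<in> G2 A"
  unfolding G2_def by (intro add_closure.base) (simp add: fgproj_iff)

lemma G2_direct_sum:
  assumes "M \<in> G2 A" "N \<in> G2 A" "E \<in> fgmod A" "rmod_iso A E (M \<oplus>\<^sub>m N)"
  shows "E \<in> G2 A"
  using assms unfolding G2_def by (rule add_closure.sum)

lemma stable_retract_G2:
  assumes M: "M \<in> fgmod A" and N: "N \<in> G2 A" and sr: "stable_retract A M N"
  shows "M \<in> G2 A"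
proof -
  note MM = fgmod_right_module[OF M] and NM = fgmod_right_module[OF G2_fgmod[OF N]]
  interpret M: right_module A M by (rule MM)
  obtain P :: "'a lmod" and s t u v where *: "projective A P" "s \<in> rmod_hom A M N" "t \<in> rmod_hom A N M"
    "u \<in> rmod_hom A M P" "v \<in> rmod_hom A P M"
    "\<forall>x\<in>carrier M. t (s x) = x \<oplus>\<^bsub>M\<^esub> v (u x)"
    by (rule stable_retractE[OF sr MM], rule that)
  note NP = right_module_direct_sum[OF NM projective_module[OF *(1)]]
  obtain E :: "'a lmod" and q r where E: "E \<in> fgmod A" "q \<in> rmod_hom A (N \<oplus>\<^sub>m P) E" "r \<in> rmod_hom A E (N \<oplus>\<^sub>m P)"
    "\<forall>x\<in>carrier (N \<oplus>\<^sub>m P). r (q x) = x" "\<forall>x\<in>carrier E. q (r x) = x"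
    using lmod_copy[OF fgmod_direct_sum[OF G2_fgmod[OF N] projective_fgmod[OF *(1)]]] by blast
  have EG: "E \<in> G2 A"
    by (rule G2_direct_sum[OF N projective_G2[OF *(1)] E(1) rmod_isoI[OF E(3,2,5,4)]])
  \<comment> \<open>From t s = 1 + v u it follows that (t, -v) composed with (s, u) is the identity,
    so \<open>M\<close> is an honest direct summand of the sum of \<open>N\<close> and
    \<open>P\<close>.\<close>
  let ?\<sigma> = "\<lambda>x. q (s x, u x)" and ?\<tau> = "\<lambda>e. (\<lambda>z. t (fst z) \<ominus>\<^bsub>M\<^esub> v (snd z)) (r e)"
  have \<sigma>: "?\<sigma> \<in> rmod_hom A M E" by (rule hom_comp[OF hom_pair[OF *(2,4)] E(2)])
  have \<tau>: "?\<tau> \<in> rmod_hom A E M"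
    by (rule hom_comp[OF E(3) hom_diff[OF NP MM hom_fst_comp[OF *(3)] hom_snd_comp[OF *(5)]]])
  have \<tau>\<sigma>: "?\<tau> (?\<sigma> x) = x" if x: "x \<in> carrier M" for x
  proof -
    have "r (q (s x, u x)) = (s x, u x)" using E(4) hom_closed[OF *(2) x] hom_closed[OF *(4) x] by simp
    then show ?thesis
      using x *(6) hom_closed[OF *(5) hom_closed[OF *(4) x]] by (simp add: M.M.minus_eq M.M.a_assoc M.M.r_neg)
  qed
  note EM = fgmod_right_module[OF E(1)]
  have iso: "rmod_iso A E (M \<oplus>\<^sub>m E\<lparr>carrier := a_kernel E M ?\<tau>\<rparr>)"
    by (rule split_iso[OF EM MM \<sigma> \<tau> \<tau>\<sigma>])
  have ker: "E\<lparr>carrier := a_kernel E M ?\<tau>\<rparr> \<in> fgmod A"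
    by (rule fgmod_submodule[OF E(1) kernel_submodule[OF EM MM \<tau>]])
  show ?thesis using EG M ker iso unfolding G2_def by (rule add_closure.summand)
qed

lemma Omega2_G2:
  fixes Y :: "'a lmod"
  assumes "Y \<in> fgmod A"
  shows "Omega A (Omega A Y) \<in> G2 A"
proof -
  have "(Omega A ^^ 2) Y = Omega A (Omega A Y)" by (simp add: numeral_2_eq_2)
  then show ?thesis unfolding G2_def using assms by (intro add_closure.base) auto
qed

lemma G2_iff:
  "M \<in> G2 A \<longleftrightarrow> M \<in> fgmod A \<and> (\<exists>Y\<in>fgmod A :: 'a lmod set. stable_retract A M (Omega A (Omega A Y)))"
  using G2_stable_retract stable_retract_G2 Omega2_G2 by blast

end

section \<open>Delooping levels\<close>

text \<open>A finite bound excludes the empty set, whose infimum is \<infinity>; a nonempty set of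
  extended naturals attains its infimum.\<close>

lemma Inf_enat_le_iff: "Inf {enat n | n. P n} \<le> enat k \<longleftrightarrow> (\<exists>n\<le>k. P n)"
proof
  assume *: "Inf {enat n | n. P n} \<le> enat k"
  have "{enat n | n. P n} \<noteq> {}"
  proof
    assume "{enat n | n. P n} = {}"
    then have "Inf {enat n | n. P n} = \<infinity>" unfolding Inf_enat_def by (rule if_P)
    then show False using * by simp
  qed
  then have "Inf {enat n | n. P n} \<in> {enat n | n. P n}"
    unfolding Inf_enat_def by (auto intro: LeastI)
  then show "\<exists>n\<le>k. P n" using * by auto
next
  assume "\<exists>n\<le>k. P n"
  then obtain n where "n \<le> k" "P n" by blast
  then show "Inf {enat n | n. P n} \<le> enat k" by (intro Inf_lower2[of "enat n"]) auto
qed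

context fd_algebra
begin

lemma dell_two_le_zero_iff:
  fixes L :: "'a lmod"
  assumes "L \<in> fgmod A"
  shows "dell A (Suc (Suc 0)) L \<le> enat 0 \<longleftrightarrow> L \<in> G2 A"
  unfolding dell_def Inf_enat_le_iff G2_iff using assms by simp

text \<open>The case n = 1 is the description of \<G> applied to \<open>Omega A C\<close>. The case
  n = 0 implies it, because \<open>Omega\<close> preserves stable retracts.\<close>

lemma dell_one_le_one_iff:
  fixes C :: "'a lmod"
  assumes "C \<in> fgmod A"
  shows "dell A (Suc 0) C \<le> enat (Suc 0) \<longleftrightarrow> Omega A C \<in> G2 A"
proof -
  have ex: "(\<exists>n\<le>Suc 0. P n) \<longleftrightarrow> P 0 \<or> P (Suc 0)" for P
    by (auto simp: le_Suc_eq)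
  have "stable_retract A (Omega A C) (Omega A (Omega A Y))"
    if "Y \<in> fgmod A" "stable_retract A C (Omega A Y)" for Y :: "'a lmod"
    using that assms by (intro Omega_stable_retract Omega_fgmod)
  then show ?thesis
    unfolding dell_def Inf_enat_le_iff ex G2_iff using Omega_fgmod[OF assms] by auto
qed

lemma exact_resolution_zero_iff:
  "exact_resolution R 0 C d e M \<longleftrightarrow> C 0 \<in> fgmod R \<and> e \<in> rmod_hom R (C 0) M \<and>
     e ` carrier (C 0) = carrier M \<and> a_kernel (C 0) M e = {\<zero>\<^bsub>C 0\<^esub>}"
  by (simp add: exact_resolution_def)

text \<open>At the left end the incoming image is zero, so exactness there says that
  \<open>d 0\<close> is injective.\<close>

lemma exact_resolution_one_iff:
  assumes "right_module R (C 0)" "right_module R (C (Suc 0))"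
  shows "exact_resolution R (Suc 0) C d e M \<longleftrightarrow> C 0 \<in> fgmod R \<and> C (Suc 0) \<in> fgmod R \<and>
     short_exact R (C (Suc 0)) (d 0) (C 0) e M"
proof -
  have inj: "a_kernel (C (Suc 0)) (C 0) (d 0) = {\<zero>\<^bsub>C (Suc 0)\<^esub>} \<longleftrightarrow> inj_on (d 0) (carrier (C (Suc 0)))"
    if d: "d 0 \<in> rmod_hom R (C (Suc 0)) (C 0)"
  proof -
    interpret C0: right_module R "C 0" by fact
    interpret C1: right_module R "C (Suc 0)" by fact
    note z = hom_zero[OF assms(2,1) d]
    show ?thesis
    proof
      assume *: "a_kernel (C (Suc 0)) (C 0) (d 0) = {\<zero>\<^bsub>C (Suc 0)\<^esub>}"
      show "inj_on (d 0) (carrier (C (Suc 0)))"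
        by (rule inj_onI) (use kernel_eq_iff[OF assms(2,1) d] C1.minus_eq_zero * in auto)
    next
      assume "inj_on (d 0) (carrier (C (Suc 0)))"
      then show "a_kernel (C (Suc 0)) (C 0) (d 0) = {\<zero>\<^bsub>C (Suc 0)\<^esub>}"
        using z C1.M.zero_closed by (fastforce simp: a_kernel_def' inj_on_def)
    qed
  qed
  have all: "(\<forall>i\<le>Suc 0. P i) \<longleftrightarrow> P 0 \<and> P (Suc 0)" for P by (auto simp: le_Suc_eq)
  show ?thesis
    unfolding exact_resolution_def short_exact_def Let_def all using inj by auto
qed

lemma ddell_le_one_iff:
  fixes M :: "('a, 'm) module"
  assumes M: "M \<in> fgmod A"
  shows "ddell A M \<le> 1 \<longleftrightarrow>
    (\<exists>L C f g. L \<in> G2 A \<and> C \<in> fgmod A \<and> Omega A C \<in> G2 A \<and>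
      short_exact A (L :: 'a lmod) f (C :: 'a lmod) g M)" (is "_ \<longleftrightarrow> ?R")
proof
  assume "ddell A M \<le> 1"
  then obtain m n C d e where mn: "m \<le> Suc 0" "n \<le> m" and ex: "exact_resolution A n C d e M"
    and dell: "\<forall>i\<le>n. dell A (i + 1) (C i) \<le> enat (m - i)"
    unfolding ddell_def one_enat_def Inf_enat_le_iff by auto
  have C: "C i \<in> fgmod A" if "i \<le> n" for i using ex that by (auto simp: exact_resolution_def Let_def)
  have "dell A (Suc 0) (C 0) \<le> enat m" using dell[rule_format, of 0] by simp
  \<comment> \<open>The value m = 0 is not excluded; its stronger bound on \<open>C 0\<close> is
    relaxed to 1.\<close>
  also have "\<dots> \<le> enat (Suc 0)" using mn by simp
  finally have \<Omega>C: "Omega A (C 0) \<in> G2 A" using dell_one_le_one_iff[OF C] by simp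
  note C0 = fgmod_right_module[OF C[OF le0]]
  show ?R
  proof (cases n)
    case 0
    note Z = zero_lmod[OF right_module.axioms(1)[OF C0]]
    have e: "e \<in> rmod_hom A (C 0) M" "e ` carrier (C 0) = carrier M" "a_kernel (C 0) M e = {\<zero>\<^bsub>C 0\<^esub>}"
      using ex unfolding 0 exact_resolution_zero_iff by auto
    \<comment> \<open>A resolution of length 0 is an isomorphism, completed to a short exact
      sequence by a zero kernel.\<close>
    have "short_exact A (zero_lmod :: 'a lmod) (\<lambda>_. \<zero>\<^bsub>C 0\<^esub>) (C 0) e M"
      unfolding short_exact_def using e Z(2) hom_const_zero[OF C0] by auto
    then show ?thesis using projective_G2[OF Z(1)] C[OF le0] \<Omega>C by blast
  next
    case (Suc n')
    \<comment> \<open>Length 1 forces m = 1, so the bound m - 1 on the delooping level of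
      \<open>C 1\<close> is 0.\<close>
    then have n: "n = Suc 0" "m = Suc 0" using mn by auto
    have C1: "C (Suc 0) \<in> fgmod A" using C n by simp
    have "dell A (Suc (Suc 0)) (C (Suc 0)) \<le> enat 0" using dell[rule_format, of "Suc 0"] n by simp
    then have "C (Suc 0) \<in> G2 A" using dell_two_le_zero_iff[OF C1] by simp
    moreover have "short_exact A (C (Suc 0)) (d 0) (C 0) e M"
      using ex exact_resolution_one_iff[OF C0 fgmod_right_module[OF C1]] unfolding n by blast
    ultimately show ?thesis using C[OF le0] \<Omega>C by blast
  qed
next
  assume ?R
  then obtain L C f g where *: "L \<in> G2 A" "C \<in> fgmod A" "Omega A C \<in> G2 A"
    "short_exact A (L :: 'a lmod) f (C :: 'a lmod) g M" by blast
  note L = G2_fgmod[OF *(1)]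
  let ?C = "\<lambda>i::nat. if i = 0 then C else L"
  have "exact_resolution A (Suc 0) ?C (\<lambda>_. f) g M"
    using exact_resolution_one_iff[of A ?C "\<lambda>_. f" g M] * L by (simp add: fgmod_right_module)
  moreover have "\<forall>i\<le>Suc 0. dell A (i + 1) (?C i) \<le> enat (Suc 0 - i)"
    using dell_one_le_one_iff[OF *(2)] dell_two_le_zero_iff[OF L] * by (auto simp: le_Suc_eq)
  ultimately show "ddell A M \<le> 1"
    unfolding ddell_def one_enat_def Inf_enat_le_iff
    by (intro exI[of _ "Suc 0"] exI[of _ ?C] exI[of _ "\<lambda>_. f"] exI[of _ g] conjI) auto
qed

text \<open>
  With projective covers \<open>\<pi>\<close> of \<open>C\<close> and \<open>p\<close> of \<open>M\<close>, the kernel \<open>W\<close> of \<open>g \<circ> \<pi>\<close> is an extension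
  of \<open>L\<close> by \<open>\<Omega> C\<close>. Schanuel's isomorphism \<open>\<Omega> M \<oplus> PC \<cong> W \<oplus> PM\<close> is built into the map \<open>G\<close> below.
\<close>
lemma syzygy_extension:
  fixes M :: "('a, 'm) module" and L C :: "'a lmod"
  assumes M: "M \<in> fgmod A" and L: "L \<in> G2 A" and C: "C \<in> fgmod A" and \<Omega>C: "Omega A C \<in> G2 A"
    and se: "short_exact A L f C g M"
  shows "\<exists>Q\<in>fgproj A. Omega A M \<oplus>\<^sub>m Q \<in> extensions A (G2 A) (G2 A)"
proof -
  note Lfg = G2_fgmod[OF L]
  note MM = fgmod_right_module[OF M] and LM = fgmod_right_module[OF Lfg] and CM = fgmod_right_module[OF C]
  obtain PC :: "'a lmod" and \<pi> where PC: "projective A PC" "short_exact A (Omega A C) (\<lambda>x. x) PC \<pi> C"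
    by (rule Omega_short_exact[OF C])
  obtain PM :: "'a lmod" and p where PM: "projective A PM" "short_exact A (Omega A M) (\<lambda>x. x) PM p M"
    by (rule Omega_short_exact[OF M])
  note PCM = projective_module[OF PC(1)] and PMM = projective_module[OF PM(1)]
  note \<Omega>MM = Omega_module[OF M] and \<Omega>CM = Omega_module[OF C]
  interpret PC: right_module A PC by (rule PCM)
  interpret PM: right_module A PM by (rule PMM)
  interpret C: right_module A C by (rule CM)
  interpret M: right_module A M by (rule MM)
  interpret L: right_module A L by (rule LM)
  have f: "f \<in> rmod_hom A L C" "inj_on f (carrier L)" "f ` carrier L = a_kernel C M g"
    and g: "g \<in> rmod_hom A C M" "g ` carrier C = carrier M"
    using se by (auto simp: short_exact_def)
  have \<pi>: "\<pi> \<in> rmod_hom A PC C" "\<pi> ` carrier PC = carrier C" "carrier (Omega A C) = a_kernel PC C \<pi>"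
    "(\<lambda>x. x) \<in> rmod_hom A (Omega A C) PC"
    using PC(2) by (auto simp: short_exact_def)
  have p: "p \<in> rmod_hom A PM M" "p ` carrier PM = carrier M" "carrier (Omega A M) = a_kernel PM M p"
    "(\<lambda>x. x) \<in> rmod_hom A (Omega A M) PM"
    using PM(2) by (auto simp: short_exact_def)
  have gf: "g (f l) = \<zero>\<^bsub>M\<^esub>" if "l \<in> carrier L" for l using that f(3) by (auto simp: a_kernel_def')
  have g\<pi>: "(\<lambda>x. g (\<pi> x)) \<in> rmod_hom A PC M" by (rule hom_comp[OF \<pi>(1) g(1)])
  have g\<pi>_surj: "(\<lambda>x. g (\<pi> x)) ` carrier PC = carrier M" using g(2) \<pi>(2) by (metis image_image)
  \<comment> \<open>\<open>\<beta>\<close> and \<open>\<alpha>\<close> compare the two presentations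
    of \<open>M\<close>, by \<open>PC\<close> and by \<open>PM\<close>, in the two
    directions.\<close>
  obtain \<beta> where \<beta>: "\<beta> \<in> rmod_hom A PC PM" "\<forall>x\<in>carrier PC. p (\<beta> x) = g (\<pi> x)"
    using projective_lift[OF PC(1) projective_fgmod[OF PM(1)] M p(1,2) g\<pi>] by blast
  obtain \<alpha> where \<alpha>: "\<alpha> \<in> rmod_hom A PM PC" "\<forall>x\<in>carrier PM. g (\<pi> (\<alpha> x)) = p x"
    using projective_lift[OF PM(1) projective_fgmod[OF PC(1)] M g\<pi> g\<pi>_surj p(1)] by blast
  let ?E = "Omega A M \<oplus>\<^sub>m PC"
  have EM: "right_module A ?E" by (rule right_module_direct_sum[OF \<Omega>MM PCM])
  \<comment> \<open>The pair (w, \<theta>) is Schanuel's map: \<open>w\<close> lands in the kernel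
    of g \<pi> and \<open>\<theta>\<close> in \<open>PM\<close>. The inverse sends (w, y) to the
    pair with second component q = w + \<alpha> y and first component y - \<beta> q.\<close>
  define \<theta> where "\<theta> z = fst z \<oplus>\<^bsub>PM\<^esub> \<beta> (snd z)" for z
  define w where "w z = snd z \<ominus>\<^bsub>PC\<^esub> \<alpha> (\<theta> z)" for z
  have \<theta>: "\<theta> \<in> rmod_hom A ?E PM"
    unfolding \<theta>_def by (rule hom_plus[OF EM PMM hom_fst_comp[OF p(4)] hom_snd_comp[OF \<beta>(1)]])
  have w: "w \<in> rmod_hom A ?E PC"
    unfolding w_def by (rule hom_diff[OF EM PCM hom_snd hom_comp[OF \<theta> \<alpha>(1)]])
  have "g (\<pi> (w z)) = \<zero>\<^bsub>M\<^esub>" if "z \<in> carrier ?E" for z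
  proof -
    obtain u q where z: "z = (u, q)" "u \<in> carrier PM" "p u = \<zero>\<^bsub>M\<^esub>" "q \<in> carrier PC"
      using \<open>z \<in> carrier ?E\<close> by (auto simp: p(3) a_kernel_def')
    have c: "\<theta> z \<in> carrier PM" "\<alpha> (\<theta> z) \<in> carrier PC"
      using hom_closed[OF \<theta> \<open>z \<in> carrier ?E\<close>] hom_closed[OF \<alpha>(1)] by auto
    have "g (\<pi> (w z)) = g (\<pi> q) \<ominus>\<^bsub>M\<^esub> p (\<theta> z)"
      using z c \<alpha>(2) by (simp add: w_def hom_minus[OF PCM MM g\<pi>])
    also have "p (\<theta> z) = g (\<pi> q)"
      using z \<beta>(2) hom_closed[OF \<beta>(1)] hom_closed[OF g\<pi>] by (simp add: \<theta>_def hom_add[OF p(1)])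
    finally show ?thesis using hom_closed[OF g\<pi>] z by (simp add: M.minus_eq_zero)
  qed
  \<comment> \<open>As \<pi> w lies in the kernel of \<open>g\<close>, it comes from
    \<open>L\<close>. Thus \<open>l\<close> is Schanuel's map followed by the projection of the
    kernel of g \<pi> onto \<open>L\<close>.\<close>
  then obtain l where l: "l \<in> rmod_hom A ?E L" "\<forall>z\<in>carrier ?E. f (l z) = \<pi> (w z)"
    using short_exact_lift[OF LM CM EM se hom_comp[OF w \<pi>(1)]] by blast
  \<comment> \<open>On \<open>Omega A C\<close> the first component of the embedding must be minus
    \<open>\<beta>\<close>, so that \<open>\<theta>\<close> vanishes on its image.\<close>
  have "p (\<zero>\<^bsub>PM\<^esub> \<ominus>\<^bsub>PM\<^esub> \<beta> x) = \<zero>\<^bsub>M\<^esub>" if "x \<in> carrier (Omega A C)" for x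
  proof -
    have "x \<in> carrier PC" "\<pi> x = \<zero>\<^bsub>C\<^esub>" using that by (auto simp: \<pi>(3) a_kernel_def')
    then show ?thesis using \<beta>(2) hom_closed[OF \<beta>(1)]
      by (simp add: hom_minus[OF PMM MM p(1)] hom_zero[OF PMM MM p(1)] hom_zero[OF CM MM g(1)] M.minus_eq_zero)
  qed
  then obtain k where k: "k \<in> rmod_hom A (Omega A C) (Omega A M)"
    "\<forall>x\<in>carrier (Omega A C). k x = \<zero>\<^bsub>PM\<^esub> \<ominus>\<^bsub>PM\<^esub> \<beta> x"
    using short_exact_lift[OF \<Omega>MM PMM \<Omega>CM PM(2)
        hom_diff[OF \<Omega>CM PMM hom_const_zero[OF PMM] hom_comp[OF \<pi>(4) \<beta>(1)]]] by blast
  obtain V :: "'a lmod" and i r where V: "V \<in> fgmod A" "i \<in> rmod_hom A (L \<oplus>\<^sub>m PM) V" "r \<in> rmod_hom A V (L \<oplus>\<^sub>m PM)"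
    "\<forall>x\<in>carrier (L \<oplus>\<^sub>m PM). r (i x) = x" "\<forall>x\<in>carrier V. i (r x) = x"
    using lmod_copy[OF fgmod_direct_sum[OF Lfg projective_fgmod[OF PM(1)]]] by blast
  have VG: "V \<in> G2 A"
    by (rule G2_direct_sum[OF L projective_G2[OF PM(1)] V(1) rmod_isoI[OF V(3,2,5,4)]])
  note VM = fgmod_right_module[OF V(1)]
  note LPM = right_module_direct_sum[OF LM PMM]
  let ?F = "\<lambda>x. (k x, x)" and ?G = "\<lambda>z. i (l z, \<theta> z)"
  have F: "?F \<in> rmod_hom A (Omega A C) ?E" by (rule hom_pair[OF k(1) \<pi>(4)])
  have G: "?G \<in> rmod_hom A ?E V" by (rule hom_comp[OF hom_pair[OF l(1) \<theta>] V(2)])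
  have G_zero: "?G z = \<zero>\<^bsub>V\<^esub> \<longleftrightarrow> l z = \<zero>\<^bsub>L\<^esub> \<and> \<theta> z = \<zero>\<^bsub>PM\<^esub>" if z: "z \<in> carrier ?E" for z
  proof -
    have "?G z = \<zero>\<^bsub>V\<^esub> \<longleftrightarrow> (l z, \<theta> z) = \<zero>\<^bsub>L \<oplus>\<^sub>m PM\<^esub>"
      using V(4) hom_closed[OF l(1) z] hom_closed[OF \<theta> z] hom_zero[OF LPM VM V(2)]
      hom_zero[OF VM LPM V(3)]
      by (metis (no_types, lifting) SigmaI direct_sum_simps(1))
    then show ?thesis by simp
  qed
  have ker: "?F ` carrier (Omega A C) = a_kernel ?E V ?G"
  proof (intro equalityI subsetI)
    fix z assume "z \<in> ?F ` carrier (Omega A C)"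
    then obtain x where x: "x \<in> carrier (Omega A C)" "z = (k x, x)" by blast
    have xC: "x \<in> carrier PC" "\<pi> x = \<zero>\<^bsub>C\<^esub>" using x(1) by (auto simp: \<pi>(3) a_kernel_def')
    have z: "z \<in> carrier ?E" using hom_closed[OF F x(1)] x(2) by simp
    have "\<theta> z = \<zero>\<^bsub>PM\<^esub>"
      using x xC k(2) hom_closed[OF \<beta>(1)] by (simp add: \<theta>_def PM.minus_add_cancel)
    moreover from this have "w z = x"
      using x xC by (simp add: w_def hom_zero[OF PMM PCM \<alpha>(1)] PC.M.minus_eq)
    then have "f (l z) = f \<zero>\<^bsub>L\<^esub>"
      using l(2)[rule_format, OF z] xC by (simp add: hom_zero[OF LM CM f(1)])
    then have "l z = \<zero>\<^bsub>L\<^esub>" using f(2) hom_closed[OF l(1) z] by (auto simp: inj_on_def)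
    ultimately show "z \<in> a_kernel ?E V ?G" using G_zero[OF z] z by (simp add: a_kernel_def')
  next
    fix z assume "z \<in> a_kernel ?E V ?G"
    then have z: "z \<in> carrier ?E" "l z = \<zero>\<^bsub>L\<^esub>" "\<theta> z = \<zero>\<^bsub>PM\<^esub>" using G_zero by (auto simp: a_kernel_def')
    obtain u q where uq: "z = (u, q)" "u \<in> carrier PM" "q \<in> carrier PC"
      using z(1) by (auto simp: p(3) a_kernel_def')
    have "w z = q" using uq z(3) by (simp add: w_def hom_zero[OF PMM PCM \<alpha>(1)] PC.M.minus_eq)
    then have "\<pi> q = \<zero>\<^bsub>C\<^esub>" using l(2) z hom_zero[OF LM CM f(1)] by metis
    then have q: "q \<in> carrier (Omega A C)" using uq by (simp add: \<pi>(3) a_kernel_def')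
    have "u \<oplus>\<^bsub>PM\<^esub> \<beta> q = \<zero>\<^bsub>PM\<^esub>" using z(3) uq by (simp add: \<theta>_def)
    then have "u = \<zero>\<^bsub>PM\<^esub> \<ominus>\<^bsub>PM\<^esub> \<beta> q"
      using uq hom_closed[OF \<beta>(1) uq(3)] PM.M.minus_equality[of u "\<beta> q"] by (simp add: PM.M.minus_eq)
    then show "z \<in> ?F ` carrier (Omega A C)" using q k(2) uq by auto
  qed
  have surj: "?G ` carrier ?E = carrier V"
  proof
    show "?G ` carrier ?E \<subseteq> carrier V" using hom_closed[OF G] by auto
    show "carrier V \<subseteq> ?G ` carrier ?E"
    proof
      fix v assume v: "v \<in> carrier V"
      obtain x y where xy: "r v = (x, y)" "x \<in> carrier L" "y \<in> carrier PM"
        using hom_closed[OF V(3) v] by auto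
      obtain q0 where q0: "q0 \<in> carrier PC" "\<pi> q0 = f x"
        using \<pi>(2) hom_closed[OF f(1) xy(2)] by (metis imageE)
      \<comment> \<open>These are the inverse Schanuel formulas, applied to \<open>y\<close> and to
        a preimage \<open>q0\<close> of \<open>f x\<close> under \<open>\<pi>\<close>.\<close>
      define q where "q = q0 \<oplus>\<^bsub>PC\<^esub> \<alpha> y"
      define u where "u = y \<ominus>\<^bsub>PM\<^esub> \<beta> q"
      note \<alpha>y = hom_closed[OF \<alpha>(1) xy(3)]
      have q: "q \<in> carrier PC" using q0 \<alpha>y by (simp add: q_def)
      note \<beta>q = hom_closed[OF \<beta>(1) q]
      have u: "u \<in> carrier PM" using xy \<beta>q by (simp add: u_def)
      have "g (\<pi> q) = p y"
        using q0 \<alpha>y \<alpha>(2) xy hom_closed[OF p(1)] gf by (simp add: q_def hom_add[OF g\<pi>])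
      then have "p u = \<zero>\<^bsub>M\<^esub>"
        using xy \<beta>q \<beta>(2) q hom_closed[OF p(1)] by (simp add: u_def hom_minus[OF PMM MM p(1)] M.minus_eq_zero)
      then have z: "(u, q) \<in> carrier ?E" using u q by (simp add: p(3) a_kernel_def')
      have \<theta>z: "\<theta> (u, q) = y" using xy \<beta>q by (simp add: \<theta>_def u_def PM.minus_add_cancel)
      then have "w (u, q) = q0"
        using q0 \<alpha>y by (simp add: w_def q_def PC.M.minus_eq PC.M.a_assoc PC.M.r_neg)
      then have "f (l (u, q)) = f x" using l(2) z q0 by simp
      then have "l (u, q) = x" using f(2) hom_closed[OF l(1) z] xy by (auto simp: inj_on_def)
      then have "v = ?G (u, q)" using \<theta>z V(5)[rule_format, OF v] unfolding xy(1) by simp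
      then show "v \<in> ?G ` carrier ?E" using z by (rule image_eqI)
    qed
  qed
  have "inj_on ?F (carrier (Omega A C))" by (auto simp: inj_on_def)
  then have "short_exact A (Omega A C) ?F ?E ?G V"
    unfolding short_exact_def using F G ker surj by blast
  moreover have "?E \<in> fgmod A" by (intro fgmod_direct_sum Omega_fgmod M projective_fgmod PC)
  ultimately have "?E \<in> extensions A (G2 A) (G2 A)"
    unfolding extensions_def using \<Omega>C VG by blast
  then show ?thesis using PC(1) fgproj_iff by blast
qed

text \<open>The converse embeds \<open>U \<subseteq> \<Omega> M \<oplus> Q \<subseteq> PM \<oplus> Q\<close> and takes \<open>C = (PM \<oplus> Q) / U\<close>.\<close>
lemma extension_syzygy:
  fixes M :: "('a, 'm) module" and Q :: "'a lmod"
  assumes M: "M \<in> fgmod A" and Q: "Q \<in> fgproj A" and ext: "Omega A M \<oplus>\<^sub>m Q \<in> extensions A (G2 A) (G2 A)"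
  shows "\<exists>L C f g. L \<in> G2 A \<and> C \<in> fgmod A \<and> Omega A C \<in> G2 A \<and>
      short_exact A (L :: 'a lmod) f (C :: 'a lmod) g M"
proof -
  let ?E = "Omega A M \<oplus>\<^sub>m Q"
  obtain U V f g where U: "U \<in> G2 A" and V: "V \<in> G2 A" and se: "short_exact A U f ?E g V"
    using ext unfolding extensions_def by blast
  obtain PM :: "'a lmod" and p where PM: "projective A PM" "short_exact A (Omega A M) (\<lambda>x. x) PM p M"
    by (rule Omega_short_exact[OF M])
  have Qp: "projective A Q" using Q by (simp add: fgproj_iff)
  let ?P = "PM \<oplus>\<^sub>m Q"
  have P: "projective A ?P" by (rule projective_direct_sum[OF PM(1) Qp])
  note MM = fgmod_right_module[OF M] and UM = fgmod_right_module[OF G2_fgmod[OF U]]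
    and VM = fgmod_right_module[OF G2_fgmod[OF V]]
  note PMod = projective_module[OF P] and QM = projective_module[OF Qp] and PMM = projective_module[OF PM(1)]
  have EM: "right_module A ?E" by (rule right_module_direct_sum[OF Omega_module[OF M] QM])
  interpret Q: right_module A Q by (rule QM)
  have f: "f \<in> rmod_hom A U ?E" "inj_on f (carrier U)" "f ` carrier U = a_kernel ?E V g"
    and g: "g \<in> rmod_hom A ?E V" "g ` carrier ?E = carrier V"
    using se by (auto simp: short_exact_def)
  have p: "p \<in> rmod_hom A PM M" "p ` carrier PM = carrier M" "carrier (Omega A M) = a_kernel PM M p"
    "(\<lambda>x. x) \<in> rmod_hom A (Omega A M) PM"
    using PM(2) by (auto simp: short_exact_def)
  have \<iota>: "(\<lambda>z. z) \<in> rmod_hom A ?E ?P"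
    using hom_pair[OF hom_fst_comp[OF p(4)] hom_snd] by simp
  have E: "z \<in> carrier ?E \<longleftrightarrow> z \<in> carrier ?P \<and> p (fst z) = \<zero>\<^bsub>M\<^esub>" for z
    by (cases z) (auto simp: p(3) a_kernel_def')
  have fP: "f \<in> rmod_hom A U ?P" by (rule hom_comp[OF f(1) \<iota>])
  obtain C :: "'a lmod" and q where C: "C \<in> fgmod A" "q \<in> rmod_hom A ?P C" "q ` carrier ?P = carrier C"
    "a_kernel ?P C q = f ` carrier U"
    using quotient_lmod[OF projective_fgmod[OF P] image_submodule[OF UM PMod fP]] by blast
  note CM = fgmod_right_module[OF C(1)]
  have seC: "short_exact A U f ?P q C" unfolding short_exact_def using fP C f by auto
  obtain PC :: "'a lmod" and \<pi> where PC: "projective A PC" "short_exact A (Omega A C) (\<lambda>x. x) PC \<pi> C"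
    by (rule Omega_short_exact[OF C(1)])
  \<comment> \<open>Both \<open>U\<close> and \<open>Omega A C\<close> are kernels of epimorphisms
    from projectives onto \<open>C\<close>, so they agree stably.\<close>
  have "stable_retract A (Omega A C) U"
    by (rule syzygy_stable_retract[OF PC(1) P PC(2) seC C(1) C(1) Omega_module[OF C(1)] UM stable_retract_refl[OF CM]])
  then have \<Omega>C: "Omega A C \<in> G2 A" by (rule stable_retract_G2[OF Omega_fgmod[OF C(1)] U])
  have fU: "z \<in> carrier ?E" if "z \<in> f ` carrier U" for z using that hom_closed[OF f(1)] by auto
  have pP: "(\<lambda>z. p (fst z)) \<in> rmod_hom A ?P M" by (rule hom_fst_comp[OF p(1)])
  \<comment> \<open>\<open>U\<close> lies inside \<open>?E\<close>, the kernel of the composite of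
    \<open>fst\<close> and \<open>p\<close>, so this composite descends to a map \<open>k\<close>
    from \<open>C\<close> onto \<open>M\<close>.\<close>
  have "a_kernel ?P C q \<subseteq> a_kernel ?P M (\<lambda>z. p (fst z))"
    using fU E unfolding C(4) by (auto simp: a_kernel_def')
  then obtain k where k: "k \<in> rmod_hom A C M" "\<forall>z\<in>carrier ?P. k (q z) = p (fst z)"
    using hom_factor[OF PMod CM MM C(2,3) pP] by blast
  \<comment> \<open>\<open>V\<close> is \<open>?E\<close> modulo \<open>U\<close>, and
    \<open>l\<close> is its embedding into \<open>?P\<close> modulo \<open>U\<close>; the image is
    the kernel of \<open>k\<close>.\<close>
  have "a_kernel ?E V g \<subseteq> a_kernel ?E C q"
    using fU C(4) unfolding f(3)[symmetric] by (auto simp: a_kernel_def')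
  then obtain l where l: "l \<in> rmod_hom A V C" "\<forall>z\<in>carrier ?E. l (g z) = q z"
    using hom_factor[OF EM VM CM g hom_comp[OF \<iota> C(2)]] by blast
  have "inj_on l (carrier V)"
  proof (rule inj_onI)
    fix v v' assume v: "v \<in> carrier V" "v' \<in> carrier V" "l v = l v'"
    obtain z z' where z: "z \<in> carrier ?E" "z' \<in> carrier ?E" "v = g z" "v' = g z'"
      using v(1,2) unfolding g(2)[symmetric] by blast
    have "q z = q z'"
      using v(3) unfolding z(3,4) l(2)[rule_format, OF z(1)] l(2)[rule_format, OF z(2)] .
    then have "z \<ominus>\<^bsub>?P\<^esub> z' \<in> f ` carrier U"
      using kernel_eq_iff[OF PMod CM C(2), of z z'] z E unfolding C(4) by blast
    then have "z \<ominus>\<^bsub>?E\<^esub> z' \<in> a_kernel ?E V g"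
      using hom_minus[OF EM PMod \<iota> z(1,2)] f(3) by simp
    then show "v = v'" using kernel_eq_iff[OF EM VM g(1) z(1,2)] z by simp
  qed
  moreover have "l ` carrier V = a_kernel C M k"
  proof -
    have "l ` carrier V = q ` carrier ?E" unfolding g(2)[symmetric] image_image
      by (rule image_cong[OF refl]) (rule l(2)[rule_format])
    also have "\<dots> = a_kernel C M k"
    proof (intro equalityI subsetI)
      fix c assume "c \<in> q ` carrier ?E"
      then obtain z where z: "c = q z" "z \<in> carrier ?E" by (rule imageE)
      then have zP: "z \<in> carrier ?P" "p (fst z) = \<zero>\<^bsub>M\<^esub>" using E by blast+
      then show "c \<in> a_kernel C M k"
        using z(1) k(2)[rule_format, OF zP(1)] hom_closed[OF C(2) zP(1)] by (simp add: a_kernel_def')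
    next
      fix c assume c: "c \<in> a_kernel C M k"
      then have "c \<in> q ` carrier ?P" unfolding C(3) by (simp add: a_kernel_def')
      then obtain z where z: "c = q z" "z \<in> carrier ?P" by (rule imageE)
      have "p (fst z) = \<zero>\<^bsub>M\<^esub>"
        using c k(2)[rule_format, OF z(2)] z(1) by (simp add: a_kernel_def')
      then have "z \<in> carrier ?E" using z(2) E by blast
      then show "c \<in> q ` carrier ?E" using z(1) by blast
    qed
    finally show ?thesis .
  qed
  moreover have "k ` carrier C = carrier M"
  proof
    show "k ` carrier C \<subseteq> carrier M" using hom_closed[OF k(1)] by auto
    show "carrier M \<subseteq> k ` carrier C"
    proof
      fix m assume "m \<in> carrier M"
      then obtain x where x: "x \<in> carrier PM" "m = p x" unfolding p(2)[symmetric] by blast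
      then have "(x, \<zero>\<^bsub>Q\<^esub>) \<in> carrier ?P" by simp
      then show "m \<in> k ` carrier C"
        using k(2) x hom_closed[OF C(2)] by (intro image_eqI[of _ _ "q (x, \<zero>\<^bsub>Q\<^esub>)"]) auto
    qed
  qed
  ultimately have "short_exact A V l C k M" unfolding short_exact_def using l(1) k(1) by blast
  then show ?thesis using V C(1) \<Omega>C by blast
qed

end

theorem theorem2p4:
  fixes K :: "('k, 'z) ring_scheme"
    and A :: "('k, 'a) module"
    and M :: "('a, 'm) module"
  assumes "fd_algebra K A"
    and "M \<in> fgmod A"
  shows "(ddell A M \<le> 1 \<longleftrightarrow>
            (\<exists>L C f g. L \<in> G2 A \<and> C \<in> fgmod A \<and> Omega A C \<in> G2 A \<and>
               short_exact A (L :: 'a lmod) f (C :: 'a lmod) g M)) \<and>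
         ((\<exists>L C f g. L \<in> G2 A \<and> C \<in> fgmod A \<and> Omega A C \<in> G2 A \<and>
               short_exact A (L :: 'a lmod) f (C :: 'a lmod) g M) \<longleftrightarrow>
            (\<exists>Q \<in> fgproj A. Omega A M \<oplus>\<^sub>m Q \<in> extensions A (G2 A) (G2 A)))"
proof -
  interpret fd_algebra K A by fact
  show ?thesis
    using ddell_le_one_iff[OF assms(2)] syzygy_extension[OF assms(2)] extension_syzygy[OF assms(2)] by blast
qed

end
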